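(* Let $\alpha\in(0,1)$. Suppose that the quasilinear problem $$\partial_t^\alpha u+\mathcal Qu+f(x,t,u)=0\ \text{ in }\Omega\times(0,T],\qquad u=0\ \text{ on }\partial\Omega\times(0,T],\qquad u(\cdot,0)=u_0\ \text{ in }\Omega,$$ with $$\mathcal Qu:=-\sum_{k=1}^d\partial_{x_k}\bigl\{a_k(x,t,u)\,\partial_{x_k}u+b_k(x,t,u)\bigr\},$$ where for some constants $\bar c_a\ge c_a>0$, $C_a\ge0$, $C_b\ge0$, $\lambda_0\ge0$ and all $x\in\Omega$, $t>0$, $v,w\in\mathbb{R}$, $k=1,\dots,d$, $$c_a\le a_k(x,t,v)\le\bar c_a,\quad |a_k(x,t,v)-a_k(x,t,w)|\le C_a|v-w|,\quad |b_k(x,t,v)-b_k(x,t,w)|\le C_b|v-w|,$$ $$f(x,t,v)-f(x,t,w)\ge-\lambda_0[v-w]\quad\text{whenever }v\ge w,$$ has a unique solution $u$, which satisfies $\|\partial_t^lu(\cdot,t)\|_{L_2(\Omega)}\lesssim1+t^{\sigma-l}$ for $l=0,1,2$, $t\in(0,T]$, with some constant $\sigma\in(0,1)\cup(1,2)$, and $\|\nabla u(\cdot,t)\|_{L_\infty(\Omega)}\le C_u$ for all $t\in[0,T]$ for some constant $C_u$. Let the temporal meshes be quasi-graded with some $r\ge1$ and satisfy $\lambda\tau_j^\alpha<\{\Gamma(2-\alpha)\}^{-1}$ for all $j\ge1$, where $$\lambda:=\lambda_0+\frac{(C_aC_u+C_b\sqrt d)^2}{4c_a}.$$ Then a solution $U^m\in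 H^1_0(\Omega)$, $m=1,\dots,M$, of the semidiscretization $$\delta_t^\alpha U^m+\mathcal Q^mU^m+f(\cdot,t_m,U^m)=0\ \text{ in }\Omega,\quad U^m=0\ \text{on }\partial\Omega,\quad m\ge1,\qquad U^0=u_0,$$ where $\mathcal Q^m:=\mathcal Q|_{t=t_m}$, satisfies $$\|u(\cdot,t_m)-U^m\|_{L_2(\Omega)}\lesssim\mathcal E^m\qquad\forall\,m=1,\dots,M,$$ where, with $\nu:=1+\sigma-\alpha$, $$\mathcal E^m:=\begin{cases}M^{-\nu r}\,t_m^{\alpha-1}&\text{if }1\le r<\frac{2-\alpha}{\nu},\\[2pt] M^{-(2-\alpha)}\,t_m^{\alpha-1}\,[1+\ln(t_m/t_1)]&\text{if }r=\frac{2-\alpha}{\nu}\ge1,\\[2pt] M^{-(2-\alpha)}\,t_m^{\sigma-\frac{2-\alpha}{r}}&\text{if }r>\frac{2-\alpha}{\nu}.\end{cases}$$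
   Context: $\Omega\subset\mathbb{R}^d$, $d\in\{1,2,3\}$, is a bounded Lipschitz domain, $T>0$. The function $f(x,t,s)$ is continuous in $s$ and $f(\cdot,t,s)\in L_\infty(\Omega)$ for all $t>0$, $s\in\mathbb{R}$. The Caputo derivative is $\partial_t^\alpha u(\cdot,t):=\frac1{\Gamma(1-\alpha)}\int_0^t(t-s)^{-\alpha}\partial_su(\cdot,s)\,ds$. The elliptic equations for $U^m$ are understood in the weak sense. A temporal mesh is $0=t_0<t_1<\dots<t_M=T$, with $\tau_j:=t_j-t_{j-1}$ and $\tau:=t_1$; one such mesh is considered for each $M$. The meshes are quasi-graded with grading parameter $r\ge1$ if there are positive constants $c_1,c_2,c_3$, independent of $M$ and $j$, such that $c_1M^{-r}\le\tau\le c_2M^{-r}$ and $\tau_j\le c_3\,\tau^{1/r}t_j^{1-1/r}$ for all $j=1,\dots,M$. The L1 operator is $\delta_t^\alpha U^m:=\frac1{\Gamma(1-\alpha)}\sum_{j=1}^m\frac{U^j-U^{j-1}}{t_j-t_{j-1}}\int_{t_{j-1}}^{t_j}(t_m-s)^{-\alpha}\,ds$. Notation: $a\lesssim b$ means $a\le Cb$ with a constant $C>0$ that may depend on the data and the family of meshes but not on $M$ or $m$ (nor, in the regularity bound, on $t$). *)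

theory Defs
  imports "HOL-Analysis.Analysis" "HOL-Probability.Essential_Supremum"
begin

section \<open>Domains and function spaces\<close>

text \<open>The local graph representation is taken with respect to a unit direction \<open>\<nu>\<close>;
  the hyperplane orthogonal to \<open>\<nu>\<close> is the parameter space of the Lipschitz graph \<open>g\<close>.\<close>

definition lipschitz_boundary :: "(real^'d) set \<Rightarrow> bool" where
  "lipschitz_boundary \<Omega> \<longleftrightarrow>
     (\<forall>p\<in>frontier \<Omega>. \<exists>\<nu> \<rho> L. \<exists>g :: real^'d \<Rightarrow> real.
        norm \<nu> = 1 \<and> \<rho> > 0 \<and> L-lipschitz_on {y. y \<bullet> \<nu> = 0} g \<and>
        \<Omega> \<inter> ball p \<rho> = {x \<in> ball p \<rho>. x \<bullet> \<nu> > g (x - (x \<bullet> \<nu>) *\<^sub>R \<nu>)})"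

definition bounded_lipschitz_domain :: "(real^'d) set \<Rightarrow> bool" where
  "bounded_lipschitz_domain \<Omega> \<longleftrightarrow>
     open \<Omega> \<and> connected \<Omega> \<and> \<Omega> \<noteq> {} \<and> bounded \<Omega> \<and> lipschitz_boundary \<Omega>"

definition L2_fun :: "(real^'d) set \<Rightarrow> (real^'d \<Rightarrow> 'b::euclidean_space) \<Rightarrow> bool" where
  "L2_fun \<Omega> g \<longleftrightarrow> g \<in> borel_measurable (lebesgue_on \<Omega>) \<and>
     integrable (lebesgue_on \<Omega>) (\<lambda>x. (norm (g x))\<^sup>2)"

definition L2_norm :: "(real^'d) set \<Rightarrow> (real^'d \<Rightarrow> 'b::euclidean_space) \<Rightarrow> real" where
  "L2_norm \<Omega> g = sqrt (LINT x|lebesgue_on \<Omega>. (norm (g x))\<^sup>2)"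

definition Linf_norm :: "(real^'d) set \<Rightarrow> (real^'d \<Rightarrow> 'b::euclidean_space) \<Rightarrow> ereal" where
  "Linf_norm \<Omega> g = esssup (lebesgue_on \<Omega>) (\<lambda>x. ereal (norm (g x)))"

definition Linf_fun :: "(real^'d) set \<Rightarrow> (real^'d \<Rightarrow> 'b::euclidean_space) \<Rightarrow> bool" where
  "Linf_fun \<Omega> g \<longleftrightarrow> g \<in> borel_measurable (lebesgue_on \<Omega>) \<and> Linf_norm \<Omega> g < \<infinity>"

definition pderivative :: "'d \<Rightarrow> (real^'d \<Rightarrow> real) \<Rightarrow> real^'d \<Rightarrow> real" where
  "pderivative k \<phi> x = frechet_derivative \<phi> (at x) (axis k 1)"

definition classical_gradient :: "(real^'d \<Rightarrow> real) \<Rightarrow> real^'d \<Rightarrow> real^'d" where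
  "classical_gradient \<phi> x = (\<chi> k. pderivative k \<phi> x)"

text \<open>Infinite differentiability: every iterated partial derivative is again (totally)
  differentiable, hence continuous.\<close>

definition smooth_fun :: "(real^'d \<Rightarrow> real) \<Rightarrow> bool" where
  "smooth_fun \<phi> \<longleftrightarrow> (\<forall>ks :: 'd list. foldr pderivative ks \<phi> differentiable_on UNIV)"

definition test_fun :: "(real^'d) set \<Rightarrow> (real^'d \<Rightarrow> real) \<Rightarrow> bool" where
  "test_fun \<Omega> \<phi> \<longleftrightarrow> smooth_fun \<phi> \<and>
     compact (closure {x. \<phi> x \<noteq> 0}) \<and> closure {x. \<phi> x \<noteq> 0} \<subseteq> \<Omega>"

text \<open>Functions are representatives of their almost-everywhere classes.
  \<open>weak_gradient \<Omega> w G\<close> says that \<open>w\<close> is in \<open>H\<^sup>1(\<Omega>)\<close> and that \<open>G\<close> is a version of its weak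
  gradient.\<close>

definition weak_gradient ::
  "(real^'d) set \<Rightarrow> (real^'d \<Rightarrow> real) \<Rightarrow> (real^'d \<Rightarrow> real^'d) \<Rightarrow> bool" where
  "weak_gradient \<Omega> w G \<longleftrightarrow> L2_fun \<Omega> w \<and> L2_fun \<Omega> G \<and>
     (\<forall>\<phi> k. test_fun \<Omega> \<phi> \<longrightarrow>
        (LINT x|lebesgue_on \<Omega>. w x * pderivative k \<phi> x) =
        - (LINT x|lebesgue_on \<Omega>. (G x $ k) * \<phi> x))"

text \<open>\<open>H\<^sup>1\<^sub>0(\<Omega>)\<close> is the closure of the test functions in the \<open>H\<^sup>1(\<Omega>)\<close> norm.\<close>

definition H1_0 :: "(real^'d) set \<Rightarrow> (real^'d \<Rightarrow> real) set" where
  "H1_0 \<Omega> = {w. \<exists>G. weak_gradient \<Omega> w G \<and>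
     (\<exists>\<phi> :: nat \<Rightarrow> real^'d \<Rightarrow> real. (\<forall>n. test_fun \<Omega> (\<phi> n)) \<and>
        (\<lambda>n. L2_norm \<Omega> (\<lambda>x. \<phi> n x - w x)) \<longlonglongrightarrow> 0 \<and>
        (\<lambda>n. L2_norm \<Omega> (\<lambda>x. classical_gradient (\<phi> n) x - G x)) \<longlonglongrightarrow> 0)}"

section \<open>The quasilinear problem\<close>

text \<open>Coefficients are written \<open>a k x t s\<close>, \<open>b k x t s\<close>, \<open>f x t s\<close>, and functions of space and
  time as \<open>u t x\<close>.

  \<open>weak_elliptic \<Omega> a b f t g w\<close>: \<open>w\<close> is a weak solution, with zero boundary values, of
  \<open>g + Q w + f(\<cdot>,t,w) = 0\<close> in \<open>\<Omega>\<close>, where \<open>Q\<close> is frozen at time \<open>t\<close>. All integrals of the weak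
  form are required to exist, and \<open>G\<close>, \<open>H\<close> run over the versions of \<open>\<nabla>w\<close> and \<open>\<nabla>v\<close>.\<close>

definition weak_elliptic ::
  "(real^'d) set \<Rightarrow> ('d \<Rightarrow> real^'d \<Rightarrow> real \<Rightarrow> real \<Rightarrow> real) \<Rightarrow>
   ('d \<Rightarrow> real^'d \<Rightarrow> real \<Rightarrow> real \<Rightarrow> real) \<Rightarrow> (real^'d \<Rightarrow> real \<Rightarrow> real \<Rightarrow> real) \<Rightarrow>
   real \<Rightarrow> (real^'d \<Rightarrow> real) \<Rightarrow> (real^'d \<Rightarrow> real) \<Rightarrow> bool" where
  "weak_elliptic \<Omega> a b f t g w \<longleftrightarrow> w \<in> H1_0 \<Omega> \<and>
     (\<forall>v\<in>H1_0 \<Omega>. \<forall>G H. weak_gradient \<Omega> w G \<longrightarrow> weak_gradient \<Omega> v H \<longrightarrow>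
        integrable (lebesgue_on \<Omega>) (\<lambda>x. g x * v x) \<and>
        integrable (lebesgue_on \<Omega>)
          (\<lambda>x. \<Sum>k\<in>UNIV. (a k x t (w x) * G x $ k + b k x t (w x)) * H x $ k) \<and>
        integrable (lebesgue_on \<Omega>) (\<lambda>x. f x t (w x) * v x) \<and>
        (LINT x|lebesgue_on \<Omega>. g x * v x)
        + (LINT x|lebesgue_on \<Omega>.
            (\<Sum>k\<in>UNIV. (a k x t (w x) * G x $ k + b k x t (w x)) * H x $ k))
        + (LINT x|lebesgue_on \<Omega>. f x t (w x) * v x) = 0)"

text \<open>\<open>w = \<partial>\<^sub>t v\<close> on \<open>(0,T]\<close>, for \<open>L\<^sub>2(\<Omega>)\<close>-valued functions of time (difference quotients converge
  in \<open>L\<^sub>2(\<Omega>)\<close>; the derivative is one-sided at \<open>T\<close>).\<close>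

definition L2_time_derivative ::
  "(real^'d) set \<Rightarrow> real \<Rightarrow> (real \<Rightarrow> real^'d \<Rightarrow> real) \<Rightarrow> (real \<Rightarrow> real^'d \<Rightarrow> real) \<Rightarrow> bool" where
  "L2_time_derivative \<Omega> T v w \<longleftrightarrow> (\<forall>t\<in>{0<..T}. L2_fun \<Omega> (v t) \<and> L2_fun \<Omega> (w t) \<and>
     ((\<lambda>s. L2_norm \<Omega> (\<lambda>x. (v s x - v t x) / (s - t) - w t x)) \<longlongrightarrow> 0) (at t within {0<..T}))"

definition L2_continuous ::
  "(real^'d) set \<Rightarrow> real \<Rightarrow> (real \<Rightarrow> real^'d \<Rightarrow> real) \<Rightarrow> bool" where
  "L2_continuous \<Omega> T v \<longleftrightarrow> (\<forall>t\<in>{0..T}. L2_fun \<Omega> (v t) \<and>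
     ((\<lambda>s. L2_norm \<Omega> (\<lambda>x. v s x - v t x)) \<longlongrightarrow> 0) (at t within {0..T}))"

text \<open>The Caputo derivative of \<open>u\<close> at time \<open>t\<close>; the argument \<open>u'\<close> stands for \<open>\<partial>\<^sub>t u\<close>.\<close>

definition caputo :: "real \<Rightarrow> (real \<Rightarrow> real^'d \<Rightarrow> real) \<Rightarrow> real \<Rightarrow> real^'d \<Rightarrow> real" where
  "caputo \<alpha> u' t x =
     1 / Gamma (1 - \<alpha>) * (LINT s|lebesgue_on {0..t}. (t - s) powr (-\<alpha>) * u' s x)"

text \<open>Solutions are continuous on \<open>[0,T]\<close> and differentiable on \<open>(0,T]\<close> with values in
  \<open>L\<^sub>2(\<Omega>)\<close>. Choosing a jointly measurable version \<open>u'\<close> of \<open>\<partial>\<^sub>t u\<close> (one always exists) makes the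
  integral over \<open>s\<close> in the Caputo derivative meaningful for almost every \<open>x\<close>; it converges
  absolutely in \<open>L\<^sub>2(\<Omega>)\<close>. The equation holds weakly in space at every time in \<open>(0,T]\<close>.\<close>

definition parabolic_solution ::
  "(real^'d) set \<Rightarrow> real \<Rightarrow> real \<Rightarrow> ('d \<Rightarrow> real^'d \<Rightarrow> real \<Rightarrow> real \<Rightarrow> real) \<Rightarrow>
   ('d \<Rightarrow> real^'d \<Rightarrow> real \<Rightarrow> real \<Rightarrow> real) \<Rightarrow> (real^'d \<Rightarrow> real \<Rightarrow> real \<Rightarrow> real) \<Rightarrow>
   (real^'d \<Rightarrow> real) \<Rightarrow> (real \<Rightarrow> real^'d \<Rightarrow> real) \<Rightarrow> bool" where
  "parabolic_solution \<Omega> T \<alpha> a b f u0 u \<longleftrightarrow>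
     L2_continuous \<Omega> T u \<and> (AE x in lebesgue_on \<Omega>. u 0 x = u0 x) \<and>
     (\<exists>u'. L2_time_derivative \<Omega> T u u' \<and>
        (\<lambda>(s, x). u' s x) \<in> borel_measurable (lebesgue_on {0<..T} \<Otimes>\<^sub>M lebesgue_on \<Omega>) \<and>
        (\<forall>t\<in>{0<..T}.
           integrable (lebesgue_on {0..t}) (\<lambda>s. (t - s) powr (-\<alpha>) * L2_norm \<Omega> (u' s)) \<and>
           weak_elliptic \<Omega> a b f t (caputo \<alpha> u' t) (u t)))"

section \<open>Meshes and the semidiscretization\<close>

definition temporal_mesh :: "real \<Rightarrow> nat \<Rightarrow> (nat \<Rightarrow> real) \<Rightarrow> bool" where
  "temporal_mesh T M t \<longleftrightarrow> t 0 = 0 \<and> t M = T \<and> (\<forall>j<M. t j < t (Suc j))"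

definition mesh_step :: "(nat \<Rightarrow> real) \<Rightarrow> nat \<Rightarrow> real" where
  "mesh_step t j = t j - t (j - 1)"

text \<open>\<open>Ms\<close> is the set of those \<open>M\<close> for which a mesh \<open>t M 0, \<dots>, t M M\<close> is considered.\<close>

definition quasi_graded :: "real \<Rightarrow> nat set \<Rightarrow> (nat \<Rightarrow> nat \<Rightarrow> real) \<Rightarrow> bool" where
  "quasi_graded r Ms t \<longleftrightarrow> (\<exists>c1>0. \<exists>c2>0. \<exists>c3>0. \<forall>M\<in>Ms.
     c1 * real M powr (-r) \<le> t M 1 \<and> t M 1 \<le> c2 * real M powr (-r) \<and>
     (\<forall>j\<in>{1..M}. mesh_step (t M) j \<le> c3 * t M 1 powr (1 / r) * t M j powr (1 - 1 / r)))"

definition L1_operator ::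
  "real \<Rightarrow> (nat \<Rightarrow> real) \<Rightarrow> (nat \<Rightarrow> real^'d \<Rightarrow> real) \<Rightarrow> nat \<Rightarrow> real^'d \<Rightarrow> real" where
  "L1_operator \<alpha> t U m x = 1 / Gamma (1 - \<alpha>) *
     (\<Sum>j=1..m. (U j x - U (j - 1) x) / (t j - t (j - 1)) *
        (LINT s|lebesgue_on {t (j - 1)..t j}. (t m - s) powr (-\<alpha>)))"

definition semidiscrete_solution ::
  "(real^'d) set \<Rightarrow> real \<Rightarrow> ('d \<Rightarrow> real^'d \<Rightarrow> real \<Rightarrow> real \<Rightarrow> real) \<Rightarrow>
   ('d \<Rightarrow> real^'d \<Rightarrow> real \<Rightarrow> real \<Rightarrow> real) \<Rightarrow> (real^'d \<Rightarrow> real \<Rightarrow> real \<Rightarrow> real) \<Rightarrow>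
   (real^'d \<Rightarrow> real) \<Rightarrow> nat \<Rightarrow> (nat \<Rightarrow> real) \<Rightarrow> (nat \<Rightarrow> real^'d \<Rightarrow> real) \<Rightarrow> bool" where
  "semidiscrete_solution \<Omega> \<alpha> a b f u0 M t U \<longleftrightarrow>
     (AE x in lebesgue_on \<Omega>. U 0 x = u0 x) \<and>
     (\<forall>m\<in>{1..M}. weak_elliptic \<Omega> a b f (t m) (L1_operator \<alpha> t U m) (U m))"

definition error_bound :: "real \<Rightarrow> real \<Rightarrow> real \<Rightarrow> nat \<Rightarrow> (nat \<Rightarrow> real) \<Rightarrow> nat \<Rightarrow> real" where
  "error_bound \<alpha> \<sigma> r M t m = (let \<nu> = 1 + \<sigma> - \<alpha> in
     if r < (2 - \<alpha>) / \<nu> then real M powr (- \<nu> * r) * t m powr (\<alpha> - 1)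
     else if r = (2 - \<alpha>) / \<nu> then
       real M powr (- (2 - \<alpha>)) * t m powr (\<alpha> - 1) * (1 + ln (t m / t 1))
     else real M powr (- (2 - \<alpha>)) * t m powr (\<sigma> - (2 - \<alpha>) / r))"

end

(* Testing the error equation with the error e^m itself and using the monotonicity of the elliptic part
up to the multiple lam of |e^m|^2, the Cauchy-Schwarz inequality turns it into the scalar inequality
(delta_t^alpha - lam) |e^m| <= |r^m| for the norms of the error, where r^m is the truncation error of the
L1 operator. Integration by parts against the kernel gives |r^m| <= C tau^(sigma - alpha) (tau/t_m)^p, with
p = min (alpha + 1) ((2 - alpha)/r + alpha - sigma).

The L1 operator is an M-matrix, so its inverse is monotone, and it remains to bound the response to
the right-hand side (tau/t_m)^p. Every nonincreasing right-hand side is a nonnegative combination of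
indicators of {1..k}, so the key estimate is that the response to such an indicator at t_m is at most
K t_k t_m^(alpha - 1). The candidate t^(alpha - 1), cut off at t_k, satisfies it for the continuous operator;
its discretization error and the lower-order term lam are again responses to nonincreasing right-hand
sides, of small total mass, so the estimate follows by a bootstrap for the best constant K. *)

theory Submission
  imports Defs
begin

section \<open>Discrete comparison principle for the L1 operator\<close>

text \<open>The obstacle is the generality of the meshes: quasi-grading bounds each step from above,
  but gives no lower bound and no control of the ratio of neighbouring steps; only neighbouring
  nodes are comparable. Quadrature errors are therefore made to telescope or compared with an
  integral. The smallness behind the bootstrap has to be arranged. The discretization error of the
  barrier cut off at t_k has mass of order (t_1 / t_k)^\<delta>, so the bootstrap runs for t_k \<ge>
  R t_1 with R large; smaller k are dominated by the first node beyond R t_1. The term with lam has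
  small mass only up to a short time s; afterwards it is bounded, and exp(t / h) with a small h
  absorbs it, as in a Gronwall argument. The choice of h and R confines the argument to fine meshes
  and leaves finitely many M over. In space, the error at t_m is fixed as the test function for all
  times. Pairing with it turns all calculus in time into that of real functions.\<close>

lemma powr_mvt:
  fixes x y p :: real
  assumes "0 < x" "x < y"
  obtains z where "x < z" "z < y" "y powr p - x powr p = (y - x) * (p * z powr (p - 1))"
proof -
  have "\<exists>z>x. z < y \<and> y powr p - x powr p = (y - x) * (p * z powr (p - 1))"
    using assms by (intro MVT2) (auto intro!: derivative_eq_intros)
  then show thesis using that by blast
qed

text \<open>The derivative of a concave power is smallest at the right end. The case x = 0, outside
  the reach of \<open>powr_mvt\<close>, is needed for the interval that ends at \<open>t m\<close>
  and for the one that starts at time 0.\<close>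

lemma powr_diff_ge:
  fixes x y p :: real
  assumes "0 \<le> x" "x < y" "0 < p" "p \<le> 1"
  shows "p * y powr (p - 1) * (y - x) \<le> y powr p - x powr p"
proof (cases "x = 0")
  case True
  have "p * (y powr (p - 1) * y) \<le> 1 * (y powr (p - 1) * y)"
    using assms by (intro mult_right_mono) auto
  moreover have "y powr (p - 1) * y = y powr p"
    using assms by (simp add: powr_mult_base' powr_diff)
  ultimately show ?thesis using True assms by (simp add: mult.assoc)
next
  case False
  then have "0 < x" using assms by simp
  from powr_mvt[OF this \<open>x < y\<close>, of p] obtain z where z: "x < z" "z < y"
    "y powr p - x powr p = (y - x) * (p * z powr (p - 1))" .
  have "y powr (p - 1) \<le> z powr (p - 1)" using z assms by (intro powr_mono2') auto
  then show ?thesis using z assms by (simp add: mult.commute mult_left_mono)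
qed

lemma powr_diff_le:
  fixes x y p :: real
  assumes "0 < x" "x < y" "0 < p" "p \<le> 1"
  shows "y powr p - x powr p \<le> p * x powr (p - 1) * (y - x)"
proof -
  from powr_mvt[OF assms(1,2), of p] obtain z where z: "x < z" "z < y"
    "y powr p - x powr p = (y - x) * (p * z powr (p - 1))" .
  have "z powr (p - 1) \<le> x powr (p - 1)" using z assms by (intro powr_mono2') auto
  then show ?thesis using z assms by (simp add: mult.commute mult_left_mono)
qed

lemma powr_neg_diff_le:
  fixes x y p :: real
  assumes "0 < x" "x \<le> y" "0 \<le> p"
  shows "x powr (-p) - y powr (-p) \<le> p * x powr (-p - 1) * (y - x)"
proof (cases "x = y")
  case False
  then have "x < y" using assms by simp
  from powr_mvt[OF assms(1) this, of "-p"] obtain z where z: "x < z" "z < y"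
    "y powr (-p) - x powr (-p) = (y - x) * (- p * z powr (- p - 1))" .
  have "z powr (-p - 1) \<le> x powr (-p - 1)" using z assms by (intro powr_mono2') auto
  then have "(y - x) * p * z powr (-p - 1) \<le> (y - x) * p * x powr (-p-1)"
    using z assms by (intro mult_left_mono) auto
  then show ?thesis using z by (simp add: algebra_simps)
qed simp

lemma powr_half_le:
  fixes x \<alpha> :: real
  assumes "0 < x" "\<alpha> \<le> 1"
  shows "(x / 2) powr (-\<alpha> - 1) \<le> 4 * x powr (-\<alpha> - 1)"
proof -
  have "(x / 2) powr (-\<alpha> - 1) = 2 powr (\<alpha> + 1) * x powr (-\<alpha> - 1)"
    using assms by (simp add: powr_divide powr_minus_divide[of 2] powr_diff powr_add powr_minus field_simps)
  also have "\<dots> \<le> 2 powr 2 * x powr (-\<alpha> - 1)"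
    using assms by (intro mult_right_mono powr_mono) auto
  finally show ?thesis by simp
qed

text \<open>1 - \<alpha> times the mean of the kernel \<open>(t m - s) powr (-\<alpha>)\<close> over
  the j-th interval. With this normalization \<open>L1_sum\<close> is Gamma(2 - \<alpha>) times the
  L1 operator, and the last weight is exactly \<open>\<tau> m powr (-\<alpha>)\<close>, so that the
  step restriction can be read off the diagonal.\<close>

definition wt :: "real \<Rightarrow> (nat \<Rightarrow> real) \<Rightarrow> nat \<Rightarrow> nat \<Rightarrow> real" where
  "wt \<alpha> t m j = ((t m - t (j - 1)) powr (1 - \<alpha>) - (t m - t j) powr (1 - \<alpha>)) / (t j - t (j - 1))"

definition L1_sum :: "real \<Rightarrow> (nat \<Rightarrow> real) \<Rightarrow> (nat \<Rightarrow> real) \<Rightarrow> nat \<Rightarrow> real" where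
  "L1_sum \<alpha> t v m = (\<Sum>j=1..m. (v j - v (j - 1)) * wt \<alpha> t m j)"

section \<open>Sign structure of the L1 operator and discrete comparison\<close>

locale mesh =
  fixes \<alpha> :: real and t :: "nat \<Rightarrow> real" and M :: nat
  assumes \<alpha>: "0 < \<alpha>" "\<alpha> < 1"
    and t_0: "t 0 = 0"
    and t_step: "j < M \<Longrightarrow> t j < t (Suc j)"
begin

abbreviation \<tau> where "\<tau> j \<equiv> t j - t (j - 1)"

lemma t_less: "i < j \<Longrightarrow> j \<le> M \<Longrightarrow> t i < t j"
proof (induction j)
  case (Suc j)
  show ?case
  proof (cases "i = j")
    case True then show ?thesis using t_step Suc by auto
  next
    case False
    then have "t i < t j" using Suc by auto
    also have "\<dots> < t (Suc j)" using t_step Suc by auto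
    finally show ?thesis .
  qed
qed simp

lemma t_le: "i \<le> j \<Longrightarrow> j \<le> M \<Longrightarrow> t i \<le> t j"
  using t_less[of i j] by (cases "i = j") auto

lemma t_pos: "1 \<le> j \<Longrightarrow> j \<le> M \<Longrightarrow> 0 < t j"
  using t_less[of 0 j] t_0 by auto

lemma t_nonneg: "j \<le> M \<Longrightarrow> 0 \<le> t j"
  using t_le[of 0 j] t_0 by auto

lemma t_pred: "1 \<le> j \<Longrightarrow> j \<le> M \<Longrightarrow> t (j - 1) < t j"
  by (rule t_less) auto

lemma wt_ge:
  assumes "1 \<le> j" "j \<le> m" "m \<le> M"
  shows "(1 - \<alpha>) * (t m - t (j - 1)) powr (-\<alpha>) \<le> wt \<alpha> t m j"
  using powr_diff_ge[of "t m - t j" "t m - t (j - 1)" "1 - \<alpha>"] t_pred[of j] t_le[of j m] assms \<alpha>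
  by (simp add: wt_def pos_le_divide_eq)

lemma wt_le:
  assumes "1 \<le> j" "j < m" "m \<le> M"
  shows "wt \<alpha> t m j \<le> (1 - \<alpha>) * (t m - t j) powr (-\<alpha>)"
  using powr_diff_le[of "t m - t j" "t m - t (j - 1)" "1 - \<alpha>"] t_pred[of j] t_less[of j m] assms \<alpha>
  by (simp add: wt_def pos_divide_le_eq)

lemma wt_pos: "1 \<le> j \<Longrightarrow> j \<le> m \<Longrightarrow> m \<le> M \<Longrightarrow> 0 < wt \<alpha> t m j"
  using t_pred[of j] t_le[of j m] \<alpha>
  by (intro less_le_trans[OF _ wt_ge] mult_pos_pos) auto

text \<open>The kernel increases towards \<open>t m\<close>, so its mean over one interval is at
  most its value at the common node, which is at most its mean over the next interval. No relation
  between the two step sizes enters.\<close>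

lemma wt_mono:
  assumes "1 \<le> j" "j < m" "m \<le> M"
  shows "wt \<alpha> t m j \<le> wt \<alpha> t m (Suc j)"
  using wt_le[OF assms] wt_ge[of "Suc j" m] assms by simp

lemma wt_diag: "1 \<le> m \<Longrightarrow> m \<le> M \<Longrightarrow> wt \<alpha> t m m = (\<tau> m) powr (-\<alpha>)"
  using t_pred[of m] \<alpha> by (simp add: wt_def powr_diff powr_minus field_simps)

text \<open>Summation by parts shows the M-matrix pattern: the coefficient of \<open>v m\<close> is
  positive and, by \<open>wt_mono\<close> and \<open>wt_pos\<close>, those of all earlier values are
  nonpositive. Comparison, time stepping and the energy inequality all start from this form.\<close>

lemma L1_sum_Abel:
  assumes "1 \<le> m"
  shows "L1_sum \<alpha> t v m = wt \<alpha> t m m * v m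
    - (\<Sum>j\<in>{1..<m}. (wt \<alpha> t m (Suc j) - wt \<alpha> t m j) * v j) - wt \<alpha> t m 1 * v 0"
proof -
  have "(\<Sum>j=1..n. (v j - v (j - 1)) * w j) =
    w n * v n - (\<Sum>j\<in>{1..<n}. (w (Suc j) - w j) * v j) - w 1 * v 0" if "1 \<le> n" for n and w :: "nat \<Rightarrow> real"
    using that
    by (induction n rule: nat_induct_at_least) (auto simp: algebra_simps)
  from this[OF assms] show ?thesis unfolding L1_sum_def .
qed

lemma L1_sum_diff: "L1_sum \<alpha> t (\<lambda>j. v j - w j) m = L1_sum \<alpha> t v m - L1_sum \<alpha> t w m"
  by (simp add: L1_sum_def sum_subtractf[symmetric] algebra_simps)

lemma L1_sum_add: "L1_sum \<alpha> t (\<lambda>j. v j + w j) m = L1_sum \<alpha> t v m + L1_sum \<alpha> t w m"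
  by (simp add: L1_sum_def sum.distrib[symmetric] algebra_simps)

lemma L1_sum_cmult: "L1_sum \<alpha> t (\<lambda>j. c * v j) m = c * L1_sum \<alpha> t v m"
  by (simp add: L1_sum_def sum_distrib_left algebra_simps)

lemma L1_sum_sum: "L1_sum \<alpha> t (\<lambda>j. \<Sum>k\<in>A. c k * v k j) m = (\<Sum>k\<in>A. c k * L1_sum \<alpha> t (v k) m)"
proof (induction A rule: infinite_finite_induct)
  case (insert x F)
  then show ?case using L1_sum_add[of "\<lambda>j. c x * v x j" "\<lambda>j. \<Sum>k\<in>F. c k * v k j"] by (simp add: L1_sum_cmult)
qed (simp_all add: L1_sum_def)

text \<open>Induction on time: if the difference z is nonpositive before m, the sign pattern of
  \<open>L1_sum_Abel\<close> leaves \<open>(wt \<alpha> t m m - \<mu>) * z m \<le> 0\<close>.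
  Stopping at n instead of M records causality: the values up to n depend on the data up to
  n.\<close>

lemma L1_sum_comparison:
  assumes "n \<le> M" "\<And>m. m \<in> {1..n} \<Longrightarrow> \<mu> < wt \<alpha> t m m" "v 0 \<le> w 0"
    and "\<And>m. m \<in> {1..n} \<Longrightarrow> L1_sum \<alpha> t v m - \<mu> * v m \<le> L1_sum \<alpha> t w m - \<mu> * w m"
    and "i \<le> n"
  shows "v i \<le> w i"
proof -
  define z where "z j = v j - w j" for j
  have D: "L1_sum \<alpha> t z m - \<mu> * z m \<le> 0" if "m \<in> {1..n}" for m
    using assms(4)[OF that] unfolding z_def L1_sum_diff by (simp add: algebra_simps)
  have "z i \<le> 0" using \<open>i \<le> n\<close>
  proof (induction i rule: less_induct)
    case (less m)
    show ?case
    proof (cases "m = 0")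
      case True then show ?thesis using assms(3) z_def by simp
    next
      case False
      then have m: "m \<in> {1..n}" "1 \<le> m" "m \<le> M" using less assms(1) by auto
      have "(\<Sum>j\<in>{1..<m}. (wt \<alpha> t m (Suc j) - wt \<alpha> t m j) * z j) \<le> 0"
        using wt_mono m less by (intro sum_nonpos mult_nonneg_nonpos) auto
      moreover have "wt \<alpha> t m 1 * z 0 \<le> 0"
        using wt_pos[of 1 m] m less.IH[of 0] by (intro mult_nonneg_nonpos) auto
      ultimately have "(wt \<alpha> t m m - \<mu>) * z m \<le> 0"
        using D[OF m(1)] L1_sum_Abel[OF m(2), of z] by (simp add: algebra_simps)
      then show ?thesis using assms(2)[OF m(1)] by (simp add: mult_le_0_iff)
    qed
  qed
  then show ?thesis by (simp add: z_def)
qed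

end

text \<open>Forward substitution in \<open>L1_sum_Abel\<close>: the solution, with initial value 0,
  of the scalar scheme with right-hand side g.\<close>

fun L1_solve :: "real \<Rightarrow> real \<Rightarrow> (nat \<Rightarrow> real) \<Rightarrow> (nat \<Rightarrow> real) \<Rightarrow> nat \<Rightarrow> real" where
  "L1_solve \<alpha> \<mu> t g m = (if m = 0 then 0 else
     (g m + (\<Sum>j\<in>{1..<m}. (wt \<alpha> t m (Suc j) - wt \<alpha> t m j) * L1_solve \<alpha> \<mu> t g j)) / (wt \<alpha> t m m - \<mu>))"

declare L1_solve.simps [simp del]

lemma L1_solve_0 [simp]: "L1_solve \<alpha> \<mu> t g 0 = 0"
  by (simp add: L1_solve.simps)

text \<open>In the application \<open>\<mu> = lam * Gamma (2 - \<alpha>)\<close>, and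
  \<open>diag\<close> is the step restriction of the theorem. It makes the divisors in
  \<open>L1_solve\<close> positive.\<close>

locale mesh_op = mesh +
  fixes \<mu> :: real
  assumes \<mu>: "0 \<le> \<mu>" and diag: "m \<in> {1..M} \<Longrightarrow> \<mu> < wt \<alpha> t m m"
begin

abbreviation "J \<equiv> L1_solve \<alpha> \<mu> t"
abbreviation "D \<equiv> L1_sum \<alpha> t"

lemma D_J: 
  assumes "m \<in> {1..M}"
  shows "D (J g) m - \<mu> * J g m = g m"
proof -
  let ?S = "\<Sum>j\<in>{1..<m}. (wt \<alpha> t m (Suc j) - wt \<alpha> t m j) * J g j"
  have "J g m = (g m + ?S) / (wt \<alpha> t m m - \<mu>)"
    using assms by (subst L1_solve.simps) simp
  then have "J g m * (wt \<alpha> t m m - \<mu>) = g m + ?S"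
    using diag[OF assms] by simp
  then show ?thesis
    using L1_sum_Abel[of m "J g"] assms by (simp add: algebra_simps)
qed

lemma le_J:
  assumes "v 0 \<le> 0" "\<And>j. j \<in> {1..M} \<Longrightarrow> D v j - \<mu> * v j \<le> g j" "m \<le> M"
  shows "v m \<le> J g m"
  by (rule L1_sum_comparison[of M \<mu>]) (use assms in \<open>auto simp: diag D_J\<close>)

lemma J_le:
  assumes "0 \<le> v 0" "\<And>j. j \<in> {1..M} \<Longrightarrow> g j \<le> D v j - \<mu> * v j" "m \<le> M"
  shows "J g m \<le> v m"
  by (rule L1_sum_comparison[of M \<mu>]) (use assms in \<open>auto simp: diag D_J\<close>)

lemma J_mono:
  assumes "\<And>j. j \<in> {1..M} \<Longrightarrow> g j \<le> h j" "m \<le> M"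
  shows "J g m \<le> J h m"
  by (rule J_le) (use assms in \<open>auto simp: D_J\<close>)

lemma J_nonneg: "(\<And>j. j \<in> {1..M} \<Longrightarrow> 0 \<le> g j) \<Longrightarrow> m \<le> M \<Longrightarrow> 0 \<le> J g m"
  using le_J[of "\<lambda>_. 0" g m] by (auto simp: L1_sum_def)

end

section \<open>Quadrature errors and barriers\<close>

lemma sum_telescope_pred:
  fixes f :: "nat \<Rightarrow> real"
  assumes "k \<le> m"
  shows "(\<Sum>j\<in>{Suc k..m}. f j - f (j - 1)) = f m - f k"
  using assms by (induction m rule: nat_induct_at_least) (auto simp: atLeastAtMostSuc_conv)

text \<open>For b = c the integrand is singular at the right end. The antiderivative is still
  continuous there, so the fundamental theorem with interior derivatives applies.\<close>

lemma kernel_has_integral: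
  fixes a b c \<alpha> :: real
  assumes "a \<le> b" "b \<le> c" "\<alpha> < 1"
  shows "((\<lambda>s. (c - s) powr (-\<alpha>)) has_integral
    ((c - a) powr (1 - \<alpha>) - (c - b) powr (1 - \<alpha>)) / (1 - \<alpha>)) {a..b}"
proof -
  have "((\<lambda>s. (c - s) powr (-\<alpha>)) has_integral
    (- ((c - b) powr (1 - \<alpha>)) / (1 - \<alpha>)) - (- ((c - a) powr (1 - \<alpha>)) / (1 - \<alpha>))) {a..b}"
  proof (rule fundamental_theorem_of_calculus_interior)
    show "continuous_on {a..b} (\<lambda>s. - ((c - s) powr (1 - \<alpha>)) / (1 - \<alpha>))"
      using assms by (intro continuous_intros continuous_on_powr') auto
    fix s assume "s \<in> {a<..<b}"
    then show "((\<lambda>s. - ((c - s) powr (1 - \<alpha>)) / (1 - \<alpha>)) has_vector_derivative (c - s) powr (-\<alpha>)) (at s)"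
      unfolding has_real_derivative_iff_has_vector_derivative[symmetric] using assms
      by (auto intro!: derivative_eq_intros)
  qed (use assms in auto)
  then show ?thesis by (simp add: diff_divide_distrib)
qed

text \<open>Pointwise bounds by singular powers may fail at the ends of the interval, where
  \<open>0 powr x\<close> is 0 by convention, so they are asked for at interior points only.\<close>

lemma has_integral_le_interior:
  fixes f g :: "real \<Rightarrow> real"
  assumes "(f has_integral i) {a..b}" "(g has_integral j) {a..b}"
    and "\<And>s. s \<in> {a<..<b} \<Longrightarrow> f s \<le> g s"
  shows "i \<le> j"
  using assms by (intro has_integral_le[of f i "{a<..<b}" g j]) (auto simp: has_integral_Icc_iff_Ioo)

lemma has_integral_abs_le_interior:
  fixes f g :: "real \<Rightarrow> real"
  assumes "(f has_integral i) {a..b}" "(g has_integral j) {a..b}"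
    and "\<And>s. s \<in> {a<..<b} \<Longrightarrow> \<bar>f s\<bar> \<le> g s"
  shows "\<bar>i\<bar> \<le> j"
proof -
  have "i \<le> j" by (rule has_integral_le_interior[OF assms(1,2)]) (use assms(3) abs_le_D1 in blast)
  moreover have "- i \<le> j" by (rule has_integral_le_interior[OF has_integral_neg[OF assms(1)] assms(2)])
      (use assms(3) abs_le_D2 in blast)
  ultimately show ?thesis by simp
qed

text \<open>The difference of \<phi> and its mean is bounded by H and integrates to zero. Taking
  absolute values gives the first bound, which survives b = c. If b < c, a constant may first be
  subtracted from the kernel, so that only the oscillation of the kernel over [a, b] counts; this is
  the gain of one order away from the singularity.\<close>

lemma kernel_quadrature_error:
  fixes a b c \<alpha> \<Delta> I H :: real and \<phi> :: "real \<Rightarrow> real"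
  assumes ab: "a < b" "b \<le> c" and \<alpha>: "0 \<le> \<alpha>" "\<alpha> < 1"
    and \<phi>: "(\<phi> has_integral \<Delta>) {a..b}"
    and I: "((\<lambda>s. (c - s) powr (-\<alpha>) * \<phi> s) has_integral I) {a..b}"
    and H: "\<And>s. s \<in> {a<..<b} \<Longrightarrow> \<bar>\<phi> s - \<Delta> / (b - a)\<bar> \<le> H"
  defines "W \<equiv> ((c - a) powr (1 - \<alpha>) - (c - b) powr (1 - \<alpha>)) / (1 - \<alpha>)"
  shows "\<bar>\<Delta> / (b - a) * W - I\<bar> \<le> H * W"
    and "b < c \<Longrightarrow> \<bar>\<Delta> / (b - a) * W - I\<bar> \<le> H * (b - a) * ((c - b) powr (-\<alpha>) - (c - a) powr (-\<alpha>))"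
proof -
  define \<delta> where "\<delta> = \<Delta> / (b - a)"
  have W: "((\<lambda>s. (c - s) powr (-\<alpha>)) has_integral W) {a..b}"
    unfolding W_def using kernel_has_integral[of a b c \<alpha>] assms by auto
  have d: "((\<lambda>s. (c - s) powr (-\<alpha>) * (\<delta> - \<phi> s)) has_integral \<delta> * W - I) {a..b}"
    using has_integral_diff[OF has_integral_mult_right[OF W, of \<delta>] I] by (simp add: algebra_simps)
  have H': "\<bar>\<delta> - \<phi> s\<bar> \<le> H" if "s \<in> {a<..<b}" for s
    using H[OF that] by (simp add: \<delta>_def abs_minus_commute)
  have "\<bar>\<delta> * W - I\<bar> \<le> H * W"
    using H' by (intro has_integral_abs_le_interior[OF d has_integral_mult_right[OF W, of H]])
      (auto simp: abs_mult mult.commute[of H] intro!: mult_left_mono)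
  then show "\<bar>\<Delta> / (b - a) * W - I\<bar> \<le> H * W" by (simp add: \<delta>_def)

  assume "b < c"
  have "((\<lambda>s. \<delta> - \<phi> s) has_integral (\<delta> * (b - a) - \<Delta>)) {a..b}"
    using has_integral_diff[OF has_integral_const_real[of \<delta> a b] \<phi>] ab by (simp add: mult.commute)
  then have "((\<lambda>s. (c - a) powr (-\<alpha>) * (\<delta> - \<phi> s)) has_integral 0) {a..b}"
    using ab by (auto dest: has_integral_mult_right[of _ _ _ "(c - a) powr (-\<alpha>)"] simp: \<delta>_def)
  from has_integral_diff[OF d this]
  have d2: "((\<lambda>s. ((c - s) powr (-\<alpha>) - (c - a) powr (-\<alpha>)) * (\<delta> - \<phi> s)) has_integral (\<delta> * W - I)) {a..b}"
    by (simp add: algebra_simps)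
  let ?B = "((c - b) powr (-\<alpha>) - (c - a) powr (-\<alpha>)) * H"
  have B: "((\<lambda>s. ?B) has_integral ?B * (b - a)) {a..b}"
    using has_integral_const_real[of ?B a b] ab by (simp add: mult.commute)
  have bd: "\<bar>((c - s) powr (-\<alpha>) - (c - a) powr (-\<alpha>)) * (\<delta> - \<phi> s)\<bar> \<le> ?B" if s: "s \<in> {a<..<b}" for s
  proof -
    have "(c - s) powr (-\<alpha>) \<le> (c - b) powr (-\<alpha>)" "(c - a) powr (-\<alpha>) \<le> (c - s) powr (-\<alpha>)"
      using s \<open>b < c\<close> \<alpha> by (auto intro!: powr_mono2')
    then show ?thesis using H'[OF s] unfolding abs_mult by (intro mult_mono) auto
  qed
  have "\<bar>\<delta> * W - I\<bar> \<le> ?B * (b - a)"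
    using bd by (rule has_integral_abs_le_interior[OF d2 B])
  then show "\<bar>\<Delta> / (b - a) * W - I\<bar> \<le> H * (b - a) * ((c - b) powr (-\<alpha>) - (c - a) powr (-\<alpha>))"
    by (simp add: \<delta>_def algebra_simps)
qed

text \<open>By the mean value theorem the slope is itself a value of g' in the interval, and g'
  varies by at most (b - a) H there.\<close>

lemma deriv_minus_slope_le:
  fixes g g' g'' :: "real \<Rightarrow> real"
  assumes "a < b" and g: "\<And>s. s \<in> {a..b} \<Longrightarrow> (g has_real_derivative g' s) (at s within {a..b})"
    and g': "\<And>s. s \<in> {a<..<b} \<Longrightarrow> (g' has_real_derivative g'' s) (at s)"
    and H: "\<And>s. s \<in> {a<..<b} \<Longrightarrow> \<bar>g'' s\<bar> \<le> H" and s: "s \<in> {a<..<b}"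
  shows "\<bar>g' s - (g b - g a) / (b - a)\<bar> \<le> (b - a) * H"
proof -
  have at: "(g has_real_derivative g' s) (at s)" if "s \<in> {a<..<b}" for s
    using g[of s] that by (auto simp: at_within_Icc_at)
  have "continuous_on {a..b} g"
    using g by (meson DERIV_continuous continuous_on_eq_continuous_within)
  with at obtain l z where "a < z" "z < b" "(g has_real_derivative l) (at z)" "g b - g a = (b - a) * l"
    using MVT[of a b g] \<open>a < b\<close> by (auto simp: real_differentiable_def)
  with at[of z] have z: "z \<in> {a<..<b}" "g b - g a = (b - a) * g' z"
    by (auto dest: DERIV_unique)
  have "\<bar>g' s - g' z\<bar> \<le> H * \<bar>s - z\<bar>"
  proof -
    have "norm (g' s - g' z) \<le> H * norm (s - z)"
      using g' H s z(1)
      by (intro field_differentiable_bound[of "{a<..<b}" g' g'']) (auto intro: DERIV_subset)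
    then show ?thesis by simp
  qed
  also have "\<dots> \<le> H * (b - a)" using s z(1) H[OF s] by (intro mult_left_mono) auto
  finally show ?thesis using z(2) \<open>a < b\<close> by (simp add: mult.commute)
qed

section \<open>An exponential supersolution\<close>

context mesh_op begin

text \<open>A supersolution that absorbs bounded right-hand sides. The sequence grows by a factor e
  over a time h, so its L1 sum is at least a multiple of \<open>h powr (-\<alpha>)\<close> times its
  last value, which beats \<mu> once h is small. The value 0 at index 0, instead of exp 0, keeps
  this true for \<open>t m < h\<close>, where the initial jump supplies the growth.\<close>

lemma exp_barrier:
  assumes h: "0 < h" "\<And>j. j \<in> {1..M} \<Longrightarrow> \<tau> j \<le> h"
    and small: "2 * (\<mu> + 1) \<le> (1 - \<alpha>) * (2 * h) powr (-\<alpha>)"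
    and m: "m \<in> {1..M}"
  defines "E \<equiv> \<lambda>j. if j = 0 then 0 else exp (t j / h)"
  shows "E m \<le> D E m - \<mu> * E m"
proof -
  define c where "c = (1 - \<alpha>) * (2 * h) powr (-\<alpha>)"
  (* The truncation keeps only the increments over the last time h, where the weights are at least c;
     these already account for at least half of E m. *)
  define F where "F j = max (E j) (exp (t m / h - 1))" for j
  have "c * (F j - F (j - 1)) \<le> (E j - E (j - 1)) * wt \<alpha> t m j" if j: "j \<in> {1..m}" for j
  proof (cases "t j \<le> t m - h")
    case True
    then have "t j / h \<le> t m / h - 1" "t (j - 1) / h \<le> t m / h - 1"
      using h t_pred[of j] j m by (auto simp: field_simps)
    then have "F j = exp (t m / h - 1)" "F (j - 1) = exp (t m / h - 1)"
      using j by (auto simp: F_def E_def max_def)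
    moreover have "E (j - 1) \<le> E j"
      using j m h t_pred[of j] by (auto simp: E_def divide_right_mono)
    ultimately show ?thesis using wt_pos[of j m] j m by (auto simp: less_imp_le)
  next
    case False
    have E: "E (j - 1) \<le> E j"
      using j m h t_pred[of j] by (auto simp: E_def divide_right_mono)
    \<comment> \<open>Here \<open>t m - t j < h\<close> and the step is at most h, so the whole
      interval lies within 2 h of \<open>t m\<close>. This is the 2 h in
      \<open>small\<close>.\<close>
    have "(2 * h) powr (-\<alpha>) \<le> (t m - t (j - 1)) powr (-\<alpha>)"
      using False h(2)[of j] j m t_less[of "j - 1" m] \<alpha> by (intro powr_mono2') auto
    then have "c \<le> wt \<alpha> t m j"
      unfolding c_def using j m \<alpha>
      by (intro order_trans[OF _ wt_ge]) (auto intro!: mult_left_mono)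
    moreover have "F j - F (j - 1) \<le> E j - E (j - 1)" "0 \<le> F j - F (j - 1)"
      using E by (auto simp: F_def)
    ultimately have "(F j - F (j - 1)) * c \<le> (E j - E (j - 1)) * wt \<alpha> t m j"
      using \<alpha> unfolding c_def by (intro mult_mono) auto
    then show ?thesis by (simp add: mult.commute)
  qed
  then have "(\<Sum>j=1..m. c * (F j - F (j - 1))) \<le> D E m"
    unfolding L1_sum_def by (rule sum_mono)
  moreover have "(\<Sum>j=1..m. c * (F j - F (j - 1))) = c * (F m - F 0)"
    using sum_telescope_pred[of 0 m F] by (simp add: sum_distrib_left[symmetric])
  moreover have "F m = E m" "F 0 = exp (- 1) * E m"
    using m by (auto simp: F_def E_def max_def exp_diff exp_minus field_simps)
  moreover have "exp (- 1 :: real) \<le> 1 / 2"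
    using exp_ge_add_one_self[of 1] by (simp add: exp_minus field_simps)
  ultimately have "c * ((1 - exp (- 1)) * E m) \<le> D E m" by (simp add: algebra_simps)
  moreover have "c * ((1 / 2) * E m) \<le> c * ((1 - exp (- 1)) * E m)"
    using \<open>exp (- 1 :: real) \<le> 1 / 2\<close> \<alpha> by (intro mult_left_mono mult_right_mono) (auto simp: c_def E_def)
  moreover have "(2 * (\<mu> + 1)) * ((1 / 2) * E m) \<le> c * ((1 / 2) * E m)"
    using small by (intro mult_right_mono) (auto simp: c_def E_def)
  ultimately show ?thesis by (simp add: algebra_simps)
qed

end

text \<open>The grading condition, rewritten for the relative step: \<tau>_j / t_j is at most c (t_1
  / t_j)^(1/r). The estimates below are in powers of t_1 / t_j, which is at most 1.\<close>

locale graded_mesh = mesh +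
  fixes r c :: real
  assumes M_pos: "1 \<le> M" and r: "1 \<le> r" and c: "0 < c"
    and grading: "j \<in> {1..M} \<Longrightarrow> \<tau> j \<le> c * (t j * (t 1 / t j) powr (1 / r))"
begin

text \<open>The first summand of the constant in \<open>truncation_sum\<close> belongs to the second
  half of [0, t_m]: 2 / (1 - \<alpha>) to the intervals close to t_m, 1 to the others, and 8 bounds
  2^q for q \<le> 3. The second summand belongs to the first half, with the 4 of
  \<open>powr_half_le\<close>.\<close>

definition trunc_const :: real where
  "trunc_const = 8 * (2 / (1 - \<alpha>) + 1) * c powr (2 - \<alpha>) + 4 * c\<^sup>2"

lemma trunc_const_pos: "0 < trunc_const"
  using \<alpha> c by (auto simp: trunc_const_def intro!: add_pos_pos mult_pos_pos)

lemma t_1_pos: "0 < t 1"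
  using t_pos[of 1] M_pos by simp

lemma t_1_le: "1 \<le> j \<Longrightarrow> j \<le> M \<Longrightarrow> t 1 \<le> t j"
  using t_le[of 1 j] by simp

text \<open>Either the relative step is at most 1/2, or the grading forces \<open>t j\<close> below
  \<open>(2 * c) powr r * t 1\<close>, and \<open>t 1 \<le> t (j - 1)\<close>. This comparison of
  nodes takes the place of a comparison of steps.\<close>

lemma mesh_ratio:
  assumes "2 \<le> j" "j \<le> M"
  shows "t j \<le> max 2 ((2 * c) powr r) * t (j - 1)"
proof -
  have pos: "0 < t j" "0 < t 1" "t 1 \<le> t (j - 1)" "0 < t (j - 1)"
    using t_pos[of j] t_1_pos t_1_le[of "j - 1"] t_pos[of "j - 1"] assms by auto
  show ?thesis
  proof (cases "c * (t 1 / t j) powr (1 / r) \<le> 1 / 2")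
    case True
    have "\<tau> j \<le> t j * (c * (t 1 / t j) powr (1 / r))"
      using grading[of j] assms by (simp add: mult_ac)
    also have "\<dots> \<le> t j * (1 / 2)" using True pos by (intro mult_left_mono) auto
    finally have "t j \<le> 2 * t (j - 1)" by simp
    also have "\<dots> \<le> max 2 ((2 * c) powr r) * t (j - 1)" using pos by (intro mult_right_mono) auto
    finally show ?thesis .
  next
    case False
    then have "1 < (2 * c) * (t 1 / t j) powr (1 / r)" by simp
    then have "1 powr r \<le> ((2 * c) * (t 1 / t j) powr (1 / r)) powr r"
      using r by (intro powr_mono2) auto
    also have "\<dots> = (2 * c) powr r * (t 1 / t j)"
      using c pos r by (simp add: powr_mult powr_powr)
    finally have "t j \<le> (2 * c) powr r * t 1" using pos by (simp add: field_simps)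
    also have "\<dots> \<le> max 2 ((2 * c) powr r) * t (j - 1)" using pos by (intro mult_mono) auto
    finally show ?thesis .
  qed
qed

text \<open>The scale is \<open>t 1 powr (1 / r)\<close> times a power of \<open>t j\<close> with
  the nonnegative exponent 1 - 1/r. Hence the step bound at \<open>t m\<close> serves for all
  earlier steps.\<close>

lemma grading_scale_mono:
  assumes "1 \<le> j" "j \<le> m" "m \<le> M"
  shows "t j * (t 1 / t j) powr (1 / r) \<le> t m * (t 1 / t m) powr (1 / r)"
proof -
  have *: "t i * (t 1 / t i) powr (1 / r) = t 1 powr (1 / r) * t i powr (1 - 1 / r)" if "1 \<le> i" "i \<le> M" for i
    using t_pos[of i] t_1_pos that by (simp add: powr_divide powr_diff)
  have "t j powr (1 - 1 / r) \<le> t m powr (1 - 1 / r)"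
    using r t_pos[of j] t_le[of j m] assms by (intro powr_mono2) auto
  then show ?thesis using * assms by (simp add: mult_left_mono)
qed

text \<open>Here -q is the exponent in the bound on the second derivative: q is 3 - \<alpha> for the
  barrier and 2 - \<sigma> for the solution. For t_j \<le> t_m / 2 the kernel is smooth, and the sum
  over j is handed to the caller. For t_j > t_m / 2 the weight \<open>t j powr (-q)\<close> is
  comparable with that at t_m and every step is at most \<eta>; as the steps may be far shorter and
  their number is not controlled, these terms have to telescope.\<close>

lemma truncation_sum:
  fixes err :: "nat \<Rightarrow> real"
  assumes k: "1 \<le> k" "k \<le> m" "m \<le> M" and q: "0 \<le> q" "q \<le> 3" and K: "0 \<le> K"
    and near: "\<And>j. j \<in> {Suc k..m} \<Longrightarrow> err j \<le> K * \<tau> j * t j powr (-q) *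
      (((t m - t (j - 1)) powr (1 - \<alpha>) - (t m - t j) powr (1 - \<alpha>)) / (1 - \<alpha>))"
    and far: "\<And>j. j \<in> {Suc k..m} \<Longrightarrow> j < m \<Longrightarrow> err j \<le> K * \<tau> j * t j powr (-q) *
      \<tau> j * ((t m - t j) powr (-\<alpha>) - (t m - t (j - 1)) powr (-\<alpha>))"
  shows "(\<Sum>j\<in>{Suc k..m}. err j) \<le> K * trunc_const *
    (t m powr (2 - \<alpha> - q) * (t 1 / t m) powr ((2 - \<alpha>) / r) + t m powr (-\<alpha> - 1) *
      (\<Sum>j\<in>{Suc k..m}. \<tau> j * ((t 1 / t j) powr (2 / r) * t j powr (2 - q))))"
proof -
  define x where "x = (t 1 / t m) powr (1 / r)"
  define \<eta> where "\<eta> = c * (t m * x)"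
  define P where "P = K * 2 powr q * t m powr (-q)"
  (* An interval is handled by the first bound if it ends within \<eta> of t m, and by the second one otherwise.
     Truncating the two antiderivatives at these distances makes both sums telescope over all intervals. *)
  define \<Phi> where "\<Phi> i = (min (t m - t i) (2 * \<eta>)) powr (1 - \<alpha>) / (1 - \<alpha>)" for i
  define \<Psi> where "\<Psi> i = (max (t m - t i) \<eta>) powr (-\<alpha>)" for i
  define F where "F j = \<tau> j * ((t 1 / t j) powr (2 / r) * t j powr (2 - q))" for j
  have tm: "0 < t m" using t_pos[of m] k by auto
  have x: "0 < x" using tm t_1_pos by (simp add: x_def)
  have \<eta>: "0 < \<eta>" using tm x c by (simp add: \<eta>_def)
  have P: "0 \<le> P" using K by (simp add: P_def)
  have main: "err j \<le> P * (\<eta> * (\<Phi> (j - 1) - \<Phi> j) + \<eta>\<^sup>2 * (\<Psi> j - \<Psi> (j - 1)))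
      + K * (4 * c\<^sup>2) * t m powr (-\<alpha> - 1) * F j" if j: "j \<in> {Suc k..m}" for j
  proof -
    have jj: "1 \<le> j" "j \<le> m" "j \<le> M" "1 \<le> j - 1" using j k by auto
    have tj: "0 < t j" "t (j - 1) < t j" "t j \<le> t m" "0 < t (j - 1)"
      using t_pos[of j] t_pred[of j] t_le[of j m] t_pos[of "j - 1"] jj k by auto
    have step: "\<tau> j \<le> \<eta>"
      using grading[of j] grading_scale_mono[of j m] jj k c mult_left_mono[of _ _ c]
      unfolding \<eta>_def x_def by (smt (verit) atLeastAtMost_iff)
    have \<Phi>: "\<Phi> j \<le> \<Phi> (j - 1)"
      unfolding \<Phi>_def using tj \<alpha> \<eta> by (intro divide_right_mono powr_mono2) auto
    have \<Psi>: "\<Psi> (j - 1) \<le> \<Psi> j"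
      unfolding \<Psi>_def using tj \<alpha> \<eta> by (intro powr_mono2') auto
    have F: "0 \<le> F j" using tj by (simp add: F_def)
    have near_nonneg: "0 \<le> P * (\<eta> * (\<Phi> (j - 1) - \<Phi> j) + \<eta>\<^sup>2 * (\<Psi> j - \<Psi> (j - 1)))"
      using \<Phi> \<Psi> \<eta> P by (intro mult_nonneg_nonneg add_nonneg_nonneg) auto
    have far_nonneg: "0 \<le> K * (4 * c\<^sup>2) * t m powr (-\<alpha> - 1) * F j"
      using K F by simp
    show ?thesis
    proof (cases "t j \<le> t m / 2")
      case True
      then have "j < m" using tj tm jj by (cases "j = m") auto
      have "(t m - t j) powr (-\<alpha>) - (t m - t (j - 1)) powr (-\<alpha>)
          \<le> \<alpha> * (t m - t j) powr (-\<alpha> - 1) * \<tau> j"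
        using powr_neg_diff_le[of "t m - t j" "t m - t (j - 1)" \<alpha>] True tj tm \<alpha> by auto
      also have "\<dots> \<le> 1 * (4 * t m powr (-\<alpha> - 1)) * \<tau> j"
      proof -
        have "(t m - t j) powr (-\<alpha> - 1) \<le> (t m / 2) powr (-\<alpha> - 1)"
          using True tm \<alpha> by (intro powr_mono2') auto
        also have "\<dots> \<le> 4 * t m powr (-\<alpha> - 1)" using tm \<alpha> by (intro powr_half_le) auto
        finally show ?thesis using \<alpha> tj by (intro mult_right_mono mult_mono) auto
      qed
      finally have osc: "(t m - t j) powr (-\<alpha>) - (t m - t (j - 1)) powr (-\<alpha>)
          \<le> 4 * t m powr (-\<alpha> - 1) * \<tau> j" by simp
      \<comment> \<open>Of the three step factors two are spent on the grading. The third remains as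
        the mesh weight of a Riemann sum.\<close>
      have sq: "(\<tau> j)\<^sup>2 \<le> c\<^sup>2 * ((t 1 / t j) powr (2 / r) * t j powr 2)"
      proof -
        have "(\<tau> j)\<^sup>2 \<le> (c * (t j * (t 1 / t j) powr (1 / r)))\<^sup>2"
          using grading[of j] jj tj by (intro power_mono) auto
        also have "\<dots> = c\<^sup>2 * ((t 1 / t j) powr (2 / r) * t j powr 2)"
          using tj t_1_pos by (simp add: power_mult_distrib powr_power powr_numeral)
        finally show ?thesis .
      qed
      have "err j \<le> K * \<tau> j * t j powr (-q) * \<tau> j *
          ((t m - t j) powr (-\<alpha>) - (t m - t (j - 1)) powr (-\<alpha>))"
        using far[OF j \<open>j < m\<close>] .
      also have "\<dots> \<le> K * \<tau> j * t j powr (-q) * \<tau> j *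
          (4 * t m powr (-\<alpha> - 1) * \<tau> j)"
        using osc K tj by (intro mult_left_mono) auto
      also have "\<dots> = K * 4 * t m powr (-\<alpha> - 1) * \<tau> j * t j powr (-q) * (\<tau> j)\<^sup>2"
        by (simp add: power2_eq_square)
      also have "\<dots> \<le> K * 4 * t m powr (-\<alpha> - 1) * \<tau> j * t j powr (-q) *
          (c\<^sup>2 * ((t 1 / t j) powr (2 / r) * t j powr 2))"
        using sq K tj by (intro mult_left_mono) auto
      also have "\<dots> = K * (4 * c\<^sup>2) * t m powr (-\<alpha> - 1) * F j"
        by (simp add: F_def powr_diff powr_minus divide_inverse)
      finally show ?thesis using near_nonneg by linarith
    next
      case False
      have tq: "t j powr (-q) \<le> 2 powr q * t m powr (-q)"
      proof -
        have "t j powr (-q) \<le> (t m / 2) powr (-q)"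
          using False tm q by (intro powr_mono2') auto
        also have "\<dots> = 2 powr q * t m powr (-q)"
          using tm by (simp add: powr_divide powr_minus field_simps)
        finally show ?thesis .
      qed
      show ?thesis
      proof (cases "t j > t m - \<eta>")
        case True
        have W: "((t m - t (j - 1)) powr (1 - \<alpha>) - (t m - t j) powr (1 - \<alpha>)) / (1 - \<alpha>) = \<Phi> (j - 1) - \<Phi> j"
          using True step \<eta> by (simp add: \<Phi>_def min_def diff_divide_distrib)
        have "err j \<le> K * \<tau> j * t j powr (-q) * (\<Phi> (j - 1) - \<Phi> j)"
          using near[OF j] unfolding W .
        also have "\<dots> \<le> K * \<eta> * (2 powr q * t m powr (-q)) * (\<Phi> (j - 1) - \<Phi> j)"
          using \<Phi> K step tq tj \<eta> by (intro mult_right_mono mult_mono) auto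
        also have "\<dots> = P * (\<eta> * (\<Phi> (j - 1) - \<Phi> j))" by (simp add: P_def)
        also have "\<dots> \<le> P * (\<eta> * (\<Phi> (j - 1) - \<Phi> j) + \<eta>\<^sup>2 * (\<Psi> j - \<Psi> (j - 1)))"
          using \<Psi> P by (intro mult_left_mono) auto
        finally show ?thesis using far_nonneg by linarith
      next
        case False
        then have "j < m" using \<eta> jj by (cases "j = m") auto
        have W: "(t m - t j) powr (-\<alpha>) - (t m - t (j - 1)) powr (-\<alpha>) = \<Psi> j - \<Psi> (j - 1)"
          using False tj by (simp add: \<Psi>_def max_absorb1)
        have "err j \<le> K * \<tau> j * t j powr (-q) * \<tau> j * (\<Psi> j - \<Psi> (j - 1))"
          using far[OF j \<open>j < m\<close>] W by simp
        also have "\<dots> \<le> K * \<eta> * (2 powr q * t m powr (-q)) * \<eta> * (\<Psi> j - \<Psi> (j - 1))"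
          using \<Psi> K step tq tj \<eta> by (intro mult_right_mono mult_mono) auto
        also have "\<dots> = P * (\<eta>\<^sup>2 * (\<Psi> j - \<Psi> (j - 1)))" by (simp add: P_def power2_eq_square)
        also have "\<dots> \<le> P * (\<eta> * (\<Phi> (j - 1) - \<Phi> j) + \<eta>\<^sup>2 * (\<Psi> j - \<Psi> (j - 1)))"
          using \<Phi> P \<eta> by (intro mult_left_mono) auto
        finally show ?thesis using far_nonneg by linarith
      qed
    qed
  qed
  have S1: "(\<Sum>j\<in>{Suc k..m}. \<Phi> (j - 1) - \<Phi> j) \<le> (2 * \<eta>) powr (1 - \<alpha>) / (1 - \<alpha>)"
  proof -
    have "(\<Sum>j\<in>{Suc k..m}. \<Phi> (j - 1) - \<Phi> j) = \<Phi> k - \<Phi> m"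
      using sum_telescope_pred[OF \<open>k \<le> m\<close>, of "\<lambda>j. - \<Phi> j"] by simp
    also have "\<dots> \<le> \<Phi> k" using \<alpha> by (simp add: \<Phi>_def)
    also have "\<dots> \<le> (2 * \<eta>) powr (1 - \<alpha>) / (1 - \<alpha>)"
      unfolding \<Phi>_def using \<alpha> \<eta> t_le[of k m] k by (intro divide_right_mono powr_mono2) auto
    finally show ?thesis .
  qed
  have S2: "(\<Sum>j\<in>{Suc k..m}. \<Psi> j - \<Psi> (j - 1)) \<le> \<eta> powr (-\<alpha>)"
  proof -
    have "(\<Sum>j\<in>{Suc k..m}. \<Psi> j - \<Psi> (j - 1)) = \<Psi> m - \<Psi> k"
      using sum_telescope_pred[OF \<open>k \<le> m\<close>, of \<Psi>] by simp
    also have "\<dots> \<le> \<Psi> m" by (simp add: \<Psi>_def)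
    also have "\<dots> = \<eta> powr (-\<alpha>)" using \<eta> by (simp add: \<Psi>_def)
    finally show ?thesis .
  qed
  have "(\<Sum>j\<in>{Suc k..m}. err j) \<le> (\<Sum>j\<in>{Suc k..m}.
      P * (\<eta> * (\<Phi> (j - 1) - \<Phi> j) + \<eta>\<^sup>2 * (\<Psi> j - \<Psi> (j - 1)))
      + K * (4 * c\<^sup>2) * t m powr (-\<alpha> - 1) * F j)"
    using main by (rule sum_mono)
  also have "\<dots> = P * (\<eta> * (\<Sum>j\<in>{Suc k..m}. \<Phi> (j - 1) - \<Phi> j) + \<eta>\<^sup>2 * (\<Sum>j\<in>{Suc k..m}. \<Psi> j - \<Psi> (j - 1)))
      + K * (4 * c\<^sup>2) * t m powr (-\<alpha> - 1) * (\<Sum>j\<in>{Suc k..m}. F j)"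
    by (simp only: sum.distrib sum_distrib_left distrib_left)
  also have "\<dots> \<le> P * (\<eta> * ((2 * \<eta>) powr (1 - \<alpha>) / (1 - \<alpha>)) + \<eta>\<^sup>2 * \<eta> powr (-\<alpha>))
      + K * (4 * c\<^sup>2) * t m powr (-\<alpha> - 1) * (\<Sum>j\<in>{Suc k..m}. F j)"
    using S1 S2 P \<eta> by (intro add_right_mono mult_left_mono add_mono) auto
  also have "P * (\<eta> * ((2 * \<eta>) powr (1 - \<alpha>) / (1 - \<alpha>)) + \<eta>\<^sup>2 * \<eta> powr (-\<alpha>))
      \<le> K * (8 * (2 / (1 - \<alpha>) + 1) * c powr (2 - \<alpha>)) * (t m powr (2 - \<alpha> - q) * (t 1 / t m) powr ((2 - \<alpha>) / r))"
  proof -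
    have e1: "\<eta> * (2 * \<eta>) powr (1 - \<alpha>) = 2 powr (1 - \<alpha>) * \<eta> powr (2 - \<alpha>)"
      using \<eta> by (simp add: powr_mult powr_mult_base algebra_simps)
    have e2: "\<eta>\<^sup>2 * \<eta> powr (-\<alpha>) = \<eta> powr (2 - \<alpha>)"
      using \<eta> by (simp add: powr_diff powr_minus powr_numeral divide_inverse)
    have e3: "\<eta> powr (2 - \<alpha>) = c powr (2 - \<alpha>) * (t m powr (2 - \<alpha>) * (t 1 / t m) powr ((2 - \<alpha>) / r))"
      using c tm x by (simp add: \<eta>_def powr_mult x_def powr_powr)
    have "(2::real) powr (1 - \<alpha>) \<le> 2 powr 1" using \<alpha> by (intro powr_mono) auto
    then have le: "2 powr (1 - \<alpha>) / (1 - \<alpha>) + 1 \<le> 2 / (1 - \<alpha>) + 1"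
      using \<alpha> by (intro add_right_mono divide_right_mono) auto
    have "(2::real) powr q \<le> 2 powr 3" using q by (intro powr_mono) auto
    then have q8: "(2::real) powr q \<le> 8" by simp
    have "P * (\<eta> * ((2 * \<eta>) powr (1 - \<alpha>) / (1 - \<alpha>)) + \<eta>\<^sup>2 * \<eta> powr (-\<alpha>))
      = P * ((2 powr (1 - \<alpha>) / (1 - \<alpha>) + 1) * \<eta> powr (2 - \<alpha>))"
      by (simp only: times_divide_eq_right e1 e2) (simp add: algebra_simps)
    also have "\<dots> = K * (2 powr q * (2 powr (1 - \<alpha>) / (1 - \<alpha>) + 1)) * c powr (2 - \<alpha>) *
        (t m powr (2 - \<alpha> - q) * (t 1 / t m) powr ((2 - \<alpha>) / r))"
      unfolding P_def e3 using tm by (simp add: powr_diff powr_minus divide_inverse)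
    also have "\<dots> \<le> K * (8 * (2 / (1 - \<alpha>) + 1)) * c powr (2 - \<alpha>) *
        (t m powr (2 - \<alpha> - q) * (t 1 / t m) powr ((2 - \<alpha>) / r))"
      using le q8 K \<alpha> by (intro mult_right_mono mult_left_mono mult_mono) auto
    finally show ?thesis by (simp only: mult.assoc)
  qed
  finally have fin: "(\<Sum>j\<in>{Suc k..m}. err j) \<le>
      K * (8 * (2 / (1 - \<alpha>) + 1) * c powr (2 - \<alpha>)) * (t m powr (2 - \<alpha> - q) * (t 1 / t m) powr ((2 - \<alpha>) / r))
      + K * (4 * c\<^sup>2) * (t m powr (-\<alpha> - 1) * (\<Sum>j\<in>{Suc k..m}. F j))" by (simp add: mult.assoc)
  have S3: "0 \<le> t m powr (-\<alpha> - 1) * (\<Sum>j\<in>{Suc k..m}. F j)"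
    using k t_pred by (intro mult_nonneg_nonneg sum_nonneg) (auto simp: F_def less_imp_le)
  have abs: "a \<le> K * (A + B) * (X + Y)" if "a \<le> K * A * X + K * B * Y" "0 \<le> X" "0 \<le> Y" "0 \<le> A" "0 \<le> B" for a A B X Y :: real
  proof -
    have "0 \<le> K * (A * Y + B * X)" using that K by simp
    then show ?thesis using that(1) by (simp add: algebra_simps)
  qed
  have "(\<Sum>j\<in>{Suc k..m}. err j) \<le>
      K * (8 * (2 / (1 - \<alpha>) + 1) * c powr (2 - \<alpha>) + 4 * c\<^sup>2) *
      (t m powr (2 - \<alpha> - q) * (t 1 / t m) powr ((2 - \<alpha>) / r) + t m powr (-\<alpha> - 1) * (\<Sum>j\<in>{Suc k..m}. F j))"
    using \<alpha> S3 by (intro abs[OF fin]) auto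
  then show ?thesis by (simp add: trunc_const_def F_def)
qed

end

section \<open>Riemann sums of powers on an arbitrary mesh\<close>

context mesh begin

text \<open>A right-endpoint sum of a nonincreasing function stays below the integral, whatever the
  steps are. The exponents below, above and equal to -1 in this and the next two lemmas lead to the
  three cases of the error bound, the last one to the logarithm.\<close>

lemma sum_step_powr_le:
  assumes "1 \<le> k" "k \<le> m" "m \<le> M" "0 < \<epsilon>"
  shows "(\<Sum>j\<in>{Suc k..m}. \<tau> j * t j powr (-1 - \<epsilon>)) \<le> t k powr (-\<epsilon>) / \<epsilon>"
proof -
  have "\<tau> j * t j powr (-1 - \<epsilon>) \<le> (- (t j powr (-\<epsilon>))) / \<epsilon> - (- (t (j - 1) powr (-\<epsilon>))) / \<epsilon>"
    if j: "j \<in> {Suc k..m}" for j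
  proof -
    have pos: "0 < t (j - 1)" "t (j - 1) < t j"
      using t_pos[of "j - 1"] t_pred[of j] j assms by auto
    then obtain z where z: "t (j - 1) < z" "z < t j"
      "t j powr (-\<epsilon>) - t (j - 1) powr (-\<epsilon>) = \<tau> j * (- \<epsilon> * z powr (- \<epsilon> - 1))"
      by (rule powr_mvt)
    have "t j powr (- \<epsilon> - 1) \<le> z powr (- \<epsilon> - 1)" using z pos assms by (intro powr_mono2') auto
    then have "\<tau> j * (\<epsilon> * t j powr (- \<epsilon> - 1)) \<le> \<tau> j * (\<epsilon> * z powr (- \<epsilon> - 1))"
      using pos assms by (intro mult_left_mono) auto
    also have "\<dots> = t (j - 1) powr (-\<epsilon>) - t j powr (-\<epsilon>)" using z by simp
    finally have "\<tau> j * (\<epsilon> * t j powr (- 1 - \<epsilon>)) \<le> t (j - 1) powr (-\<epsilon>) - t j powr (-\<epsilon>)"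
      by (simp add: minus_diff_commute)
    then show ?thesis using assms by (simp add: field_simps)
  qed
  then have "(\<Sum>j\<in>{Suc k..m}. \<tau> j * t j powr (-1 - \<epsilon>)) \<le>
      (\<Sum>j\<in>{Suc k..m}. (- (t j powr (-\<epsilon>))) / \<epsilon> - (- (t (j - 1) powr (-\<epsilon>))) / \<epsilon>)"
    by (rule sum_mono)
  also have "\<dots> = t k powr (-\<epsilon>) / \<epsilon> - t m powr (-\<epsilon>) / \<epsilon>"
    using sum_telescope_pred[OF \<open>k \<le> m\<close>, of "\<lambda>j. (- (t j powr (-\<epsilon>))) / \<epsilon>"] by simp
  finally show ?thesis using assms by (smt (verit) divide_nonneg_pos powr_ge_zero)
qed

lemma sum_step_powr_le':
  assumes "m \<le> M" "0 < q" "q \<le> 1"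
  shows "(\<Sum>j=1..m. \<tau> j * t j powr (q - 1)) \<le> t m powr q / q"
proof -
  have "\<tau> j * t j powr (q - 1) \<le> t j powr q / q - t (j - 1) powr q / q"
    if j: "j \<in> {1..m}" for j
    using powr_diff_ge[of "t (j - 1)" "t j" q] t_nonneg[of "j - 1"] t_pred[of j] j assms
    by (auto simp: field_simps)
  then have "(\<Sum>j=1..m. \<tau> j * t j powr (q - 1)) \<le> (\<Sum>j=1..m. t j powr q / q - t (j - 1) powr q / q)"
    by (rule sum_mono)
  also have "\<dots> = t m powr q / q"
    using sum_telescope_pred[of 0 m "\<lambda>j. t j powr q / q"] t_0 by simp
  finally show ?thesis .
qed

lemma sum_step_inverse_le:
  assumes "1 \<le> k" "k \<le> m" "m \<le> M"
  shows "(\<Sum>j\<in>{Suc k..m}. \<tau> j / t j) \<le> ln (t m / t k)"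
proof -
  have pos: "0 < t j" if "j \<in> {k..m}" for j using t_pos[of j] that assms by auto
  have "\<tau> j / t j \<le> ln (t j) - ln (t (j - 1))" if j: "j \<in> {Suc k..m}" for j
  proof -
    have p: "0 < t j" "0 < t (j - 1)" by (rule pos; use j assms in force)+
    have "ln (t (j - 1) / t j) \<le> t (j - 1) / t j - 1" using p by (intro ln_le_minus_one) auto
    then show ?thesis using p by (simp add: ln_div diff_divide_distrib)
  qed
  then have "(\<Sum>j\<in>{Suc k..m}. \<tau> j / t j) \<le> (\<Sum>j\<in>{Suc k..m}. ln (t j) - ln (t (j - 1)))"
    by (rule sum_mono)
  also have "\<dots> = ln (t m) - ln (t k)"
    using sum_telescope_pred[OF \<open>k \<le> m\<close>, of "\<lambda>j. ln (t j)"] by simp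
  finally show ?thesis using pos[of m] pos[of k] assms by (simp add: ln_div)
qed

end

section \<open>Superposition of cut-off responses\<close>

lemma sum_telescope_Suc:
  fixes f :: "nat \<Rightarrow> real"
  assumes "a \<le> b"
  shows "(\<Sum>l\<in>{a..b}. f l - f (Suc l)) = f a - f (Suc b)"
  using assms by (induction b rule: nat_induct_at_least) (auto simp: atLeastAtMostSuc_conv)

definition cutoff :: "nat \<Rightarrow> nat \<Rightarrow> real" where "cutoff k j = (if j \<le> k then 1 else 0)"

context mesh_op begin

text \<open>A nonincreasing g is the sum of its drops times the indicators \<open>cutoff l\<close>.
  Responses add up, and summation by parts turns the bounds K t_l back into a Riemann sum of g, with
  g frozen at \<open>g k\<close> on [0, t_k]. Due to the freezing only the cut-offs with l \<ge> k
  occur, which are those that the bootstrap controls.\<close>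

lemma J_le_weighted_sum:
  assumes k: "1 \<le> k" "k \<le> M" and m: "m \<le> M"
    and K: "\<And>l. l \<in> {k..M} \<Longrightarrow> J (cutoff l) m \<le> K * t l"
    and g: "\<And>l. k \<le> l \<Longrightarrow> l < M \<Longrightarrow> g (Suc l) \<le> g l" "0 \<le> g M"
    and h: "\<And>j. j \<in> {1..M} \<Longrightarrow> h j \<le> g (max j k)"
  shows "J h m \<le> K * (g k * t k + (\<Sum>l\<in>{Suc k..M}. \<tau> l * g l))"
proof -
  \<comment> \<open>Extended by 0, so that the last drop is \<open>g M\<close> itself.\<close>
  define g' where "g' l = (if l \<le> M then g l else 0)" for l
  define d where "d l = g' l - g' (Suc l)" for l
  define w where "w j = (\<Sum>l\<in>{k..M}. d l * J (cutoff l) j)" for j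
  have d: "0 \<le> d l" if "l \<in> {k..M}" for l
    using g that by (cases "l = M") (auto simp: d_def g'_def)
  have "J h m \<le> w m"
  proof (rule J_le)
    show "0 \<le> w 0" by (simp add: w_def)
    fix j assume j: "j \<in> {1..M}"
    have "D w j = (\<Sum>l\<in>{k..M}. d l * D (J (cutoff l)) j)"
      unfolding w_def by (rule L1_sum_sum)
    then have "D w j - \<mu> * w j = (\<Sum>l\<in>{k..M}. d l * (D (J (cutoff l)) j - \<mu> * J (cutoff l) j))"
      by (simp add: w_def sum_subtractf sum_distrib_left right_diff_distrib mult.left_commute)
    also have "\<dots> = (\<Sum>l\<in>{k..M}. d l * cutoff l j)"
      using j by (simp add: D_J)
    also have "\<dots> = (\<Sum>l\<in>{max j k..M}. d l)"
      by (intro sum.mono_neutral_cong_right) (auto simp: cutoff_def)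
    also have "\<dots> = g (max j k)"
      unfolding d_def using j k by (subst sum_telescope_Suc) (auto simp: g'_def)
    finally show "h j \<le> D w j - \<mu> * w j" using h[OF j] by simp
  qed (use m in auto)
  also have "w m \<le> (\<Sum>l\<in>{k..M}. d l * (K * t l))"
    unfolding w_def using d K by (intro sum_mono mult_left_mono) auto
  also have "\<dots> = K * (\<Sum>l\<in>{k..M}. (g' l - g' (Suc l)) * t l)"
    by (simp add: sum_distrib_left d_def algebra_simps)
  also have "(\<Sum>l\<in>{k..n}. (g' l - g' (Suc l)) * t l) =
      g' k * t k + (\<Sum>l\<in>{Suc k..n}. \<tau> l * g' l) - g' (Suc n) * t n" if "k \<le> n" for n
    using that by (induction n rule: nat_induct_at_least) (auto simp: atLeastAtMostSuc_conv algebra_simps)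
  from this[OF k(2)] have "(\<Sum>l\<in>{k..M}. (g' l - g' (Suc l)) * t l) =
      g k * t k + (\<Sum>l\<in>{Suc k..M}. \<tau> l * g l)"
    using k by (simp add: g'_def)
  finally show ?thesis .
qed

end

section \<open>The cut-off power barrier\<close>

context graded_mesh begin

(* The Riemann-Liouville derivative annihilates t^(\<alpha>-1). The jump of the barrier from the value 0 at time 0
   supplies the right-hand side 1 / t k on {1..k}. *)
definition barrier :: "nat \<Rightarrow> nat \<Rightarrow> real" where
  "barrier k j = (if j = 0 then 0 else max (t j) (t k) powr (\<alpha> - 1))"

text \<open>The decay rate of the barrier's discretization error. As \<delta> \<le> 1/r, the grading
  yields \<open>(t 1 / t j) powr (2 * \<delta>)\<close>: one \<delta> makes the sum over j converge
  and the other one remains. As \<delta> \<le> \<alpha>, the factor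
  \<open>t j powr (\<alpha> - \<delta>)\<close> may be replaced by its value at
  \<open>t m\<close>.\<close>

definition \<delta> :: real where "\<delta> = min \<alpha> (1 / r)"

lemma \<delta>: "0 < \<delta>" "\<delta> \<le> \<alpha>" "\<delta> \<le> 1 / r"
  using \<alpha> r by (auto simp: \<delta>_def)

definition ratio :: real where "ratio = max 2 ((2 * c) powr r)"

definition barrier_const :: real where
  "barrier_const = 2 * ratio ^ 3 * trunc_const * (1 + 1 / \<delta>)"

lemma barrier_const_pos: "0 < barrier_const"
  using trunc_const_pos \<delta>(1) by (auto simp: barrier_const_def ratio_def intro!: mult_pos_pos add_pos_pos)

lemma ratio_powr_le:
  assumes "2 \<le> j" "j \<le> M" "0 \<le> q" "q \<le> 3"
  shows "t (j - 1) powr (-q) \<le> ratio ^ 3 * t j powr (-q)"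
proof -
  have pos: "0 < t j" "0 < t (j - 1)" "0 < ratio" "1 \<le> ratio"
    using t_pos[of j] t_pos[of "j - 1"] assms by (auto simp: ratio_def)
  have "t (j - 1) powr (-q) \<le> (t j / ratio) powr (-q)"
    using mesh_ratio[OF assms(1,2), folded ratio_def] pos assms
    by (intro powr_mono2') (auto simp: field_simps)
  also have "\<dots> = ratio powr q * t j powr (-q)"
    using pos by (simp add: powr_divide powr_minus field_simps)
  also have "\<dots> \<le> ratio powr 3 * t j powr (-q)"
    using pos assms by (intro mult_right_mono powr_mono) auto
  finally show ?thesis using pos by (simp add: powr_numeral)
qed

text \<open>Supplies the two hypotheses of \<open>truncation_sum\<close>. The second derivative is
  largest at the left end \<open>t (j - 1)\<close>, and \<open>ratio\<close> moves its bound to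
  \<open>t j\<close>; hence j starts at 2, where the left end is positive.\<close>

lemma interval_quadrature_error:
  fixes g g' g'' :: "real \<Rightarrow> real"
  assumes j: "j \<in> {Suc 1..m}" "m \<le> M" and q: "0 \<le> q" "q \<le> 3" and K: "0 \<le> K"
    and g: "\<And>s. s \<in> {t (j - 1)..t j} \<Longrightarrow> (g has_real_derivative g' s) (at s within {t (j - 1)..t j})"
    and g': "\<And>s. s \<in> {t (j - 1)<..<t j} \<Longrightarrow> (g' has_real_derivative g'' s) (at s)"
    and g'': "\<And>s. s \<in> {t (j - 1)<..<t j} \<Longrightarrow> \<bar>g'' s\<bar> \<le> K * s powr (-q)"
    and I: "((\<lambda>s. (t m - s) powr (-\<alpha>) * g' s) has_integral I) {t (j - 1)..t j}"
  defines "err \<equiv> \<bar>(g (t j) - g (t (j - 1))) / \<tau> j *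
    (((t m - t (j - 1)) powr (1 - \<alpha>) - (t m - t j) powr (1 - \<alpha>)) / (1 - \<alpha>)) - I\<bar>"
  shows "err \<le> K * ratio ^ 3 * \<tau> j * t j powr (-q) *
      (((t m - t (j - 1)) powr (1 - \<alpha>) - (t m - t j) powr (1 - \<alpha>)) / (1 - \<alpha>))"
    and "j < m \<Longrightarrow> err \<le> K * ratio ^ 3 * \<tau> j * t j powr (-q) *
      \<tau> j * ((t m - t j) powr (-\<alpha>) - (t m - t (j - 1)) powr (-\<alpha>))"
proof -
  have ord: "0 < t (j - 1)" "t (j - 1) < t j" "t j \<le> t m"
    using t_pos[of "j - 1"] t_pred[of j] t_le[of j m] j by auto
  have p: "(g' has_integral g (t j) - g (t (j - 1))) {t (j - 1)..t j}"
    using ord g by (intro fundamental_theorem_of_calculus) (auto simp: has_real_derivative_iff_has_vector_derivative)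
  have H: "\<bar>g' s - (g (t j) - g (t (j - 1))) / \<tau> j\<bar> \<le> K * ratio ^ 3 * \<tau> j * t j powr (-q)"
    if s: "s \<in> {t (j - 1)<..<t j}" for s
  proof -
    have "\<bar>g'' x\<bar> \<le> K * t (j - 1) powr (-q)" if x: "x \<in> {t (j - 1)<..<t j}" for x
    proof -
      have "\<bar>g'' x\<bar> \<le> K * x powr (-q)" using x by (rule g'')
      also have "\<dots> \<le> K * t (j - 1) powr (-q)"
        using x ord K q by (intro mult_left_mono powr_mono2') auto
      finally show ?thesis .
    qed
    then have "\<bar>g' s - (g (t j) - g (t (j - 1))) / \<tau> j\<bar> \<le> \<tau> j * (K * t (j - 1) powr (-q))"
      using ord s g g' by (intro deriv_minus_slope_le[where g'' = g'']) auto
    also have "\<dots> \<le> \<tau> j * (K * (ratio ^ 3 * t j powr (-q)))"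
      using ratio_powr_le[of j q] j K q ord by (intro mult_left_mono) auto
    finally show ?thesis by (simp add: mult_ac)
  qed
  show "err \<le> K * ratio ^ 3 * \<tau> j * t j powr (-q) *
      (((t m - t (j - 1)) powr (1 - \<alpha>) - (t m - t j) powr (1 - \<alpha>)) / (1 - \<alpha>))"
    unfolding err_def using ord \<alpha> by (intro kernel_quadrature_error(1)[OF _ _ _ _ p I H]) auto
  show "err \<le> K * ratio ^ 3 * \<tau> j * t j powr (-q) *
      \<tau> j * ((t m - t j) powr (-\<alpha>) - (t m - t (j - 1)) powr (-\<alpha>))" if "j < m"
    unfolding err_def using ord \<alpha> t_less[of j m] that j
    by (intro kernel_quadrature_error(2)[OF _ _ _ _ p I H]) auto
qed

text \<open>The barrier is constant on the nodes 1, ..., k, so only its jump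
  \<open>t k powr (\<alpha> - 1)\<close> in the first interval counts, with a weight of at least
  \<open>(1 - \<alpha>) * t k powr (-\<alpha>)\<close>.\<close>

lemma barrier_before:
  assumes "1 \<le> m" "m \<le> k" "k \<le> M"
  shows "(1 - \<alpha>) / t k \<le> L1_sum \<alpha> t (barrier k) m"
proof -
  have pos: "0 < t k" "0 < t m" "t m \<le> t k"
    using t_pos[of k] t_pos[of m] t_le[of m k] assms by auto
  have "L1_sum \<alpha> t (barrier k) m = (\<Sum>j\<in>{1}. (barrier k j - barrier k (j - 1)) * wt \<alpha> t m j)"
    unfolding L1_sum_def using assms t_le
    by (intro sum.mono_neutral_right) (auto simp: barrier_def max_def)
  also have "\<dots> = t k powr (\<alpha> - 1) * wt \<alpha> t m 1"
    using t_le[of 1 k] assms by (simp add: barrier_def max_def)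
  also have "\<dots> \<ge> t k powr (\<alpha> - 1) * ((1 - \<alpha>) * t k powr (-\<alpha>))"
  proof (intro mult_left_mono)
    have "(1 - \<alpha>) * t k powr (-\<alpha>) \<le> (1 - \<alpha>) * t m powr (-\<alpha>)"
      using pos \<alpha> by (intro mult_left_mono powr_mono2') auto
    also have "\<dots> \<le> wt \<alpha> t m 1" using wt_ge[of 1 m] assms t_0 by simp
    finally show "(1 - \<alpha>) * t k powr (-\<alpha>) \<le> wt \<alpha> t m 1" .
  qed simp
  also have "t k powr (\<alpha> - 1) * ((1 - \<alpha>) * t k powr (-\<alpha>)) = (1 - \<alpha>) / t k"
    using pos by (simp add: powr_diff powr_minus)
  finally show ?thesis by simp
qed

text \<open>If the L1 sum were an exact integral, the decrease of the barrier after t_k would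
  contribute \<open>- (1 - \<alpha>) * F (t k)\<close>, and the initial jump outweighs this. What is
  left is the quadrature error, summed by \<open>truncation_sum\<close> with q = 3 -
  \<alpha>.\<close>

lemma barrier_after:
  assumes "1 \<le> k" "k < m" "m \<le> M"
  shows "- barrier_const * (1 / t m * (t 1 / t m) powr \<delta>) \<le> L1_sum \<alpha> t (barrier k) m"
proof -
  define W where "W j = ((t m - t (j - 1)) powr (1 - \<alpha>) - (t m - t j) powr (1 - \<alpha>)) / (1 - \<alpha>)" for j
  define p where "p s = (\<alpha> - 1) * s powr (\<alpha> - 2)" for s :: real
  (* F is an antiderivative of (t m - s)^(-\<alpha>) * p s. *)
  define F where "F s = (t m - s) powr (1 - \<alpha>) * s powr (\<alpha> - 1) / t m" for s
  define \<Delta> where "\<Delta> j = t j powr (\<alpha> - 1) - t (j - 1) powr (\<alpha> - 1)" for j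
  define err where "err j = \<bar>\<Delta> j / \<tau> j * W j - (F (t j) - F (t (j - 1)))\<bar>" for j
  have tm: "0 < t m" and tk: "0 < t k" "t k < t m"
    using t_pos[of m] t_pos[of k] t_less[of k m] assms by auto
  have both: "err j \<le> 2 * ratio ^ 3 * \<tau> j * t j powr (- (3 - \<alpha>)) * W j"
    "j < m \<Longrightarrow> err j \<le> 2 * ratio ^ 3 * \<tau> j * t j powr (- (3 - \<alpha>)) *
      \<tau> j * ((t m - t j) powr (-\<alpha>) - (t m - t (j - 1)) powr (-\<alpha>))"
    if j: "j \<in> {Suc k..m}" for j
  proof -
    have ord: "0 < t (j - 1)" "t (j - 1) < t j" "t j \<le> t m"
      using t_pos[of "j - 1"] t_pred[of j] t_le[of j m] j assms by auto
    have I: "((\<lambda>s. (t m - s) powr (-\<alpha>) * p s) has_integral F (t j) - F (t (j - 1))) {t (j - 1)..t j}"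
    proof (rule fundamental_theorem_of_calculus_interior)
      show "continuous_on {t (j - 1)..t j} F"
        unfolding F_def using ord \<alpha> tm by (intro continuous_intros continuous_on_powr') auto
      fix s assume s: "s \<in> {t (j - 1)<..<t j}"
      have e12: "s powr (\<alpha> - 1) = s * s powr (\<alpha> - 2)" "(t m - s) powr (1 - \<alpha>) = (t m - s) * (t m - s) powr (-\<alpha>)"
        using s ord by (auto simp: powr_mult_base)
      have e: "(1 - \<alpha>) * (t m - s) powr (-\<alpha>) * (0 - 1) * s powr (\<alpha> - 1)
          + (\<alpha> - 1) * s powr (\<alpha> - 2) * (t m - s) powr (1 - \<alpha>) = t m * ((t m - s) powr (-\<alpha>) * p s)"
        unfolding p_def e12 by (simp add: algebra_simps)
      have "(F has_real_derivative (t m * ((t m - s) powr (-\<alpha>) * p s)) / t m) (at s)"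
        unfolding F_def e[symmetric] using s ord \<alpha>
        by (auto intro!: derivative_eq_intros simp: field_simps)
      then show "(F has_vector_derivative (t m - s) powr (-\<alpha>) * p s) (at s)"
        using tm by (simp add: has_real_derivative_iff_has_vector_derivative)
    qed (use ord in auto)
    have d: "((\<lambda>a. a powr (\<alpha> - 1)) has_real_derivative p x) (at x within {t (j - 1)..t j})"
      if "x \<in> {t (j - 1)..t j}" for x
      by (rule has_field_derivative_at_within) (use that ord in \<open>auto simp: p_def intro!: derivative_eq_intros\<close>)
    have d': "(p has_real_derivative (\<alpha> - 1) * ((\<alpha> - 2) * x powr (\<alpha> - 3))) (at x)"
      if "x \<in> {t (j - 1)<..<t j}" for x
      using that ord unfolding p_def by (auto intro!: derivative_eq_intros)
    have d'': "\<bar>(\<alpha> - 1) * ((\<alpha> - 2) * x powr (\<alpha> - 3))\<bar> \<le> 2 * x powr (- (3 - \<alpha>))" for x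
    proof -
      have "\<bar>(\<alpha> - 1) * (\<alpha> - 2)\<bar> \<le> 1 * 2" unfolding abs_mult using \<alpha> by (intro mult_mono) auto
      then have "\<bar>(\<alpha> - 1) * (\<alpha> - 2)\<bar> * x powr (\<alpha> - 3) \<le> 2 * x powr (\<alpha> - 3)"
        by (intro mult_right_mono) auto
      then show ?thesis by (simp add: abs_mult mult.assoc)
    qed
    show "err j \<le> 2 * ratio ^ 3 * \<tau> j * t j powr (- (3 - \<alpha>)) * W j"
      unfolding err_def W_def \<Delta>_def using \<alpha> j assms
      by (intro interval_quadrature_error(1)[OF _ _ _ _ _ d d' d'' I]) auto
    show "err j \<le> 2 * ratio ^ 3 * \<tau> j * t j powr (- (3 - \<alpha>)) *
      \<tau> j * ((t m - t j) powr (-\<alpha>) - (t m - t (j - 1)) powr (-\<alpha>))" if "j < m"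
      unfolding err_def W_def \<Delta>_def using \<alpha> j assms that
      by (intro interval_quadrature_error(2)[OF _ _ _ _ _ d d' d'' I]) auto
  qed
  have "(\<Sum>j\<in>{Suc k..m}. err j) \<le> 2 * ratio ^ 3 * trunc_const *
    (t m powr (2 - \<alpha> - (3 - \<alpha>)) * (t 1 / t m) powr ((2 - \<alpha>) / r) + t m powr (-\<alpha> - 1) *
      (\<Sum>j\<in>{Suc k..m}. \<tau> j * ((t 1 / t j) powr (2 / r) * t j powr (2 - (3 - \<alpha>)))))"
    using both assms \<alpha> unfolding W_def by (intro truncation_sum) (auto simp: ratio_def)
  also have "\<dots> \<le> 2 * ratio ^ 3 * trunc_const *
    (1 / t m * (t 1 / t m) powr \<delta> + t m powr (-\<alpha> - 1) * (t m powr \<alpha> * (t 1 / t m) powr \<delta> / \<delta>))"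
  proof (intro mult_left_mono add_mono)
    have "(t 1 / t m) powr ((2 - \<alpha>) / r) \<le> (t 1 / t m) powr \<delta>"
    proof (intro powr_mono')
      have "1 / r \<le> (2 - \<alpha>) / r" using r \<alpha> by (intro divide_right_mono) auto
      then show "\<delta> \<le> (2 - \<alpha>) / r" using \<delta>(3) by simp
    qed (use t_1_pos t_1_le[of m] assms tm in auto)
    then show "t m powr (2 - \<alpha> - (3 - \<alpha>)) * (t 1 / t m) powr ((2 - \<alpha>) / r) \<le> 1 / t m * (t 1 / t m) powr \<delta>"
      using tm by (simp add: powr_minus divide_inverse mult_left_mono)
    have "(\<Sum>j\<in>{Suc k..m}. \<tau> j * ((t 1 / t j) powr (2 / r) * t j powr (2 - (3 - \<alpha>))))
      \<le> (\<Sum>j\<in>{Suc k..m}. \<tau> j * (t 1 powr (2 * \<delta>) * t m powr (\<alpha> - \<delta>) * t j powr (-1 - \<delta>)))"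
    proof (intro sum_mono mult_left_mono)
      fix j assume j: "j \<in> {Suc k..m}"
      have ord: "0 < t j" "t 1 \<le> t j" "t j \<le> t m" "t (j - 1) < t j"
        using t_pos[of j] t_1_le[of j] t_le[of j m] t_pred[of j] j assms by auto
      have "(t 1 / t j) powr (2 / r) * t j powr (2 - (3 - \<alpha>)) \<le> (t 1 / t j) powr (2 * \<delta>) * t j powr (\<alpha> - 1)"
      proof -
        have "(t 1 / t j) powr (2 / r) \<le> (t 1 / t j) powr (2 * \<delta>)"
          using \<delta>(3) ord t_1_pos by (intro powr_mono') auto
        then show ?thesis by (simp add: mult_right_mono)
      qed
      also have "\<dots> = t 1 powr (2 * \<delta>) * t j powr (\<alpha> - \<delta>) * t j powr (-1 - \<delta>)"
      proof -
        have "t j powr (\<alpha> - \<delta>) * t j powr (-1 - \<delta>) * t j powr (2 * \<delta>) = t j powr (\<alpha> - 1)"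
          by (simp add: powr_add[symmetric])
        moreover have "t j powr (2 * \<delta>) \<noteq> 0" using ord by simp
        ultimately show ?thesis using ord t_1_pos by (simp add: powr_divide field_simps)
      qed
      also have "\<dots> \<le> t 1 powr (2 * \<delta>) * t m powr (\<alpha> - \<delta>) * t j powr (-1 - \<delta>)"
        using ord \<delta>(2) by (intro mult_right_mono mult_left_mono powr_mono2) auto
      finally show "(t 1 / t j) powr (2 / r) * t j powr (2 - (3 - \<alpha>)) \<le> t 1 powr (2 * \<delta>) * t m powr (\<alpha> - \<delta>) * t j powr (-1 - \<delta>)" .
    qed (use t_pred assms in \<open>auto simp: less_imp_le\<close>)
    also have "\<dots> = t 1 powr (2 * \<delta>) * t m powr (\<alpha> - \<delta>) * (\<Sum>j\<in>{Suc k..m}. \<tau> j * t j powr (-1 - \<delta>))"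
      by (simp add: sum_distrib_left mult_ac)
    also have "\<dots> \<le> t 1 powr (2 * \<delta>) * t m powr (\<alpha> - \<delta>) * (t 1 powr (-\<delta>) / \<delta>)"
    proof (intro mult_left_mono)
      have "(\<Sum>j\<in>{Suc k..m}. \<tau> j * t j powr (-1 - \<delta>)) \<le> t k powr (-\<delta>) / \<delta>"
        using assms \<delta>(1) by (intro sum_step_powr_le) auto
      also have "\<dots> \<le> t 1 powr (-\<delta>) / \<delta>"
        using t_1_le[of k] assms \<delta>(1) t_1_pos by (intro divide_right_mono powr_mono2') auto
      finally show "(\<Sum>j\<in>{Suc k..m}. \<tau> j * t j powr (-1 - \<delta>)) \<le> t 1 powr (-\<delta>) / \<delta>" .
    qed simp
    also have "\<dots> = t m powr \<alpha> * (t 1 / t m) powr \<delta> / \<delta>"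
    proof -
      have "t 1 powr (2 * \<delta>) * t 1 powr (-\<delta>) = t 1 powr \<delta>" by (simp add: powr_add[symmetric])
      then show ?thesis using tm t_1_pos by (simp add: powr_diff powr_divide)
    qed
    finally show "(\<Sum>j\<in>{Suc k..m}. \<tau> j * ((t 1 / t j) powr (2 / r) * t j powr (2 - (3 - \<alpha>))))
       \<le> t m powr \<alpha> * (t 1 / t m) powr \<delta> / \<delta>" .
  qed (use trunc_const_pos in \<open>auto simp: ratio_def\<close>)
  also have "\<dots> = barrier_const * (1 / t m * (t 1 / t m) powr \<delta>)"
    using tm by (simp add: barrier_const_def powr_diff powr_minus field_simps)
  finally have err: "(\<Sum>j\<in>{Suc k..m}. err j) \<le> barrier_const * (1 / t m * (t 1 / t m) powr \<delta>)" .

  have split: "{1..m} = {1..k} \<union> {Suc k..m}" "{1..k} \<inter> {Suc k..m} = {}" using assms by auto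
  have L1: "L1_sum \<alpha> t (barrier k) m = (\<Sum>j\<in>{1..k}. (barrier k j - barrier k (j - 1)) * wt \<alpha> t m j)
    + (\<Sum>j\<in>{Suc k..m}. (barrier k j - barrier k (j - 1)) * wt \<alpha> t m j)"
    unfolding L1_sum_def split(1) using split(2) by (intro sum.union_disjoint) auto
  have L2: "(\<Sum>j\<in>{1..k}. (barrier k j - barrier k (j - 1)) * wt \<alpha> t m j) = t k powr (\<alpha> - 1) * wt \<alpha> t m 1"
  proof -
    have "(\<Sum>j\<in>{1..k}. (barrier k j - barrier k (j - 1)) * wt \<alpha> t m j) =
        (\<Sum>j\<in>{1}. (barrier k j - barrier k (j - 1)) * wt \<alpha> t m j)"
      using assms t_le by (intro sum.mono_neutral_right) (auto simp: barrier_def max_def)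
    then show ?thesis using t_le[of 1 k] assms by (simp add: barrier_def max_def)
  qed
  have L3: "(\<Sum>j\<in>{Suc k..m}. (barrier k j - barrier k (j - 1)) * wt \<alpha> t m j)
    = (1 - \<alpha>) * (\<Sum>j\<in>{Suc k..m}. \<Delta> j / \<tau> j * W j)"
    unfolding sum_distrib_left
  proof (rule sum.cong)
    fix j assume j: "j \<in> {Suc k..m}"
    have "t k \<le> t (j - 1)" "t k \<le> t j" using t_le[of k j] t_le[of k "j - 1"] j assms by auto
    then show "(barrier k j - barrier k (j - 1)) * wt \<alpha> t m j = (1 - \<alpha>) * (\<Delta> j / \<tau> j * W j)"
      using j \<alpha> assms by (auto simp: barrier_def \<Delta>_def wt_def W_def max_absorb1)
  qed simp
  have "(\<Sum>j\<in>{Suc k..m}. (F (t j) - F (t (j - 1))) - err j) \<le>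
      (\<Sum>j\<in>{Suc k..m}. \<Delta> j / \<tau> j * W j)"
    by (intro sum_mono) (auto simp: err_def)
  \<comment> \<open>The upper end of the telescope vanishes: \<open>F (t m) = 0\<close> because 1 -
    \<alpha> is positive.\<close>
  moreover have "(\<Sum>j\<in>{Suc k..m}. (F (t j) - F (t (j - 1))) - err j) = - F (t k) - (\<Sum>j\<in>{Suc k..m}. err j)"
    using sum_telescope_pred[of k m "\<lambda>j. F (t j)"] assms \<alpha> by (simp add: sum_subtractf F_def)
  ultimately have L: "t k powr (\<alpha> - 1) * wt \<alpha> t m 1 + (1 - \<alpha>) * (- F (t k) - (\<Sum>j\<in>{Suc k..m}. err j))
      \<le> L1_sum \<alpha> t (barrier k) m" unfolding L1 L2 L3 using \<alpha> by (intro add_left_mono mult_left_mono) auto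
  \<comment> \<open>Enlarging \<open>t m - t k\<close> to \<open>t m\<close> bounds the exact part
    by the jump times a lower bound for the first weight.\<close>
  have "F (t k) \<le> t m powr (1 - \<alpha>) * t k powr (\<alpha> - 1) / t m"
    unfolding F_def using tm tk \<alpha> by (intro divide_right_mono mult_right_mono powr_mono2) auto
  also have "\<dots> = t m powr (-\<alpha>) * t k powr (\<alpha> - 1)"
    using tm by (simp add: powr_diff powr_minus field_simps)
  finally have "(1 - \<alpha>) * F (t k) \<le> (1 - \<alpha>) * (t m powr (-\<alpha>) * t k powr (\<alpha> - 1))"
    using \<alpha> by (intro mult_left_mono) auto
  also have "\<dots> = t k powr (\<alpha> - 1) * ((1 - \<alpha>) * t m powr (-\<alpha>))" by simp
  also have "\<dots> \<le> t k powr (\<alpha> - 1) * wt \<alpha> t m 1"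
    using wt_ge[of 1 m] assms t_0 by (intro mult_left_mono) auto
  finally have F: "(1 - \<alpha>) * F (t k) \<le> t k powr (\<alpha> - 1) * wt \<alpha> t m 1" .
  have "(1 - \<alpha>) * (\<Sum>j\<in>{Suc k..m}. err j) \<le> 1 * (\<Sum>j\<in>{Suc k..m}. err j)"
    using \<alpha> by (intro mult_right_mono sum_nonneg) (auto simp: err_def)
  with L F err show ?thesis by (simp add: algebra_simps)
qed

end

section \<open>Stability uniformly in the mesh\<close>

context mesh_op begin

text \<open>The scheme is causal: the response at m sees the right-hand side at 1, ..., m
  only.\<close>

lemma J_mono_upto:
  assumes "\<And>j. j \<in> {1..m} \<Longrightarrow> g j \<le> h j" "m \<le> M"
  shows "J g m \<le> J h m"
  by (rule L1_sum_comparison[of m \<mu>]) (use assms in \<open>auto simp: diag D_J\<close>)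

lemma J_cmult:
  assumes "m \<le> M"
  shows "J (\<lambda>j. c * g j) m = c * J g m"
proof (rule antisym)
  show "J (\<lambda>j. c * g j) m \<le> c * J g m"
    by (rule J_le) (use assms D_J in \<open>auto simp: L1_sum_cmult algebra_simps simp flip: right_diff_distrib\<close>)
  show "c * J g m \<le> J (\<lambda>j. c * g j) m"
    by (rule le_J) (use assms D_J in \<open>auto simp: L1_sum_cmult algebra_simps simp flip: right_diff_distrib\<close>)
qed

end

section \<open>Bootstrap for cut-off right-hand sides\<close>

locale graded_op = graded_mesh + mesh_op
begin

(* What the barrier misses: its discretization error and, up to time s, the lower-order term. After time s
   the lower-order term is bounded and is absorbed by the exponential. *)
definition residual :: "real \<Rightarrow> nat \<Rightarrow> real" where
  "residual s j = barrier_const * (1 / t j * (t 1 / t j) powr \<delta>) + \<mu> * (if t j \<le> s then t j powr (\<alpha> - 1) else 0)"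

lemma residual_nonneg: "1 \<le> j \<Longrightarrow> j \<le> M \<Longrightarrow> 0 \<le> residual s j"
  using barrier_const_pos t_pos[of j] \<mu> by (auto simp: residual_def)

lemma residual_antimono:
  assumes "1 \<le> j" "j < M"
  shows "residual s (Suc j) \<le> residual s j"
proof -
  have t: "0 < t j" "t j < t (Suc j)" "0 < t 1"
    using t_pos[of j] t_step[of j] t_1_pos assms by auto
  have "1 / t (Suc j) * (t 1 / t (Suc j)) powr \<delta> \<le> 1 / t j * (t 1 / t j) powr \<delta>"
    using t \<delta>(1) by (intro mult_mono powr_mono2 divide_left_mono) auto
  moreover have "(if t (Suc j) \<le> s then t (Suc j) powr (\<alpha> - 1) else 0) \<le> (if t j \<le> s then t j powr (\<alpha> - 1) else 0)"
    using t \<alpha> by (auto intro!: powr_mono2')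
  ultimately show ?thesis
    unfolding residual_def using barrier_const_pos \<mu> by (intro add_mono mult_left_mono) auto
qed

text \<open>The mass of the residual frozen at t_k. The discretization error integrates to a
  multiple of (t_1 / t_k)^\<delta>, small if t_k is a large multiple of t_1; the lower-order term
  integrates to a multiple of \<mu> s^\<alpha>, small if s is.\<close>

lemma residual_sum_le:
  assumes k: "1 \<le> k" "k \<le> M" and s: "0 < s"
  shows "residual s k * t k + (\<Sum>l\<in>{Suc k..M}. \<tau> l * residual s l)
    \<le> barrier_const * (1 + 1 / \<delta>) * (t 1 / t k) powr \<delta> + \<mu> * s powr \<alpha> * (1 + 1 / \<alpha>)"
proof -
  have tk: "0 < t k" using t_pos[of k] k by auto
  \<comment> \<open>The integral of the power with exponent \<alpha> - 1 up to time
    \<open>min (t l) s\<close>. It telescopes although s need not be a node.\<close>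
  define f where "f l = min (t l) s powr \<alpha> / \<alpha>" for l
  have "\<tau> l * residual s l \<le> barrier_const * t 1 powr \<delta> * (\<tau> l * t l powr (-1 - \<delta>))
      + \<mu> * (f l - f (l - 1))" if l: "l \<in> {Suc k..M}" for l
  proof -
    have t: "0 < t (l - 1)" "t (l - 1) < t l" using t_pos[of "l - 1"] t_pred[of l] l k by auto
    have "\<tau> l * (if t l \<le> s then t l powr (\<alpha> - 1) else 0) \<le> f l - f (l - 1)"
    proof (cases "t l \<le> s")
      case True
      have "\<alpha> * t l powr (\<alpha> - 1) * \<tau> l \<le> t l powr \<alpha> - t (l - 1) powr \<alpha>"
        using t \<alpha> by (intro powr_diff_ge) auto
      then have "t l powr (\<alpha> - 1) * \<tau> l \<le> (t l powr \<alpha> - t (l - 1) powr \<alpha>) / \<alpha>"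
        using \<alpha> by (simp add: pos_le_divide_eq mult_ac)
      then show ?thesis using True t by (simp add: f_def min_def diff_divide_distrib mult_ac)
    next
      case False
      have "f (l - 1) \<le> f l" unfolding f_def using t s \<alpha> by (intro divide_right_mono powr_mono2) auto
      then show ?thesis using False by simp
    qed
    then have "\<mu> * (\<tau> l * (if t l \<le> s then t l powr (\<alpha> - 1) else 0)) \<le> \<mu> * (f l - f (l - 1))"
      using \<mu> by (rule mult_left_mono)
    moreover have "1 / t l * (t 1 / t l) powr \<delta> = t 1 powr \<delta> * t l powr (-1 - \<delta>)"
      using t t_1_pos by (simp add: powr_divide powr_diff powr_minus field_simps)
    ultimately show ?thesis unfolding residual_def by (simp add: algebra_simps)
  qed
  then have "(\<Sum>l\<in>{Suc k..M}. \<tau> l * residual s l) \<le>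
    (\<Sum>l\<in>{Suc k..M}. barrier_const * t 1 powr \<delta> * (\<tau> l * t l powr (-1 - \<delta>)) + \<mu> * (f l - f (l - 1)))"
    by (rule sum_mono)
  also have "\<dots> = barrier_const * t 1 powr \<delta> * (\<Sum>l\<in>{Suc k..M}. \<tau> l * t l powr (-1 - \<delta>)) + \<mu> * (f M - f k)"
    using sum_telescope_pred[of k M f] k by (simp only: sum.distrib sum_distrib_left[symmetric])
  also have "\<dots> \<le> barrier_const * t 1 powr \<delta> * (t k powr (-\<delta>) / \<delta>) + \<mu> * (s powr \<alpha> / \<alpha>)"
  proof (intro add_mono mult_left_mono)
    have "f M \<le> s powr \<alpha> / \<alpha>" unfolding f_def using s \<alpha> t_pos[of M] M_pos by (intro divide_right_mono powr_mono2) auto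
    then show "f M - f k \<le> s powr \<alpha> / \<alpha>" using \<alpha> by (simp add: f_def add_increasing2 diff_le_eq)
  qed (use k \<delta> \<mu> barrier_const_pos sum_step_powr_le[of k M \<delta>] in auto)
  also have "barrier_const * t 1 powr \<delta> * (t k powr (-\<delta>) / \<delta>) = barrier_const * (1 / \<delta>) * (t 1 / t k) powr \<delta>"
    using tk t_1_pos by (simp add: powr_divide powr_minus field_simps)
  finally have S: "(\<Sum>l\<in>{Suc k..M}. \<tau> l * residual s l) \<le>
      barrier_const * (1 / \<delta>) * (t 1 / t k) powr \<delta> + \<mu> * (s powr \<alpha> / \<alpha>)" .
  have "(if t k \<le> s then t k powr (\<alpha> - 1) else 0) * t k \<le> s powr \<alpha>"
    using tk \<alpha> s by (auto simp: mult.commute[of _ "t k"] powr_mult_base intro!: powr_mono2)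
  then have "\<mu> * ((if t k \<le> s then t k powr (\<alpha> - 1) else 0) * t k) \<le> \<mu> * s powr \<alpha>"
    using \<mu> by (rule mult_left_mono)
  then have "residual s k * t k \<le> barrier_const * (t 1 / t k) powr \<delta> + \<mu> * s powr \<alpha>"
    using tk by (simp add: residual_def algebra_simps)
  with S show ?thesis by (simp add: algebra_simps)
qed

definition expo :: "real \<Rightarrow> nat \<Rightarrow> real" where "expo h j = (if j = 0 then 0 else exp (t j / h))"

text \<open>The part of the bound that is free of the bootstrap constant: 1 from the barrier, and
  the exponential estimated by its value at the final time and rewritten as a multiple of
  \<open>t m powr (\<alpha> - 1)\<close>.\<close>

definition C0 :: "real \<Rightarrow> real \<Rightarrow> real" where
  "C0 h s = (1 + \<mu> * s powr (\<alpha> - 1) * exp (t M / h) * t M powr (1 - \<alpha>)) / (1 - \<alpha>)"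

text \<open>The conditions on s and R each make one of the two masses in
  \<open>residual_sum_le\<close> at most (1 - \<alpha>) / 4, so that after division by 1 - \<alpha>
  a constant K returns as K / 2. Those on h come from \<open>exp_barrier\<close>.
  \<open>T_large\<close> provides a node to which the bootstrap applies.\<close>

context
  fixes h s R :: real
  assumes h: "0 < h" "\<And>j. j \<in> {1..M} \<Longrightarrow> \<tau> j \<le> h"
    and h_small: "2 * (\<mu> + 1) \<le> (1 - \<alpha>) * (2 * h) powr (-\<alpha>)"
    and s: "0 < s" "\<mu> * s powr \<alpha> * (1 + 1 / \<alpha>) \<le> (1 - \<alpha>) / 4"
    and R: "1 \<le> R" "barrier_const * (1 + 1 / \<delta>) * R powr (-\<delta>) \<le> (1 - \<alpha>) / 4"
    and T_large: "R * t 1 \<le> t M"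
begin

text \<open>The right-hand side is a supersolution: the barrier produces (1 - \<alpha>) / t_k on
  {1..k}, and its defects are compensated by the response to the residual and by the exponential.
  The bound is implicit, since the response to the residual is again controlled by cut-off
  responses.\<close>

lemma J_cutoff_le_barrier:
  assumes k: "1 \<le> k" "k \<le> M" and m: "m \<le> M"
  shows "J (cutoff k) m \<le> t k / (1 - \<alpha>) *
    (barrier k m + J (\<lambda>j. residual s (max j k)) m + \<mu> * s powr (\<alpha> - 1) * expo h m)"
proof (rule J_le)
  let ?g = "\<lambda>j. residual s (max j k)" and ?A = "\<mu> * s powr (\<alpha> - 1)"
  let ?w = "\<lambda>j. barrier k j + J ?g j + ?A * expo h j"
  have tk: "0 < t k" using t_pos[of k] k by auto
  show "0 \<le> t k / (1 - \<alpha>) * ?w 0" by (simp add: barrier_def expo_def)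
  fix j assume j: "j \<in> {1..M}"
  have "?A * 1 \<le> ?A * expo h j"
    using j \<mu> h t_nonneg[of j] by (intro mult_left_mono) (auto simp: expo_def)
  also have "\<dots> \<le> ?A * (D (expo h) j - \<mu> * expo h j)"
    unfolding expo_def using exp_barrier[OF h h_small j] \<mu> by (intro mult_left_mono) auto
  finally have A: "?A \<le> ?A * (D (expo h) j - \<mu> * expo h j)" by simp
  \<comment> \<open>Beyond time s the barrier is at most the constant
    \<open>s powr (\<alpha> - 1)\<close>, which is left to the exponential.\<close>
  have B: "\<mu> * barrier k j \<le> \<mu> * (if t (max j k) \<le> s then t (max j k) powr (\<alpha> - 1) else 0) + ?A"
  proof -
    have e: "barrier k j = t (max j k) powr (\<alpha> - 1)"
      using j t_le[of j k] t_le[of k j] k by (auto simp: barrier_def max_def)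
    have "barrier k j \<le> (if t (max j k) \<le> s then t (max j k) powr (\<alpha> - 1) else 0) + s powr (\<alpha> - 1)"
      unfolding e using s \<alpha> by (auto intro!: powr_mono2')
    then show ?thesis using \<mu> by (simp add: mult_left_mono flip: distrib_left)
  qed
  have "(1 - \<alpha>) / t k * cutoff k j \<le> D (barrier k) j + barrier_const * (1 / t (max j k) * (t 1 / t (max j k)) powr \<delta>)"
  proof (cases "j \<le> k")
    case True
    then show ?thesis using barrier_before[of j k] j k barrier_const_pos tk
      by (auto simp: cutoff_def max_absorb2 intro!: add_increasing2)
  next
    case False
    then show ?thesis using barrier_after[of k j] j k by (auto simp: cutoff_def max_absorb1)
  qed
  with A B have "(1 - \<alpha>) / t k * cutoff k j \<le> D (barrier k) j - \<mu> * barrier k j + ?g j + ?A * (D (expo h) j - \<mu> * expo h j)"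
    by (simp add: residual_def)
  also have "\<dots> = D ?w j - \<mu> * ?w j"
    using D_J[OF j, of ?g] by (simp only: L1_sum_add L1_sum_cmult) (simp add: algebra_simps)
  finally have "t k / (1 - \<alpha>) * ((1 - \<alpha>) / t k * cutoff k j) \<le> t k / (1 - \<alpha>) * (D ?w j - \<mu> * ?w j)"
    using tk \<alpha> by (intro mult_left_mono) auto
  also have "\<dots> = D (\<lambda>j. t k / (1 - \<alpha>) * ?w j) j - \<mu> * (t k / (1 - \<alpha>) * ?w j)"
    by (simp only: L1_sum_cmult) (simp add: right_diff_distrib)
  finally show "cutoff k j \<le> D (\<lambda>j. t k / (1 - \<alpha>) * ?w j) j - \<mu> * (t k / (1 - \<alpha>) * ?w j)"
    using tk \<alpha> by simp
qed (rule m)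

lemma C0_nonneg: "0 \<le> (C0 h s)"
  using \<alpha> \<mu> by (simp add: C0_def)

text \<open>The assumed bound for all later cut-offs, fed into \<open>J_le_weighted_sum\<close>,
  comes back with half its constant because the mass of the residual is small.\<close>

lemma J_cutoff_bootstrap:
  assumes k: "1 \<le> k" "k \<le> M" "R * t 1 \<le> t k" and m: "m \<in> {1..M}" and K: "0 \<le> K"
    and IH: "\<And>l. l \<in> {k..M} \<Longrightarrow> J (cutoff l) m \<le> K * t l * t m powr (\<alpha> - 1)"
  shows "J (cutoff k) m \<le> ((C0 h s) + K / 2) * t k * t m powr (\<alpha> - 1)"
proof -
  have t: "0 < t k" "0 < t m" "t m \<le> t M" using t_pos[of k] t_pos[of m] t_le[of m M] k m by auto
  have b: "barrier k m \<le> t m powr (\<alpha> - 1)"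
    using m t \<alpha> by (auto simp: barrier_def intro!: powr_mono2')
  have "J (\<lambda>j. residual s (max j k)) m \<le> (K * t m powr (\<alpha> - 1)) *
      (residual s k * t k + (\<Sum>l\<in>{Suc k..M}. \<tau> l * residual s l))"
    using k m IH residual_antimono residual_nonneg M_pos
    by (intro J_le_weighted_sum) (auto simp: mult_ac)
  also have "\<dots> \<le> (K * t m powr (\<alpha> - 1)) *
      (barrier_const * (1 + 1 / \<delta>) * (t 1 / t k) powr \<delta> + \<mu> * s powr \<alpha> * (1 + 1 / \<alpha>))"
    using residual_sum_le[OF k(1,2) s(1)] K by (intro mult_left_mono) auto
  also have "\<dots> \<le> (K * t m powr (\<alpha> - 1)) * ((1 - \<alpha>) / 4 + (1 - \<alpha>) / 4)"
  proof (intro mult_left_mono add_mono)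
    have "(t 1 / t k) powr \<delta> \<le> (1 / R) powr \<delta>"
      using k(3) R(1) t t_1_pos \<delta>(1) by (intro powr_mono2) (auto simp: field_simps)
    also have "\<dots> = R powr (-\<delta>)" using R(1) by (simp add: powr_divide powr_minus field_simps)
    finally have "barrier_const * (1 + 1 / \<delta>) * (t 1 / t k) powr \<delta> \<le> barrier_const * (1 + 1 / \<delta>) * R powr (-\<delta>)"
      using barrier_const_pos \<delta>(1) by (intro mult_left_mono) auto
    then show "barrier_const * (1 + 1 / \<delta>) * (t 1 / t k) powr \<delta> \<le> (1 - \<alpha>) / 4" using R(2) by linarith
  qed (use s K in auto)
  finally have g: "J (\<lambda>j. residual s (max j k)) m \<le> K * t m powr (\<alpha> - 1) * ((1 - \<alpha>) / 2)" by simp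
  have "expo h m \<le> exp (t M / h) * (t M powr (1 - \<alpha>) * t m powr (\<alpha> - 1))"
  proof -
    have "expo h m \<le> exp (t M / h)" using t h by (auto simp: expo_def divide_right_mono)
    also have "\<dots> \<le> exp (t M / h) * (t M powr (1 - \<alpha>) * t m powr (\<alpha> - 1))"
    proof -
      have "t m powr (1 - \<alpha>) \<le> t M powr (1 - \<alpha>)" using t \<alpha> by (intro powr_mono2) auto
      then have "t m powr (1 - \<alpha>) * t m powr (\<alpha> - 1) \<le> t M powr (1 - \<alpha>) * t m powr (\<alpha> - 1)"
        by (intro mult_right_mono) auto
      moreover have "t m powr (1 - \<alpha>) * t m powr (\<alpha> - 1) = 1"
        using t by (simp flip: powr_add)
      ultimately show ?thesis by simp
    qed
    finally show ?thesis .
  qed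
  then have e: "\<mu> * s powr (\<alpha> - 1) * expo h m \<le> \<mu> * s powr (\<alpha> - 1) * (exp (t M / h) * (t M powr (1 - \<alpha>) * t m powr (\<alpha> - 1)))"
    using \<mu> by (intro mult_left_mono) auto
  have "J (cutoff k) m \<le> t k / (1 - \<alpha>) * (barrier k m + J (\<lambda>j. residual s (max j k)) m + \<mu> * s powr (\<alpha> - 1) * expo h m)"
    using J_cutoff_le_barrier[of k m] k m by auto
  also have "\<dots> \<le> t k / (1 - \<alpha>) * (t m powr (\<alpha> - 1) + K * t m powr (\<alpha> - 1) * ((1 - \<alpha>) / 2)
      + \<mu> * s powr (\<alpha> - 1) * (exp (t M / h) * (t M powr (1 - \<alpha>) * t m powr (\<alpha> - 1))))"
    using t \<alpha> by (intro mult_left_mono add_mono b g e) auto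
  also have "\<dots> = ((C0 h s) + K / 2) * t k * t m powr (\<alpha> - 1)"
    using \<alpha> by (simp add: C0_def field_simps)
  finally show ?thesis .
qed

lemma J_cutoff_le_large:
  assumes k: "1 \<le> k" "k \<le> M" "R * t 1 \<le> t k" and m: "m \<in> {1..M}"
  shows "J (cutoff k) m \<le> 2 * (C0 h s) * t k * t m powr (\<alpha> - 1)"
proof -
  define Q where "Q l = J (cutoff l) m / (t l * t m powr (\<alpha> - 1))" for l
  have pos: "0 < t l * t m powr (\<alpha> - 1)" if "l \<in> {k..M}" for l
    using t_pos[of l] t_pos[of m] that k m by auto
  \<comment> \<open>The best constant for this mesh and this m. As a maximum over finitely many
    nodes it exists without any a priori estimate, and the bootstrap then yields a bound that does
    not depend on the mesh points chosen.\<close>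
  define K where "K = Max (Q ` {k..M})"
  have QK: "Q l \<le> K" if "l \<in> {k..M}" for l using that by (simp add: K_def)
  have "0 \<le> Q k" using J_nonneg[of "cutoff k" m] m pos[of k] k by (simp add: Q_def cutoff_def)
  then have K: "0 \<le> K" using QK[of k] k by simp
  have IH: "J (cutoff l) m \<le> K * t l * t m powr (\<alpha> - 1)" if "l \<in> {k..M}" for l
    using QK[OF that] pos[OF that] by (simp add: Q_def pos_divide_le_eq mult.assoc)
  have "Q l \<le> (C0 h s) + K / 2" if l: "l \<in> {k..M}" for l
  proof -
    have "R * t 1 \<le> t l" using k t_le[of k l] l by auto
    with l k m K IH have "J (cutoff l) m \<le> ((C0 h s) + K / 2) * t l * t m powr (\<alpha> - 1)"
      by (intro J_cutoff_bootstrap) auto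
    then show ?thesis using pos[OF l] by (simp add: Q_def pos_divide_le_eq mult.assoc)
  qed
  then have "K \<le> (C0 h s) + K / 2" unfolding K_def using k by (subst Max_le_iff) auto
  then have "K \<le> 2 * (C0 h s)" by simp
  then have "K * (t k * t m powr (\<alpha> - 1)) \<le> 2 * (C0 h s) * (t k * t m powr (\<alpha> - 1))"
    using pos[of k] k by (intro mult_right_mono) auto
  then show ?thesis using IH[of k] k by (simp add: mult.assoc)
qed

text \<open>For t_k < R t_1 the cut-off is enlarged to the first node k0 beyond R t_1. By
  \<open>mesh_ratio\<close>, t_k0 is at most \<open>ratio * R * t 1\<close> and hence at most
  \<open>ratio * R * t k\<close>, so only a constant is lost.\<close>

lemma J_cutoff_le:
  assumes k: "k \<in> {1..M}" and m: "m \<in> {1..M}"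
  shows "J (cutoff k) m \<le> 2 * (C0 h s) * (ratio * R) * t k * t m powr (\<alpha> - 1)"
proof (cases "R * t 1 \<le> t k")
  case True
  have "1 \<le> ratio * R" using R(1) mult_mono[of 1 ratio 1 R] by (simp add: ratio_def)
  then have "2 * (C0 h s) * 1 * t k * t m powr (\<alpha> - 1) \<le> 2 * (C0 h s) * (ratio * R) * t k * t m powr (\<alpha> - 1)"
    using C0_nonneg t_pos[of k] k by (intro mult_right_mono mult_left_mono) auto
  then show ?thesis using J_cutoff_le_large[of k m] True k m by simp
next
  case False
  define k0 where "k0 = (LEAST i. R * t 1 \<le> t i \<and> i \<le> M)"
  have k0: "R * t 1 \<le> t k0" "k0 \<le> M"
    unfolding k0_def using LeastI[of "\<lambda>i. R * t 1 \<le> t i \<and> i \<le> M" M] T_large by auto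
  have least: "\<not> (R * t 1 \<le> t i \<and> i \<le> M)" if "i < k0" for i
    using not_less_Least[OF that[unfolded k0_def]] .
  have "k < k0"
  proof (rule ccontr)
    assume "\<not> k < k0"
    then have "t k0 \<le> t k" using t_le[of k0 k] k by auto
    then show False using k0 False by simp
  qed
  then have kk: "2 \<le> k0" "1 \<le> k0" using k by auto
  have "t (k0 - 1) < R * t 1" using least[of "k0 - 1"] k0 kk by auto
  moreover have "t k0 \<le> ratio * t (k0 - 1)" using mesh_ratio[of k0] kk k0 by (simp add: ratio_def)
  moreover have "t 1 \<le> t k" using t_1_le[of k] k by auto
  moreover have "ratio * t (k0 - 1) \<le> ratio * (R * t 1)" "ratio * R * t 1 \<le> ratio * R * t k"
    using calculation R by (auto simp: ratio_def intro!: mult_left_mono)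
  ultimately have tk0: "t k0 \<le> ratio * R * t k" by (simp add: mult.assoc)
  have "J (cutoff k) m \<le> J (cutoff k0) m"
    using \<open>k < k0\<close> m by (intro J_mono) (auto simp: cutoff_def)
  also have "\<dots> \<le> 2 * (C0 h s) * t k0 * t m powr (\<alpha> - 1)"
    using k0 kk m by (intro J_cutoff_le_large) auto
  also have "\<dots> \<le> 2 * (C0 h s) * (ratio * R * t k) * t m powr (\<alpha> - 1)"
    using tk0 C0_nonneg by (intro mult_right_mono mult_left_mono) auto
  finally show ?thesis by (simp add: mult_ac)
qed

end
end

text \<open>K and h are fixed before the mesh and depend on \<alpha>, \<mu>, r, c and T only. For
  this reason the locale constants occur in the proof in their exported form, with explicit
  parameters.\<close>

theorem discrete_stability:
  fixes \<alpha> \<mu> r c T :: real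
  assumes \<alpha>: "0 < \<alpha>" "\<alpha> < 1" and \<mu>: "0 \<le> \<mu>" and r: "1 \<le> r" and c: "0 < c" and T: "0 < T"
  obtains K h where "0 < K" "0 < h"
    "\<And>t M k m. graded_op \<alpha> t M r c \<mu> \<Longrightarrow> t M = T \<Longrightarrow> (\<And>j. j \<in> {1..M} \<Longrightarrow> t j - t (j - 1) \<le> h) \<Longrightarrow>
      k \<in> {1..M} \<Longrightarrow> m \<in> {1..M} \<Longrightarrow> L1_solve \<alpha> \<mu> t (cutoff k) m \<le> K * t k * t m powr (\<alpha> - 1)"
proof -
  \<comment> \<open>h solves \<open>h_small\<close> with equality, s solves its condition with \<mu>
    + 1 in place of \<mu>, which covers \<mu> = 0, and R is the least admissible value.\<close>
  define h where "h = ((1 - \<alpha>) / (2 * (\<mu> + 1))) powr (1 / \<alpha>) / 2"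
  define s where "s = ((1 - \<alpha>) / (4 * ((\<mu> + 1) * (1 + 1 / \<alpha>)))) powr (1 / \<alpha>)"
  define d where "d = graded_mesh.\<delta> \<alpha> r"
  define B where "B = graded_mesh.barrier_const \<alpha> r c * (1 + 1 / d)"
  define R where "R = max 1 ((4 * B / (1 - \<alpha>)) powr (1 / d))"
  define K where "K = 2 * ((1 + \<mu> * s powr (\<alpha> - 1) * exp (T / h) * T powr (1 - \<alpha>)) / (1 - \<alpha>)) * (max 2 ((2 * c) powr r) * R)"
  have h: "0 < h" using \<alpha> \<mu> by (simp add: h_def)
  have h_small: "2 * (\<mu> + 1) \<le> (1 - \<alpha>) * (2 * h) powr (-\<alpha>)"
    using \<alpha> \<mu> by (simp add: h_def powr_powr powr_minus field_simps)
  have "0 < 1 + 1 / \<alpha>" using \<alpha> by (simp add: add_pos_pos)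
  have s: "0 < s" using \<alpha> \<mu> \<open>0 < 1 + 1 / \<alpha>\<close> by (simp add: s_def)
  have "s powr \<alpha> = (1 - \<alpha>) / (4 * ((\<mu> + 1) * (1 + 1 / \<alpha>)))"
    unfolding s_def using \<alpha> \<mu> by (simp add: powr_powr)
  moreover have "0 < (\<mu> + 1) * (1 + 1 / \<alpha>)" using \<alpha> \<mu> \<open>0 < 1 + 1 / \<alpha>\<close> by (intro mult_pos_pos) auto
  moreover have "z * (x / (4 * z)) = x / 4" if "0 < z" for x z :: real using that by simp
  ultimately have "((\<mu> + 1) * (1 + 1 / \<alpha>)) * s powr \<alpha> = (1 - \<alpha>) / 4" by (simp only:)
  then have "(\<mu> + 1) * s powr \<alpha> * (1 + 1 / \<alpha>) = (1 - \<alpha>) / 4" by (simp only: mult_ac)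
  moreover have "\<mu> * s powr \<alpha> * (1 + 1 / \<alpha>) \<le> (\<mu> + 1) * s powr \<alpha> * (1 + 1 / \<alpha>)"
    using \<alpha> by (intro mult_right_mono) auto
  ultimately have s_small: "\<mu> * s powr \<alpha> * (1 + 1 / \<alpha>) \<le> (1 - \<alpha>) / 4" by linarith
  show thesis
  \<comment> \<open>The bound T / R, applied to the first step, gives R t_1 \<le> T, the assumption
    \<open>T_large\<close>.\<close>
  proof (rule that[of K "min h (T / R)"])
    have R1: "1 \<le> R" by (simp add: R_def)
    then show "0 < min h (T / R)" using h T by simp
    have "0 < 1 + \<mu> * s powr (\<alpha> - 1) * exp (T / h) * T powr (1 - \<alpha>)"
      using \<mu> by (intro add_pos_nonneg) auto
    then show "0 < K" unfolding K_def using \<alpha> R1 by (intro mult_pos_pos divide_pos_pos) auto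
    fix t :: "nat \<Rightarrow> real" and M k m :: nat
    assume op: "graded_op \<alpha> t M r c \<mu>" and TM: "t M = T"
      and steps: "\<And>j. j \<in> {1..M} \<Longrightarrow> t j - t (j - 1) \<le> min h (T / R)"
      and km: "k \<in> {1..M}" "m \<in> {1..M}"
    interpret graded_op \<alpha> t M r c \<mu> by fact
    have d: "\<delta> = d" "0 < d" using \<delta>(1) by (simp_all add: d_def)
    have B: "0 < B" using barrier_const_pos d by (auto simp: B_def intro!: mult_pos_pos add_pos_pos)
    have "4 * B / (1 - \<alpha>) = ((4 * B / (1 - \<alpha>)) powr (1 / d)) powr d"
      using B d \<alpha> by (simp add: powr_powr)
    also have "\<dots> \<le> R powr d" using d by (intro powr_mono2) (auto simp: R_def)
    finally have R2: "barrier_const * (1 + 1 / \<delta>) * R powr (- \<delta>) \<le> (1 - \<alpha>) / 4"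
      using d \<alpha> R1 by (simp add: B_def powr_minus field_simps)
    have "t 1 \<le> T / R" using steps[of 1] km t_0 by auto
    then have "R * t 1 \<le> t M" using R1 TM by (simp add: field_simps)
    then have "L1_solve \<alpha> \<mu> t (cutoff k) m \<le> 2 * C0 h s * (ratio * R) * t k * t m powr (\<alpha> - 1)"
      using steps km by (intro J_cutoff_le h h_small s s_small R1 R2) auto
    also have "C0 h s = (1 + \<mu> * s powr (\<alpha> - 1) * exp (T / h) * T powr (1 - \<alpha>)) / (1 - \<alpha>)"
      using TM by (simp add: C0_def)
    finally show "L1_solve \<alpha> \<mu> t (cutoff k) m \<le> K * t k * t m powr (\<alpha> - 1)"
      unfolding K_def ratio_def .
  qed
qed

section \<open>Responses to power right-hand sides\<close>

context graded_op begin

(* A bound for the sum of the right-hand side (t 1 / t j)^p over the mesh up to time t m. *)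
definition power_mass :: "real \<Rightarrow> nat \<Rightarrow> real" where
  "power_mass p m = (if 1 < p then t 1 * (1 + 1 / (p - 1)) else if p = 1 then t 1 * (1 + ln (t m / t 1))
     else t m * (t 1 / t m) powr p * (1 + 1 / (1 - p)))"

text \<open>For p \<ge> 0 the right-hand side is nonincreasing and \<open>J_le_weighted_sum\<close>
  applies with k = 1. For p < 0 it increases, and on {1..m} it is dominated by its value at
  \<open>t m\<close> times \<open>cutoff m\<close>.\<close>

lemma J_power_le:
  assumes m: "m \<in> {1..M}" and K: "0 \<le> K"
    and KJ: "\<And>k. k \<in> {1..M} \<Longrightarrow> J (cutoff k) m \<le> K * t k * t m powr (\<alpha> - 1)"
  shows "J (\<lambda>j. (t 1 / t j) powr p) m \<le> K * t m powr (\<alpha> - 1) * power_mass p m"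
proof -
  have tm: "0 < t m" and t1: "0 < t 1" "t 1 \<le> t m" using t_pos[of m] t_1_pos t_1_le[of m] m by auto
  show ?thesis
  proof (cases "0 \<le> p")
    case True
    \<comment> \<open>By causality the right-hand side may be set to 0 after m, so that its mass
      counts up to \<open>t m\<close> only.\<close>
    define g where "g l = (if l \<le> m then (t 1 / t l) powr p else 0)" for l
    have pos: "0 < t l" if "1 \<le> l" "l \<le> M" for l using t_pos that by auto
    have "J (\<lambda>j. (t 1 / t j) powr p) m \<le> J g m"
      using m by (intro J_mono_upto) (auto simp: g_def)
    also have "\<dots> \<le> K * t m powr (\<alpha> - 1) * (g 1 * t 1 + (\<Sum>l\<in>{Suc 1..M}. \<tau> l * g l))"
    proof (intro J_le_weighted_sum)
      fix l assume l: "1 \<le> l" "l < M"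
      then have "(t 1 / t (Suc l)) powr p \<le> (t 1 / t l) powr p"
        using True t1 t_step[of l] pos[of l] by (intro powr_mono2 divide_left_mono) auto
      then show "g (Suc l) \<le> g l" by (auto simp: g_def)
    qed (use M_pos m KJ in \<open>auto simp: mult_ac g_def max_absorb1\<close>)
    also have "g 1 * t 1 + (\<Sum>l\<in>{Suc 1..M}. \<tau> l * g l) = t 1 + (\<Sum>l\<in>{Suc 1..m}. \<tau> l * (t 1 / t l) powr p)"
    proof -
      have "(\<Sum>l\<in>{Suc 1..M}. \<tau> l * g l) = (\<Sum>l\<in>{Suc 1..m}. \<tau> l * (t 1 / t l) powr p)"
        using m by (intro sum.mono_neutral_cong_right) (auto simp: g_def)
      then show ?thesis using m t1 by (simp add: g_def)
    qed
    also have "t 1 + (\<Sum>l\<in>{Suc 1..m}. \<tau> l * (t 1 / t l) powr p) \<le> power_mass p m"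
    proof -
      consider "1 < p" | "p = 1" | "p < 1" by linarith
      then show ?thesis
      proof cases
        case 1
        have "(\<Sum>l\<in>{Suc 1..m}. \<tau> l * (t 1 / t l) powr p) =
            t 1 powr p * (\<Sum>l\<in>{Suc 1..m}. \<tau> l * t l powr (-1 - (p - 1)))"
          unfolding sum_distrib_left using pos m t1
          by (intro sum.cong) (auto simp: powr_divide powr_minus field_simps)
        also have "\<dots> \<le> t 1 powr p * (t 1 powr (- (p - 1)) / (p - 1))"
          using m 1 by (intro mult_left_mono sum_step_powr_le) auto
        also have "\<dots> = t 1 / (p - 1)"
          using t1 by (simp add: powr_diff)
        finally show ?thesis using 1 by (simp add: power_mass_def algebra_simps)
      next
        case 2
        have "(\<Sum>l\<in>{Suc 1..m}. \<tau> l * (t 1 / t l) powr p) =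
            t 1 * (\<Sum>l\<in>{Suc 1..m}. \<tau> l / t l)"
          unfolding sum_distrib_left
        proof (rule sum.cong)
          fix l assume "l \<in> {Suc 1..m}"
          then have "0 < t 1 / t l" using pos m t1 by simp
          then show "\<tau> l * (t 1 / t l) powr p = t 1 * (\<tau> l / t l)"
            unfolding 2 by (simp only: powr_one less_imp_le) simp
        qed simp
        also have "\<dots> \<le> t 1 * ln (t m / t 1)"
          using m t1 by (intro mult_left_mono sum_step_inverse_le) auto
        finally show ?thesis using 2 by (simp add: power_mass_def algebra_simps)
      next
        case 3
        have "t 1 + (\<Sum>l\<in>{Suc 1..m}. \<tau> l * (t 1 / t l) powr p) =
            (\<Sum>l=1..m. \<tau> l * (t 1 / t l) powr p)"
          using m t1 t_0 by (simp add: sum.atLeast_Suc_atMost)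
        also have "\<dots> = t 1 powr p * (\<Sum>l=1..m. \<tau> l * t l powr ((1 - p) - 1))"
          unfolding sum_distrib_left using pos m t1
          by (intro sum.cong) (auto simp: powr_divide powr_minus field_simps)
        also have "\<dots> \<le> t 1 powr p * (t m powr (1 - p) / (1 - p))"
          using m 3 True by (intro mult_left_mono sum_step_powr_le') auto
        also have "\<dots> = t m * (t 1 / t m) powr p * (1 / (1 - p))"
          using t1 tm by (simp add: powr_diff powr_divide)
        also have "\<dots> \<le> t m * (t 1 / t m) powr p * (1 + 1 / (1 - p))"
          using tm by (intro mult_left_mono) auto
        finally show ?thesis using 3 by (simp add: power_mass_def)
      qed
    qed
    finally show ?thesis using K by (simp add: mult_left_mono)
  next
    case False
    have "J (\<lambda>j. (t 1 / t j) powr p) m \<le> J (\<lambda>j. (t 1 / t m) powr p * cutoff m j) m"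
    proof (rule J_mono_upto)
      fix j assume j: "j \<in> {1..m}"
      have "0 < t j" "t j \<le> t m" using t_pos[of j] t_le[of j m] j m by auto
      then have "t 1 / t m \<le> t 1 / t j" using t1 by (intro divide_left_mono) auto
      then have "(t 1 / t j) powr p \<le> (t 1 / t m) powr p" using False t1 tm by (intro powr_mono2') auto
      then show "(t 1 / t j) powr p \<le> (t 1 / t m) powr p * cutoff m j" using j by (simp add: cutoff_def)
    qed (use m in auto)
    also have "\<dots> = (t 1 / t m) powr p * J (cutoff m) m" using m by (intro J_cmult) auto
    also have "\<dots> \<le> (t 1 / t m) powr p * (K * t m * t m powr (\<alpha> - 1))"
      using KJ m by (intro mult_left_mono) auto
    also have "\<dots> = K * t m powr (\<alpha> - 1) * (t m * (t 1 / t m) powr p * 1)" by (simp add: mult_ac)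
    also have "\<dots> \<le> K * t m powr (\<alpha> - 1) * (t m * (t 1 / t m) powr p * (1 + 1 / (1 - p)))"
      using False K tm by (intro mult_left_mono) auto
    finally show ?thesis using False by (simp add: power_mass_def)
  qed
qed

end

section \<open>Truncation error\<close>

lemma powr_sing_has_integral:
  fixes b q :: real
  assumes "0 \<le> b" "0 < q"
  shows "((\<lambda>s. s powr (q - 1)) has_integral b powr q / q) {0..b}"
proof -
  have "((\<lambda>s. s powr (q - 1)) has_integral b powr q / q - 0 powr q / q) {0..b}"
  proof (rule fundamental_theorem_of_calculus_interior)
    show "continuous_on {0..b} (\<lambda>s. s powr q / q)"
      using assms by (intro continuous_intros continuous_on_powr') auto
    fix s assume "s \<in> {0<..<b}"
    then show "((\<lambda>s. s powr q / q) has_vector_derivative s powr (q - 1)) (at s)"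
      unfolding has_real_derivative_iff_has_vector_derivative[symmetric] using assms
      by (auto intro!: derivative_eq_intros)
  qed (use assms in auto)
  then show ?thesis using assms by simp
qed

definition first_step_const :: "real \<Rightarrow> real \<Rightarrow> real" where
  "first_step_const \<alpha> \<sigma> = (2 + 1 / \<sigma>) / \<bar>\<sigma> - 1\<bar> * (4 * (3 / (1 - \<alpha>) + 2 / \<sigma> + 1))"

text \<open>The bound on the second derivative need not be integrable at 0, so \<psi>' is compared
  with its value at b by integrating from s to b; as \<sigma> is not 1, this yields powers with
  exponent \<sigma> - 1 > -1, which are integrable. If c > 2 b, the zero mean of the slope minus
  \<psi>' leaves only the oscillation of the kernel, of order b c^(-\<alpha>-1), the source of
  \<open>(b / c) powr (\<alpha> + 1)\<close>. If c \<le> 2 b, this factor is at least 1/4.\<close>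

lemma first_step_error:
  fixes \<psi> \<psi>' \<psi>'' :: "real \<Rightarrow> real"
  assumes \<alpha>: "0 < \<alpha>" "\<alpha> < 1" and \<sigma>: "0 < \<sigma>" "\<sigma> < 2" "\<sigma> \<noteq> 1" and K: "0 \<le> K"
    and b: "0 < b" "b \<le> c"
    and \<psi>: "continuous_on {0..b} \<psi>" "\<And>s. s \<in> {0<..<b} \<Longrightarrow> (\<psi> has_real_derivative \<psi>' s) (at s)"
    and \<psi>': "\<And>s. s \<in> {0<..b} \<Longrightarrow> (\<psi>' has_real_derivative \<psi>'' s) (at s within {0<..b})"
    and \<psi>'': "\<And>s. s \<in> {0<..b} \<Longrightarrow> \<bar>\<psi>'' s\<bar> \<le> K * s powr (\<sigma> - 2)"
    and I: "((\<lambda>s. (c - s) powr (-\<alpha>) * \<psi>' s) has_integral I) {0..b}"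
  shows "\<bar>(\<psi> b - \<psi> 0) / b * ((c powr (1 - \<alpha>) - (c - b) powr (1 - \<alpha>)) / (1 - \<alpha>)) - I\<bar>
    \<le> K * first_step_const \<alpha> \<sigma> * (b powr (\<sigma> - \<alpha>) * (b / c) powr (\<alpha> + 1))"
proof -
  define \<delta> where "\<delta> = (\<psi> b - \<psi> 0) / b"
  define W where "W = (c powr (1 - \<alpha>) - (c - b) powr (1 - \<alpha>)) / (1 - \<alpha>)"
  define L where "L = K / \<bar>\<sigma> - 1\<bar>"
  define N where "N = K * ((2 + 1 / \<sigma>) / \<bar>\<sigma> - 1\<bar>)"
  have L: "0 \<le> L" using K by (simp add: L_def)
  have NL: "N = (2 + 1 / \<sigma>) * L" by (simp add: N_def L_def)
  have N: "0 \<le> N" using K \<sigma> by (simp add: N_def)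
  have osc: "\<bar>\<psi>' s - \<psi>' b\<bar> \<le> L * b powr (\<sigma> - 1) + L * s powr (\<sigma> - 1)" if s: "s \<in> {0<..<b}" for s
  proof -
    have i1: "(\<psi>'' has_integral \<psi>' b - \<psi>' s) {s..b}"
    proof (rule fundamental_theorem_of_calculus)
      fix x assume "x \<in> {s..b}"
      then show "(\<psi>' has_vector_derivative \<psi>'' x) (at x within {s..b})"
        using \<psi>'[of x] s by (auto simp: has_real_derivative_iff_has_vector_derivative
            intro: has_vector_derivative_within_subset)
    qed (use s in auto)
    have i2: "((\<lambda>x. K * x powr (\<sigma> - 2)) has_integral K * (b powr (\<sigma> - 1) / (\<sigma> - 1) - s powr (\<sigma> - 1) / (\<sigma> - 1))) {s..b}"
    proof (intro has_integral_mult_right fundamental_theorem_of_calculus)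
      fix x assume "x \<in> {s..b}"
      then have "((\<lambda>x. x powr (\<sigma> - 1) / (\<sigma> - 1)) has_real_derivative x powr (\<sigma> - 2)) (at x)"
        using s \<sigma> by (auto intro!: derivative_eq_intros)
      then show "((\<lambda>x. x powr (\<sigma> - 1) / (\<sigma> - 1)) has_vector_derivative x powr (\<sigma> - 2)) (at x within {s..b})"
        by (simp add: has_real_derivative_iff_has_vector_derivative has_vector_derivative_at_within)
    qed (use s in auto)
    have "\<bar>\<psi>' b - \<psi>' s\<bar> \<le> K * (b powr (\<sigma> - 1) / (\<sigma> - 1) - s powr (\<sigma> - 1) / (\<sigma> - 1))"
      using \<psi>'' s by (intro has_integral_abs_le_interior[OF i1 i2]) auto
    also have "\<dots> \<le> \<bar>K * (b powr (\<sigma> - 1) / (\<sigma> - 1) - s powr (\<sigma> - 1) / (\<sigma> - 1))\<bar>" by simp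
    also have "\<dots> = L * \<bar>b powr (\<sigma> - 1) - s powr (\<sigma> - 1)\<bar>"
      using K by (simp add: L_def abs_mult diff_divide_distrib[symmetric])
    also have "\<dots> \<le> L * (b powr (\<sigma> - 1) + s powr (\<sigma> - 1))"
      using L by (intro mult_left_mono) (auto simp: abs_le_iff add_increasing add_increasing2 diff_le_eq le_diff_eq)
    finally show ?thesis by (simp add: abs_minus_commute algebra_simps)
  qed
  have p: "(\<psi>' has_integral \<psi> b - \<psi> 0) {0..b}"
    using \<psi> b by (intro fundamental_theorem_of_calculus_interior)
      (auto simp: has_real_derivative_iff_has_vector_derivative)
  have c1: "((\<lambda>s. x) has_integral b * x) {0..b}" for x :: real
    using has_integral_const_real[of x 0 b] b by simp
  note sing = powr_sing_has_integral[of b \<sigma>, OF less_imp_le[OF b(1)] \<sigma>(1)]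
  have "\<bar>(\<psi> b - \<psi> 0) - b * \<psi>' b\<bar> \<le> b * (L * b powr (\<sigma> - 1)) + L * (b powr \<sigma> / \<sigma>)"
    using osc by (intro has_integral_abs_le_interior[OF has_integral_diff[OF p c1]
          has_integral_add[OF c1 has_integral_mult_right[OF sing]]]) auto
  also have "\<dots> = b * ((1 + 1 / \<sigma>) * L * b powr (\<sigma> - 1))"
    using b \<sigma> by (simp add: powr_mult_base field_simps)
  finally have "b * \<bar>\<delta> - \<psi>' b\<bar> \<le> b * ((1 + 1 / \<sigma>) * L * b powr (\<sigma> - 1))"
  proof -
    have "(\<psi> b - \<psi> 0) - b * \<psi>' b = b * (\<delta> - \<psi>' b)" using b by (simp add: \<delta>_def field_simps)
    moreover assume "\<bar>(\<psi> b - \<psi> 0) - b * \<psi>' b\<bar> \<le> b * ((1 + 1 / \<sigma>) * L * b powr (\<sigma> - 1))"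
    ultimately show ?thesis using b by (simp add: abs_mult)
  qed
  then have slope: "\<bar>\<delta> - \<psi>' b\<bar> \<le> (1 + 1 / \<sigma>) * L * b powr (\<sigma> - 1)" using b by simp
  have H: "\<bar>\<delta> - \<psi>' s\<bar> \<le> N * (b powr (\<sigma> - 1) + s powr (\<sigma> - 1))" if s: "s \<in> {0<..<b}" for s
  proof -
    have "\<bar>\<delta> - \<psi>' s\<bar> \<le> (2 + 1 / \<sigma>) * L * b powr (\<sigma> - 1) + 1 * (L * s powr (\<sigma> - 1))"
      using osc[OF s] slope by (simp add: algebra_simps)
    also have "\<dots> \<le> (2 + 1 / \<sigma>) * L * b powr (\<sigma> - 1) + (2 + 1 / \<sigma>) * (L * s powr (\<sigma> - 1))"
      using \<sigma> L by (intro add_left_mono mult_right_mono) auto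
    also have "\<dots> = N * (b powr (\<sigma> - 1) + s powr (\<sigma> - 1))"
      unfolding NL by (simp add: algebra_simps)
    finally show ?thesis .
  qed
  have W: "((\<lambda>s. (c - s) powr (-\<alpha>)) has_integral W) {0..b}"
    unfolding W_def using kernel_has_integral[of 0 b c \<alpha>] assms by auto
  have d: "((\<lambda>s. (c - s) powr (-\<alpha>) * (\<delta> - \<psi>' s)) has_integral \<delta> * W - I) {0..b}"
    using has_integral_diff[OF has_integral_mult_right[OF W, of \<delta>] I] by (simp add: algebra_simps)
  have "\<bar>\<delta> * W - I\<bar> \<le> N * (4 * (3 / (1 - \<alpha>) + 2 / \<sigma> + 1)) * (b powr (\<sigma> - \<alpha>) * (b / c) powr (\<alpha> + 1))"
  proof (cases "c \<le> 2 * b")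
    case True
    \<comment> \<open>The kernel is singular at b and the bound on \<psi>' at 0. Splitting at b / 2
      bounds the product of the two singular factors by a sum in which each stands alone.\<close>
    let ?g = "\<lambda>s. N * (3 * b powr (\<sigma> - 1) * (b - s) powr (-\<alpha>) + 2 * b powr (-\<alpha>) * s powr (\<sigma> - 1))"
    have W': "((\<lambda>s. (b - s) powr (-\<alpha>)) has_integral b powr (1 - \<alpha>) / (1 - \<alpha>)) {0..b}"
      using kernel_has_integral[of 0 b b \<alpha>] b \<alpha> by auto
    have g: "(?g has_integral N * (3 * b powr (\<sigma> - 1) * (b powr (1 - \<alpha>) / (1 - \<alpha>)) + 2 * b powr (-\<alpha>) * (b powr \<sigma> / \<sigma>))) {0..b}"
      by (intro has_integral_mult_right has_integral_add W' sing)
    have "\<bar>\<delta> * W - I\<bar> \<le> N * (3 * b powr (\<sigma> - 1) * (b powr (1 - \<alpha>) / (1 - \<alpha>)) + 2 * b powr (-\<alpha>) * (b powr \<sigma> / \<sigma>))"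
    proof (rule has_integral_abs_le_interior[OF d g])
      fix s assume s: "s \<in> {0<..<b}"
      have k: "(c - s) powr (-\<alpha>) \<le> (b - s) powr (-\<alpha>)" using s b \<alpha> by (intro powr_mono2') auto
      have "(b - s) powr (-\<alpha>) * s powr (\<sigma> - 1) \<le> 2 * b powr (\<sigma> - 1) * (b - s) powr (-\<alpha>) + 2 * b powr (-\<alpha>) * s powr (\<sigma> - 1)"
      proof (cases "s \<le> b / 2")
        case True
        have "(b - s) powr (-\<alpha>) \<le> (b / 2) powr (-\<alpha>)" using True b \<alpha> by (intro powr_mono2') auto
        also have "\<dots> = 2 powr \<alpha> * b powr (-\<alpha>)" using b by (simp add: powr_divide powr_minus field_simps)
        also have "\<dots> \<le> 2 powr 1 * b powr (-\<alpha>)" using \<alpha> by (intro mult_right_mono powr_mono) auto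
        finally have "(b - s) powr (-\<alpha>) * s powr (\<sigma> - 1) \<le> 2 * b powr (-\<alpha>) * s powr (\<sigma> - 1)"
          by (intro mult_right_mono) auto
        moreover have "0 \<le> 2 * b powr (\<sigma> - 1) * (b - s) powr (-\<alpha>)" by simp
        ultimately show ?thesis by linarith
      next
        case False
        have "s powr (\<sigma> - 1) \<le> 2 * b powr (\<sigma> - 1)"
        proof (cases "1 \<le> \<sigma>")
          case True
          then have "s powr (\<sigma> - 1) \<le> b powr (\<sigma> - 1)" using s by (intro powr_mono2) auto
          moreover have "0 \<le> b powr (\<sigma> - 1)" by simp
          ultimately show ?thesis by linarith
        next
          case \<sigma>1: False
          have "s powr (\<sigma> - 1) \<le> (b / 2) powr (\<sigma> - 1)" using False b \<sigma>1 by (intro powr_mono2') auto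
          also have "\<dots> = 2 powr (1 - \<sigma>) * b powr (\<sigma> - 1)" using b by (simp add: powr_divide powr_diff field_simps)
          also have "\<dots> \<le> 2 powr 1 * b powr (\<sigma> - 1)" using \<sigma> by (intro mult_right_mono powr_mono) auto
          finally show ?thesis by simp
        qed
        then have "(b - s) powr (-\<alpha>) * s powr (\<sigma> - 1) \<le> (b - s) powr (-\<alpha>) * (2 * b powr (\<sigma> - 1))"
          by (intro mult_left_mono) auto
        also have "\<dots> = 2 * b powr (\<sigma> - 1) * (b - s) powr (-\<alpha>)" by simp
        also have "\<dots> \<le> 2 * b powr (\<sigma> - 1) * (b - s) powr (-\<alpha>) + 2 * b powr (-\<alpha>) * s powr (\<sigma> - 1)" by simp
        finally show ?thesis .
      qed
      then have "(b - s) powr (-\<alpha>) * (b powr (\<sigma> - 1) + s powr (\<sigma> - 1)) \<le> 3 * b powr (\<sigma> - 1) * (b - s) powr (-\<alpha>) + 2 * b powr (-\<alpha>) * s powr (\<sigma> - 1)"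
        by (simp add: algebra_simps)
      then have "N * ((b - s) powr (-\<alpha>) * (b powr (\<sigma> - 1) + s powr (\<sigma> - 1))) \<le> ?g s"
        using N by (rule mult_left_mono)
      moreover have "\<bar>(c - s) powr (-\<alpha>) * (\<delta> - \<psi>' s)\<bar> \<le> (b - s) powr (-\<alpha>) * (N * (b powr (\<sigma> - 1) + s powr (\<sigma> - 1)))"
        unfolding abs_mult using k H[OF s] by (intro mult_mono) auto
      ultimately show "\<bar>(c - s) powr (-\<alpha>) * (\<delta> - \<psi>' s)\<bar> \<le> ?g s" by (simp add: mult_ac)
    qed
    also have "\<dots> = N * (3 / (1 - \<alpha>) + 2 / \<sigma>) * b powr (\<sigma> - \<alpha>)"
    proof -
      have "b powr (\<sigma> - 1) * b powr (1 - \<alpha>) = b powr (\<sigma> - \<alpha>)" "b powr (-\<alpha>) * b powr \<sigma> = b powr (\<sigma> - \<alpha>)"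
        by (simp_all flip: powr_add)
      then show ?thesis using \<sigma> \<alpha> by (simp add: field_simps)
    qed
    also have "\<dots> \<le> N * (3 / (1 - \<alpha>) + 2 / \<sigma> + 1) * (b powr (\<sigma> - \<alpha>) * (4 * (b / c) powr (\<alpha> + 1)))"
    proof (intro mult_mono)
      have "(1 / 2) powr 2 \<le> (1 / 2 :: real) powr (\<alpha> + 1)" using \<alpha> by (intro powr_mono') auto
      also have "\<dots> \<le> (b / c) powr (\<alpha> + 1)" using True b \<alpha> by (intro powr_mono2) (auto simp: field_simps)
      finally have "1 \<le> 4 * (b / c) powr (\<alpha> + 1)" by (simp add: power2_eq_square powr_numeral)
      then have "b powr (\<sigma> - \<alpha>) * 1 \<le> b powr (\<sigma> - \<alpha>) * (4 * (b / c) powr (\<alpha> + 1))" by (intro mult_left_mono) auto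
      then show "b powr (\<sigma> - \<alpha>) \<le> b powr (\<sigma> - \<alpha>) * (4 * (b / c) powr (\<alpha> + 1))" by simp
    qed (use N \<alpha> \<sigma> in auto)
    finally show ?thesis by (simp only: mult_ac)
  next
    case False
    then have c: "0 < c" "b < c" using b by auto
    have "((\<lambda>s. \<delta> - \<psi>' s) has_integral 0) {0..b}"
      using has_integral_diff[OF c1[of \<delta>] p] b by (simp add: \<delta>_def)
    from has_integral_diff[OF d has_integral_mult_right[OF this, of "c powr (-\<alpha>)"]]
    have d2: "((\<lambda>s. ((c - s) powr (-\<alpha>) - c powr (-\<alpha>)) * (\<delta> - \<psi>' s)) has_integral (\<delta> * W - I)) {0..b}"
      by (simp add: algebra_simps)
    let ?X = "4 * c powr (-\<alpha> - 1) * b"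
    have "\<bar>\<delta> * W - I\<bar> \<le> ?X * (N * (b * b powr (\<sigma> - 1) + b powr \<sigma> / \<sigma>))"
    proof (rule has_integral_abs_le_interior[OF d2 has_integral_mult_right[OF has_integral_mult_right[OF has_integral_add[OF c1 sing]]]])
      fix s assume s: "s \<in> {0<..<b}"
      have "(c - s) powr (-\<alpha>) - c powr (-\<alpha>) \<le> \<alpha> * (c - s) powr (-\<alpha> - 1) * s"
        using powr_neg_diff_le[of "c - s" c \<alpha>] s b c \<alpha> by auto
      also have "\<dots> \<le> 1 * (4 * c powr (-\<alpha> - 1)) * b"
      proof (intro mult_mono)
        have "(c - s) powr (-\<alpha> - 1) \<le> (c / 2) powr (-\<alpha> - 1)" using s False c \<alpha> by (intro powr_mono2') auto
        also have "\<dots> \<le> 4 * c powr (-\<alpha> - 1)" using c \<alpha> by (intro powr_half_le) auto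
        finally show "(c - s) powr (-\<alpha> - 1) \<le> 4 * c powr (-\<alpha> - 1)" .
      qed (use s \<alpha> in auto)
      finally have "(c - s) powr (-\<alpha>) - c powr (-\<alpha>) \<le> ?X" by simp
      moreover have "c powr (-\<alpha>) \<le> (c - s) powr (-\<alpha>)" using s c \<alpha> by (intro powr_mono2') auto
      ultimately have "\<bar>(c - s) powr (-\<alpha>) - c powr (-\<alpha>)\<bar> \<le> ?X" by simp
      then show "\<bar>((c - s) powr (-\<alpha>) - c powr (-\<alpha>)) * (\<delta> - \<psi>' s)\<bar> \<le> ?X * (N * (b powr (\<sigma> - 1) + s powr (\<sigma> - 1)))"
        unfolding abs_mult using H[OF s] b by (intro mult_mono) auto
    qed
    also have "b * b powr (\<sigma> - 1) + b powr \<sigma> / \<sigma> = (1 + 1 / \<sigma>) * b powr \<sigma>"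
      using b by (simp add: powr_mult_base algebra_simps)
    also have "?X * (N * ((1 + 1 / \<sigma>) * b powr \<sigma>)) = N * (1 + 1 / \<sigma>) * (b powr (\<sigma> - \<alpha>) * (4 * (b / c) powr (\<alpha> + 1)))"
      using b c by (simp add: powr_divide powr_diff powr_add powr_minus field_simps)
    also have "\<dots> \<le> N * (3 / (1 - \<alpha>) + 2 / \<sigma> + 1) * (b powr (\<sigma> - \<alpha>) * (4 * (b / c) powr (\<alpha> + 1)))"
    proof (intro mult_right_mono mult_left_mono)
      have "1 / \<sigma> \<le> 2 / \<sigma>" using \<sigma> by (intro divide_right_mono) auto
      then show "1 + 1 / \<sigma> \<le> 3 / (1 - \<alpha>) + 2 / \<sigma> + 1" using \<alpha> by (simp add: add_increasing)
    qed (use N in auto)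
    finally show ?thesis by (simp only: mult_ac)
  qed
  then show ?thesis by (simp only: \<delta>_def W_def N_def first_step_const_def mult_ac)
qed

section \<open>Truncation error of scalar functions\<close>

context graded_mesh begin

(* With this exponent the first interval dominates if the minimum is \<alpha> + 1, the intervals near t m otherwise. *)
definition truncation_exponent :: "real \<Rightarrow> real" where
  "truncation_exponent \<sigma> = min (\<alpha> + 1) ((2 - \<alpha>) / r + \<alpha> - \<sigma>)"

definition truncation_bound_const :: "real \<Rightarrow> real" where
  "truncation_bound_const \<sigma> = first_step_const \<alpha> \<sigma> + ratio ^ 3 * trunc_const * (1 + r / \<alpha>)"

lemma sum_integral_mesh:
  fixes f :: "real \<Rightarrow> real"
  assumes "f integrable_on {0..t M}" "m \<le> M"
  shows "(\<Sum>j=1..m. integral {t (j - 1)..t j} f) = integral {0..t m} f"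
  using assms(2)
proof (induction m)
  case (Suc m)
  have "integral {0..t m} f + integral {t m..t (Suc m)} f = integral {0..t (Suc m)} f"
    using Suc.prems t_nonneg[of m] t_le[of m "Suc m"] t_le[of "Suc m" M]
    by (intro Henstock_Kurzweil_Integration.integral_combine integrable_subinterval_real[OF assms(1)]) auto
  with Suc show ?case by simp
qed (simp add: t_0)

text \<open>To be applied to the inner product of u(s) with the error at t_m; I is then Gamma(1 -
  \<alpha>) times the Caputo derivative. The first interval falls under
  \<open>first_step_error\<close>, the others under \<open>truncation_sum\<close> with q = 2 -
  \<sigma>.\<close>

lemma truncation_error:
  fixes \<psi> \<psi>' \<psi>'' :: "real \<Rightarrow> real"
  assumes m: "m \<in> {1..M}" and \<sigma>: "0 < \<sigma>" "\<sigma> < 2" "\<sigma> \<noteq> 1" and K: "0 \<le> K"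
    and \<psi>: "continuous_on {0..t M} \<psi>"
      "\<And>s. s \<in> {0<..t M} \<Longrightarrow> (\<psi> has_real_derivative \<psi>' s) (at s within {0<..t M})"
    and \<psi>': "\<And>s. s \<in> {0<..t M} \<Longrightarrow> (\<psi>' has_real_derivative \<psi>'' s) (at s within {0<..t M})"
    and \<psi>'': "\<And>s. s \<in> {0<..t M} \<Longrightarrow> \<bar>\<psi>'' s\<bar> \<le> K * s powr (\<sigma> - 2)"
    and I: "((\<lambda>s. (t m - s) powr (-\<alpha>) * \<psi>' s) has_integral I) {0..t m}"
  shows "\<bar>L1_sum \<alpha> t (\<lambda>j. \<psi> (t j)) m / (1 - \<alpha>) - I\<bar>
    \<le> K * truncation_bound_const \<sigma> * (t 1 powr (\<sigma> - \<alpha>) * (t 1 / t m) powr truncation_exponent \<sigma>)"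
proof -
  define p where "p = truncation_exponent \<sigma>"
  define f where "f s = (t m - s) powr (-\<alpha>) * \<psi>' s" for s
  define W where "W j = ((t m - t (j - 1)) powr (1 - \<alpha>) - (t m - t j) powr (1 - \<alpha>)) / (1 - \<alpha>)" for j
  define \<Delta> where "\<Delta> j = \<psi> (t j) - \<psi> (t (j - 1))" for j
  define I' where "I' j = integral {t (j - 1)..t j} f" for j
  define err where "err j = \<bar>\<Delta> j / \<tau> j * W j - I' j\<bar>" for j
  have mM: "1 \<le> m" "m \<le> M" using m by auto
  have t: "0 < t 1" "t 1 \<le> t m" "0 < t m" "t m \<le> t M" using t_1_pos t_1_le[of m] t_le[of m M] t_pos[of m] mM by auto
  define x where "x = t 1 / t m"
  have x: "0 < x" "x \<le> 1" using t by (auto simp: x_def)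
  have at: "(g has_real_derivative g' s) (at s)"
    if "\<And>s. s \<in> {0<..t M} \<Longrightarrow> (g has_real_derivative g' s) (at s within {0<..t M})" "0 < s" "s < t M" for g g' s
  proof -
    have "(g has_real_derivative g' s) (at s within {0<..<t M})"
      using that(1)[of s] that(2,3) by (auto intro: has_field_derivative_subset)
    then show ?thesis using that at_within_open[of s "{0<..<t M}"] by simp
  qed
  have f: "f integrable_on {0..t m}" "integral {0..t m} f = I" using I by (auto simp: f_def[abs_def] has_integral_iff)
  have Isub: "(f has_integral I' j) {t (j - 1)..t j}" if "j \<in> {1..m}" for j
    unfolding I'_def using that mM t_nonneg[of "j - 1"] t_le[of j m]
    by (intro integrable_integral integrable_subinterval_real[OF f(1)]) auto
  \<comment> \<open>The integrand is known to be integrable on [0, t_m] only, so the mesh is cut at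
    m.\<close>
  interpret sub: graded_mesh \<alpha> t m r c
    by unfold_locales (use mM \<alpha> t_0 t_step r c grading in auto)
  have I_sum: "(\<Sum>j=1..m. I' j) = I" unfolding I'_def using sub.sum_integral_mesh[of f m] f by simp

  have both: "err j \<le> K * ratio ^ 3 * \<tau> j * t j powr (- (2 - \<sigma>)) * W j"
    "j < m \<Longrightarrow> err j \<le> K * ratio ^ 3 * \<tau> j * t j powr (- (2 - \<sigma>)) *
      \<tau> j * ((t m - t j) powr (-\<alpha>) - (t m - t (j - 1)) powr (-\<alpha>))"
    if j: "j \<in> {Suc 1..m}" for j
  proof -
    have ord: "0 < t (j - 1)" "t (j - 1) < t j" "t j \<le> t m" "t j \<le> t M"
      using t_pos[of "j - 1"] t_pred[of j] t_le[of j m] t_le[of j M] j mM by auto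
    have der: "(\<psi> has_real_derivative \<psi>' s) (at s within {t (j - 1)..t j})" if "s \<in> {t (j - 1)..t j}" for s
      using \<psi>(2)[of s] ord that by (auto intro: has_field_derivative_subset)
    have I'': "((\<lambda>s. (t m - s) powr (-\<alpha>) * \<psi>' s) has_integral I' j) {t (j - 1)..t j}"
      using Isub[of j] j by (simp add: f_def[abs_def])
    have der': "(\<psi>' has_real_derivative \<psi>'' s) (at s)" if "s \<in> {t (j - 1)<..<t j}" for s
      using that ord by (intro at[OF \<psi>']) auto
    have der'': "\<bar>\<psi>'' s\<bar> \<le> K * s powr (- (2 - \<sigma>))" if "s \<in> {t (j - 1)<..<t j}" for s
      using \<psi>''[of s] that ord by auto
    show "err j \<le> K * ratio ^ 3 * \<tau> j * t j powr (- (2 - \<sigma>)) * W j"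
      unfolding err_def W_def \<Delta>_def using j mM \<sigma> K
      by (intro interval_quadrature_error(1)[OF _ _ _ _ _ der der' der'' I'']) auto
    show "err j \<le> K * ratio ^ 3 * \<tau> j * t j powr (- (2 - \<sigma>)) *
      \<tau> j * ((t m - t j) powr (-\<alpha>) - (t m - t (j - 1)) powr (-\<alpha>))" if "j < m"
      unfolding err_def W_def \<Delta>_def using j mM \<sigma> K that
      by (intro interval_quadrature_error(2)[OF _ _ _ _ _ der der' der'' I'']) auto
  qed
  have "(\<Sum>j\<in>{Suc 1..m}. err j) \<le> K * ratio ^ 3 * trunc_const *
    (t m powr (2 - \<alpha> - (2 - \<sigma>)) * (t 1 / t m) powr ((2 - \<alpha>) / r) + t m powr (-\<alpha> - 1) *
      (\<Sum>j\<in>{Suc 1..m}. \<tau> j * ((t 1 / t j) powr (2 / r) * t j powr (2 - (2 - \<sigma>)))))"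
    using both mM \<sigma> K unfolding W_def by (intro truncation_sum) (auto simp: ratio_def)
  also have "\<dots> \<le> K * ratio ^ 3 * trunc_const *
    (t 1 powr (\<sigma> - \<alpha>) * x powr p + t 1 powr (\<sigma> - \<alpha>) * x powr p * (r / \<alpha>))"
  proof (intro mult_left_mono add_mono)
    have "t m powr (2 - \<alpha> - (2 - \<sigma>)) * (t 1 / t m) powr ((2 - \<alpha>) / r) = t 1 powr (\<sigma> - \<alpha>) * x powr ((2 - \<alpha>) / r + \<alpha> - \<sigma>)"
      using t by (simp add: x_def powr_divide powr_add powr_diff field_simps)
    also have "\<dots> \<le> t 1 powr (\<sigma> - \<alpha>) * x powr p"
      using x by (intro mult_left_mono powr_mono') (auto simp: p_def truncation_exponent_def)
    finally show "t m powr (2 - \<alpha> - (2 - \<sigma>)) * (t 1 / t m) powr ((2 - \<alpha>) / r) \<le> t 1 powr (\<sigma> - \<alpha>) * x powr p" .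
    \<comment> \<open>In these terms \<open>p \<le> (2 - \<alpha>) / r + \<alpha> - \<sigma>\<close>
      gives \<open>1 + \<epsilon> - Q \<le> 2 / r - \<sigma>\<close>. The power of y = t_1 / t_j
      thus splits into \<open>y powr (1 + \<epsilon>)\<close>, which is summable, and
      \<open>y powr (-Q)\<close>, which is largest at t_m because Q \<ge> 0.\<close>
    define Q where "Q = \<alpha> + 1 - p"
    define \<epsilon> where "\<epsilon> = \<alpha> / r"
    have \<epsilon>: "0 < \<epsilon>" using \<alpha> r by (simp add: \<epsilon>_def)
    have Q: "0 \<le> Q" "1 + \<epsilon> - Q \<le> 2 / r - \<sigma>"
      unfolding Q_def p_def truncation_exponent_def \<epsilon>_def by (auto simp: diff_divide_distrib min_def)
    have "(\<Sum>j\<in>{Suc 1..m}. \<tau> j * ((t 1 / t j) powr (2 / r) * t j powr (2 - (2 - \<sigma>)))) \<le>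
      (\<Sum>j\<in>{Suc 1..m}. \<tau> j * (t 1 powr (\<sigma> + 1 + \<epsilon>) * x powr (-Q) * t j powr (-1 - \<epsilon>)))"
    proof (intro sum_mono mult_left_mono)
      fix j assume j: "j \<in> {Suc 1..m}"
      have ord: "0 < t j" "t 1 \<le> t j" "t j \<le> t m" "t (j - 1) < t j"
        using t_pos[of j] t_1_le[of j] t_le[of j m] t_pred[of j] j mM by auto
      define y where "y = t 1 / t j"
      have y: "0 < y" "y \<le> 1" "x \<le> y" using ord t by (auto simp: y_def x_def intro!: divide_left_mono)
      have "(t 1 / t j) powr (2 / r) * t j powr (2 - (2 - \<sigma>)) = t 1 powr \<sigma> * y powr (2 / r - \<sigma>)"
        using ord t by (simp add: y_def powr_divide powr_diff field_simps)
      also have "\<dots> \<le> t 1 powr \<sigma> * y powr (1 + \<epsilon> - Q)"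
        using y Q by (intro mult_left_mono powr_mono') auto
      also have "\<dots> = t 1 powr \<sigma> * (y powr (1 + \<epsilon>) * y powr (-Q))"
        by (simp flip: powr_add)
      also have "\<dots> \<le> t 1 powr \<sigma> * (y powr (1 + \<epsilon>) * x powr (-Q))"
        using y x Q by (intro mult_left_mono powr_mono2') auto
      also have "\<dots> = t 1 powr (\<sigma> + 1 + \<epsilon>) * x powr (-Q) * t j powr (-1 - \<epsilon>)"
      proof -
        have "t j powr (-1 - \<epsilon>) = 1 / t j powr (1 + \<epsilon>)"
          by (metis minus_diff_eq powr_minus_divide uminus_add_conv_diff diff_minus_eq_add add.commute)
        moreover have "t 1 powr (\<sigma> + 1 + \<epsilon>) = t 1 powr \<sigma> * t 1 powr (1 + \<epsilon>)" by (simp add: add.assoc flip: powr_add)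
        ultimately show ?thesis using ord t by (simp add: y_def powr_divide)
      qed
      finally show "(t 1 / t j) powr (2 / r) * t j powr (2 - (2 - \<sigma>)) \<le> t 1 powr (\<sigma> + 1 + \<epsilon>) * x powr (-Q) * t j powr (-1 - \<epsilon>)" .
    qed (use t_pred mM in \<open>auto simp: less_imp_le\<close>)
    also have "\<dots> = t 1 powr (\<sigma> + 1 + \<epsilon>) * x powr (-Q) * (\<Sum>j\<in>{Suc 1..m}. \<tau> j * t j powr (-1 - \<epsilon>))"
      by (simp add: sum_distrib_left mult_ac)
    also have "\<dots> \<le> t 1 powr (\<sigma> + 1 + \<epsilon>) * x powr (-Q) * (t 1 powr (-\<epsilon>) / \<epsilon>)"
      using mM \<epsilon> by (intro mult_left_mono sum_step_powr_le) auto
    also have "\<dots> = t 1 powr (\<sigma> + 1) * x powr (-Q) * (r / \<alpha>)"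
    proof -
      have "t 1 powr (\<sigma> + 1 + \<epsilon>) * t 1 powr (-\<epsilon>) = t 1 powr (\<sigma> + 1)" by (simp flip: powr_add)
      then show ?thesis by (simp add: \<epsilon>_def)
    qed
    finally have "t m powr (-\<alpha> - 1) * (\<Sum>j\<in>{Suc 1..m}. \<tau> j * ((t 1 / t j) powr (2 / r) * t j powr (2 - (2 - \<sigma>))))
      \<le> t m powr (-\<alpha> - 1) * (t 1 powr (\<sigma> + 1) * x powr (-Q) * (r / \<alpha>))"
      by (intro mult_left_mono) auto
    also have "\<dots> = t 1 powr (\<sigma> - \<alpha>) * x powr p * (r / \<alpha>)"
    proof -
      have "x powr p = x powr (\<alpha> + 1) * x powr (-Q)" by (simp add: Q_def flip: powr_add)
      also have "x powr (\<alpha> + 1) = t 1 powr (\<alpha> + 1) * t m powr (-\<alpha> - 1)"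
        using t by (simp add: x_def powr_divide powr_diff powr_add powr_minus field_simps)
      finally have "t 1 powr (\<sigma> - \<alpha>) * x powr p = t 1 powr (\<sigma> - \<alpha>) * t 1 powr (\<alpha> + 1) * t m powr (-\<alpha> - 1) * x powr (-Q)"
        by simp
      also have "t 1 powr (\<sigma> - \<alpha>) * t 1 powr (\<alpha> + 1) = t 1 powr (\<sigma> + 1)" by (simp flip: powr_add)
      finally show ?thesis by simp
    qed
    finally show "t m powr (-\<alpha> - 1) * (\<Sum>j\<in>{Suc 1..m}. \<tau> j * ((t 1 / t j) powr (2 / r) * t j powr (2 - (2 - \<sigma>))))
      \<le> t 1 powr (\<sigma> - \<alpha>) * x powr p * (r / \<alpha>)" .
  qed (use trunc_const_pos K in \<open>auto simp: ratio_def\<close>)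
  also have "\<dots> = K * (ratio ^ 3 * trunc_const * (1 + r / \<alpha>)) * (t 1 powr (\<sigma> - \<alpha>) * x powr p)"
    by (simp add: algebra_simps)
  finally have late: "(\<Sum>j\<in>{Suc 1..m}. err j) \<le> K * (ratio ^ 3 * trunc_const * (1 + r / \<alpha>)) * (t 1 powr (\<sigma> - \<alpha>) * x powr p)" .

  have "\<bar>(\<psi> (t 1) - \<psi> 0) / t 1 * ((t m powr (1 - \<alpha>) - (t m - t 1) powr (1 - \<alpha>)) / (1 - \<alpha>)) - I' 1\<bar>
    \<le> K * first_step_const \<alpha> \<sigma> * (t 1 powr (\<sigma> - \<alpha>) * (t 1 / t m) powr (\<alpha> + 1))"
  proof (rule first_step_error[where \<psi>' = \<psi>' and \<psi>'' = \<psi>''])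
    show "continuous_on {0..t 1} \<psi>" using \<psi>(1) t by (auto intro: continuous_on_subset)
    show "(\<psi> has_real_derivative \<psi>' s) (at s)" if "s \<in> {0<..<t 1}" for s
      using that t by (intro at[OF \<psi>(2)]) auto
    show "(\<psi>' has_real_derivative \<psi>'' s) (at s within {0<..t 1})" if "s \<in> {0<..t 1}" for s
      using \<psi>'[of s] that t by (auto intro: has_field_derivative_subset)
    show "((\<lambda>s. (t m - s) powr - \<alpha> * \<psi>' s) has_integral I' 1) {0..t 1}"
      using Isub[of 1] mM t_0 by (simp add: f_def[abs_def])
  qed (use \<alpha> \<sigma> K t \<psi>'' in auto)
  also have "\<dots> \<le> K * first_step_const \<alpha> \<sigma> * (t 1 powr (\<sigma> - \<alpha>) * x powr p)"
    unfolding x_def[symmetric] using x K \<sigma> \<alpha>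
    by (intro mult_left_mono powr_mono') (auto simp: p_def truncation_exponent_def first_step_const_def
        intro!: mult_nonneg_nonneg divide_nonneg_nonneg add_nonneg_nonneg)
  finally have first: "err 1 \<le> K * first_step_const \<alpha> \<sigma> * (t 1 powr (\<sigma> - \<alpha>) * x powr p)"
    by (simp add: err_def \<Delta>_def W_def t_0)

  have "L1_sum \<alpha> t (\<lambda>j. \<psi> (t j)) m / (1 - \<alpha>) = (\<Sum>j=1..m. \<Delta> j / \<tau> j * W j)"
    unfolding L1_sum_def sum_divide_distrib by (intro sum.cong) (auto simp: \<Delta>_def wt_def W_def)
  then have "\<bar>L1_sum \<alpha> t (\<lambda>j. \<psi> (t j)) m / (1 - \<alpha>) - I\<bar> = \<bar>\<Sum>j=1..m. \<Delta> j / \<tau> j * W j - I' j\<bar>"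
    by (simp add: I_sum[symmetric] sum_subtractf)
  also have "\<dots> \<le> (\<Sum>j=1..m. err j)" unfolding err_def by (rule sum_abs)
  also have "\<dots> = err 1 + (\<Sum>j\<in>{Suc 1..m}. err j)" using mM by (simp add: sum.atLeast_Suc_atMost)
  also have "\<dots> \<le> K * truncation_bound_const \<sigma> * (t 1 powr (\<sigma> - \<alpha>) * x powr p)"
    using first late by (simp add: truncation_bound_const_def algebra_simps)
  finally show ?thesis by (simp add: x_def p_def)
qed

end

section \<open>Square-integrable functions\<close>

text \<open>Holds since Lebesgue measure is complete. It gives measurability of \<open>U 0\<close>,
  which is known only to agree with the initial value almost everywhere.\<close>

lemma borel_measurable_lebesgue_on_cong_AE:
  fixes f g :: "'a::euclidean_space \<Rightarrow> 'b::topological_space"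
  assumes S: "S \<in> sets lebesgue" and f: "f \<in> borel_measurable (lebesgue_on S)"
    and eq: "AE x in lebesgue_on S. f x = g x"
  shows "g \<in> borel_measurable (lebesgue_on S)"
proof -
  obtain N where N: "{x \<in> space (lebesgue_on S). f x \<noteq> g x} \<subseteq> N" "N \<in> null_sets (lebesgue_on S)"
    using eq unfolding eventually_ae_filter by auto
  have sub: "B \<in> sets (lebesgue_on S)" if "B \<subseteq> N" for B
  proof -
    have "N \<in> null_sets lebesgue" "B \<subseteq> S"
      using N(2) S that null_sets_restrict_space[of S lebesgue N] by (auto simp: null_sets_def sets_restrict_space_iff)
    then have "B \<in> null_sets lebesgue" using that completion.complete2 by blast
    then show ?thesis using S \<open>B \<subseteq> S\<close> by (auto simp: sets_restrict_space_iff)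
  qed
  show ?thesis
  proof (rule measurableI)
    fix A :: "'b set" assume A: "A \<in> sets borel"
    have "g -` A \<inter> space (lebesgue_on S) = ((f -` A \<inter> space (lebesgue_on S)) - N) \<union> (g -` A \<inter> S \<inter> N)"
      using N(1) by auto
    moreover have "\<dots> \<in> sets (lebesgue_on S)"
      using f A by (intro sets.Un sets.Diff measurable_sets[OF f A] sub) auto
    ultimately show "g -` A \<inter> space (lebesgue_on S) \<in> sets (lebesgue_on S)" by (simp only:)
  qed auto
qed

definition L2_inner :: "(real^'d) set \<Rightarrow> (real^'d \<Rightarrow> real) \<Rightarrow> (real^'d \<Rightarrow> real) \<Rightarrow> real" where
  "L2_inner \<Omega> f g = (LINT x|lebesgue_on \<Omega>. f x * g x)"

lemma L2_fun_measurable: "L2_fun \<Omega> f \<Longrightarrow> f \<in> borel_measurable (lebesgue_on \<Omega>)"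
  by (simp add: L2_fun_def)

lemma L2_mult_integrable:
  fixes f g :: "real^'d \<Rightarrow> real"
  assumes "L2_fun \<Omega> f" "L2_fun \<Omega> g"
  shows "integrable (lebesgue_on \<Omega>) (\<lambda>x. f x * g x)"
proof (rule Bochner_Integration.integrable_bound)
  show "integrable (lebesgue_on \<Omega>) (\<lambda>x. (norm (f x))\<^sup>2 + (norm (g x))\<^sup>2)"
    using assms by (intro Bochner_Integration.integrable_add) (auto simp: L2_fun_def)
  have "\<bar>a * b\<bar> \<le> a\<^sup>2 + b\<^sup>2" for a b :: real
  proof -
    have "2 * (\<bar>a\<bar> * \<bar>b\<bar>) \<le> a\<^sup>2 + b\<^sup>2" using sum_squares_bound[of "\<bar>a\<bar>" "\<bar>b\<bar>"] by simp
    moreover have "0 \<le> \<bar>a\<bar> * \<bar>b\<bar>" by simp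
    ultimately show ?thesis unfolding abs_mult by linarith
  qed
  then show "AE x in lebesgue_on \<Omega>. norm (f x * g x) \<le> norm ((norm (f x))\<^sup>2 + (norm (g x))\<^sup>2)"
    by (intro AE_I2) simp
qed (use assms in \<open>auto simp: L2_fun_def\<close>)

lemma L2_fun_norm: "L2_fun \<Omega> f \<Longrightarrow> L2_fun \<Omega> (\<lambda>x. norm (f x))"
  by (auto simp: L2_fun_def)

lemma L2_norm_norm: "L2_norm \<Omega> (\<lambda>x. norm (f x)) = L2_norm \<Omega> f"
  by (simp add: L2_norm_def)

lemma L2_fun_add:
  assumes "L2_fun \<Omega> f" "L2_fun \<Omega> g"
  shows "L2_fun \<Omega> (\<lambda>x. f x + g x)"
  unfolding L2_fun_def
proof
  show m: "(\<lambda>x. f x + g x) \<in> borel_measurable (lebesgue_on \<Omega>)"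
    using assms by (auto simp: L2_fun_def)
  show "integrable (lebesgue_on \<Omega>) (\<lambda>x. (norm (f x + g x))\<^sup>2)"
  proof (rule Bochner_Integration.integrable_bound)
    show "integrable (lebesgue_on \<Omega>) (\<lambda>x. 2 * (norm (f x))\<^sup>2 + 2 * (norm (g x))\<^sup>2)"
      using assms by (intro Bochner_Integration.integrable_add integrable_mult_right) (auto simp: L2_fun_def)
    have "(norm (a + b))\<^sup>2 \<le> 2 * (norm a)\<^sup>2 + 2 * (norm b)\<^sup>2" for a b :: 'b
    proof -
      have "(norm (a + b))\<^sup>2 \<le> (norm a + norm b)\<^sup>2" by (intro power_mono norm_triangle_ineq) auto
      also have "\<dots> \<le> 2 * (norm a)\<^sup>2 + 2 * (norm b)\<^sup>2"
        using sum_squares_bound[of "norm a" "norm b"] by (simp add: power2_sum)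
      finally show ?thesis .
    qed
    then show "AE x in lebesgue_on \<Omega>. norm ((norm (f x + g x))\<^sup>2) \<le> norm (2 * (norm (f x))\<^sup>2 + 2 * (norm (g x))\<^sup>2)"
      by (intro AE_I2) simp
  qed (use m in auto)
qed

lemma L2_fun_scaleR: "L2_fun \<Omega> f \<Longrightarrow> L2_fun \<Omega> (\<lambda>x. c *\<^sub>R f x)"
  by (auto simp: L2_fun_def power_mult_distrib)

lemma L2_fun_cmult: "L2_fun \<Omega> f \<Longrightarrow> L2_fun \<Omega> (\<lambda>x. c * f x :: real)"
  using L2_fun_scaleR[of \<Omega> f c] by simp

lemma L2_fun_diff: "L2_fun \<Omega> f \<Longrightarrow> L2_fun \<Omega> g \<Longrightarrow> L2_fun \<Omega> (\<lambda>x. f x - g x)"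
  using L2_fun_add[of \<Omega> f "\<lambda>x. (-1) *\<^sub>R g x"] L2_fun_scaleR[of \<Omega> g "-1"] by simp

lemma L2_fun_divide: "L2_fun \<Omega> f \<Longrightarrow> L2_fun \<Omega> (\<lambda>x. f x / c :: real)"
  using L2_fun_cmult[of \<Omega> f "1 / c"] by simp

lemma L2_fun_zero: "L2_fun \<Omega> (\<lambda>x. 0)"
  by (simp add: L2_fun_def)

lemma L2_fun_sum: "(\<And>i. i \<in> A \<Longrightarrow> L2_fun \<Omega> (f i)) \<Longrightarrow> L2_fun \<Omega> (\<lambda>x. \<Sum>i\<in>A. f i x)"
  by (induction A rule: infinite_finite_induct) (auto intro: L2_fun_add simp: L2_fun_zero)

lemma L2_fun_component:
  fixes G :: "real^'d \<Rightarrow> real^'d"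
  assumes "L2_fun \<Omega> G"
  shows "L2_fun \<Omega> (\<lambda>x. G x $ k)"
  unfolding L2_fun_def
proof
  show m: "(\<lambda>x. G x $ k) \<in> borel_measurable (lebesgue_on \<Omega>)"
    using assms borel_measurable_euclidean_space[of G "lebesgue_on \<Omega>"]
    by (auto simp: L2_fun_def cart_eq_inner_axis axis_in_Basis_iff)
  show "integrable (lebesgue_on \<Omega>) (\<lambda>x. (norm (G x $ k))\<^sup>2)"
  proof (rule Bochner_Integration.integrable_bound[where f = "\<lambda>x. (norm (G x))\<^sup>2"])
    have "(G x $ k)\<^sup>2 \<le> (norm (G x))\<^sup>2" for x
      using power_mono[OF component_le_norm_cart[of "G x" k], of 2] by simp
    then show "AE x in lebesgue_on \<Omega>. norm ((norm (G x $ k))\<^sup>2) \<le> norm ((norm (G x))\<^sup>2)" by simp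
  qed (use assms m in \<open>auto simp: L2_fun_def\<close>)
qed

lemma L2_norm_nonneg: "0 \<le> L2_norm \<Omega> f"
  by (simp add: L2_norm_def)

lemma L2_norm_power2:
  fixes f :: "real^'d \<Rightarrow> real"
  shows "(L2_norm \<Omega> f)\<^sup>2 = L2_inner \<Omega> f f"
  by (simp add: L2_norm_def L2_inner_def power2_eq_square)

lemma L2_inner_commute: "L2_inner \<Omega> f g = L2_inner \<Omega> g f"
  by (simp add: L2_inner_def mult.commute)

lemma L2_inner_add:
  "L2_fun \<Omega> f \<Longrightarrow> L2_fun \<Omega> g \<Longrightarrow> L2_fun \<Omega> h \<Longrightarrow> L2_inner \<Omega> (\<lambda>x. f x + g x) h = L2_inner \<Omega> f h + L2_inner \<Omega> g h"
  using L2_mult_integrable[of \<Omega> f h] L2_mult_integrable[of \<Omega> g h]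
  by (simp add: L2_inner_def distrib_right)

lemma L2_inner_diff:
  "L2_fun \<Omega> f \<Longrightarrow> L2_fun \<Omega> g \<Longrightarrow> L2_fun \<Omega> h \<Longrightarrow> L2_inner \<Omega> (\<lambda>x. f x - g x) h = L2_inner \<Omega> f h - L2_inner \<Omega> g h"
  using L2_mult_integrable[of \<Omega> f h] L2_mult_integrable[of \<Omega> g h]
  by (simp add: L2_inner_def left_diff_distrib)

lemma L2_inner_cmult: "L2_inner \<Omega> (\<lambda>x. c * f x) h = c * L2_inner \<Omega> f h"
  by (simp add: L2_inner_def mult.assoc)

lemma L2_inner_divide: "L2_inner \<Omega> (\<lambda>x. f x / c) h = L2_inner \<Omega> f h / c"
  using L2_inner_cmult[of \<Omega> "1 / c" f h] by simp

lemma L2_inner_sum: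
  assumes "\<And>i. i \<in> A \<Longrightarrow> L2_fun \<Omega> (f i)" "L2_fun \<Omega> h"
  shows "L2_inner \<Omega> (\<lambda>x. \<Sum>i\<in>A. f i x) h = (\<Sum>i\<in>A. L2_inner \<Omega> (f i) h)"
  using assms by (simp add: L2_inner_def sum_distrib_right L2_mult_integrable Bochner_Integration.integral_sum)

lemma L2_Cauchy_Schwarz:
  fixes f g :: "real^'d \<Rightarrow> real"
  assumes f: "L2_fun \<Omega> f" and g: "L2_fun \<Omega> g"
  shows "\<bar>L2_inner \<Omega> f g\<bar> \<le> L2_norm \<Omega> f * L2_norm \<Omega> g"
proof -
  let ?a = "L2_inner \<Omega> f f" and ?b = "L2_inner \<Omega> f g" and ?c = "L2_inner \<Omega> g g"
  have q: "0 \<le> ?a - 2 * s * ?b + s\<^sup>2 * ?c" for s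
  proof -
    have h: "L2_fun \<Omega> (\<lambda>x. s * g x)" using g by (rule L2_fun_cmult)
    have "0 \<le> L2_inner \<Omega> (\<lambda>x. f x - s * g x) (\<lambda>x. f x - s * g x)"
      unfolding L2_norm_power2[symmetric] by simp
    also have "\<dots> = L2_inner \<Omega> f (\<lambda>x. f x - s * g x) - s * L2_inner \<Omega> g (\<lambda>x. f x - s * g x)"
      using f h L2_fun_diff[OF f h] by (simp add: L2_inner_diff L2_inner_cmult)
    also have "L2_inner \<Omega> f (\<lambda>x. f x - s * g x) = ?a - s * ?b"
      by (subst (1 2) L2_inner_commute) (use f g h in \<open>simp add: L2_inner_diff L2_inner_cmult\<close>)
    also have "L2_inner \<Omega> g (\<lambda>x. f x - s * g x) = ?b - s * ?c"
      by (subst L2_inner_commute) (use f g h in \<open>simp add: L2_inner_diff L2_inner_cmult\<close>)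
    also have "(?a - s * ?b) - s * (?b - s * ?c) = ?a - 2 * s * ?b + s\<^sup>2 * ?c"
      by (simp add: algebra_simps power2_eq_square)
    finally show ?thesis .
  qed
  have c: "0 \<le> ?c" "0 \<le> ?a" unfolding L2_norm_power2[symmetric] by auto
  have "?b\<^sup>2 \<le> ?a * ?c"
  proof (cases "?c = 0")
    case True
    have "?b = 0"
    proof (rule ccontr)
      assume "?b \<noteq> 0"
      \<comment> \<open>With \<open>?c = 0\<close> the quadratic is affine in s, and at this s its
        value is -1.\<close>
      then show False using q[of "(?a + 1) / (2 * ?b)"] True by (simp add: field_simps)
    qed
    then show ?thesis using True by simp
  next
    case False
    then have "0 < ?c" using c by simp
    then have "0 \<le> ?c * (?a - 2 * (?b / ?c) * ?b + (?b / ?c)\<^sup>2 * ?c)" using q[of "?b / ?c"] by simp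
    also have "\<dots> = ?a * ?c - ?b\<^sup>2" using \<open>0 < ?c\<close> by (simp add: field_simps power2_eq_square)
    finally show ?thesis by simp
  qed
  then have "?b\<^sup>2 \<le> (L2_norm \<Omega> f * L2_norm \<Omega> g)\<^sup>2"
    by (simp add: power_mult_distrib L2_norm_power2)
  then show ?thesis
    using L2_norm_nonneg[of \<Omega> f] L2_norm_nonneg[of \<Omega> g] by (simp add: abs_le_square_iff[symmetric] abs_mult)
qed

text \<open>Vector-valued functions are handled through their norms, to which the scalar
  Cauchy-Schwarz inequality applies.\<close>

lemma L2_norm_triangle:
  assumes f: "L2_fun \<Omega> f" and g: "L2_fun \<Omega> g"
  shows "L2_norm \<Omega> (\<lambda>x. f x + g x) \<le> L2_norm \<Omega> f + L2_norm \<Omega> g"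
proof -
  let ?F = "\<lambda>x. norm (f x)" and ?G = "\<lambda>x. norm (g x)"
  note FG = L2_fun_norm[OF f] L2_fun_norm[OF g]
  have "(L2_norm \<Omega> (\<lambda>x. f x + g x))\<^sup>2 = (LINT x|lebesgue_on \<Omega>. (norm (f x + g x))\<^sup>2)"
    by (simp add: L2_norm_def)
  also have "\<dots> \<le> (LINT x|lebesgue_on \<Omega>. (?F x + ?G x) * (?F x + ?G x))"
    using L2_fun_add[OF f g] L2_mult_integrable[OF L2_fun_add[OF FG] L2_fun_add[OF FG]]
    by (intro integral_mono) (auto simp: L2_fun_def simp flip: power2_eq_square intro!: power_mono norm_triangle_ineq)
  also have "\<dots> = L2_inner \<Omega> (\<lambda>x. ?F x + ?G x) (\<lambda>x. ?F x + ?G x)" by (simp add: L2_inner_def)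
  also have "\<dots> = L2_inner \<Omega> ?F ?F + 2 * L2_inner \<Omega> ?F ?G + L2_inner \<Omega> ?G ?G"
  proof -
    have "L2_inner \<Omega> (\<lambda>x. ?F x + ?G x) (\<lambda>x. ?F x + ?G x) =
        L2_inner \<Omega> (\<lambda>x. ?F x + ?G x) ?F + L2_inner \<Omega> (\<lambda>x. ?F x + ?G x) ?G"
      using L2_inner_add[OF FG L2_fun_add[OF FG]]
        L2_inner_commute[of \<Omega> ?F "\<lambda>x. ?F x + ?G x"] L2_inner_commute[of \<Omega> ?G "\<lambda>x. ?F x + ?G x"] by simp
    then show ?thesis
      using L2_inner_add[OF FG FG(1)] L2_inner_add[OF FG FG(2)] L2_inner_commute[of \<Omega> ?G ?F] by simp
  qed
  also have "\<dots> \<le> (L2_norm \<Omega> f)\<^sup>2 + 2 * (L2_norm \<Omega> f * L2_norm \<Omega> g) + (L2_norm \<Omega> g)\<^sup>2"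
    using L2_Cauchy_Schwarz[OF FG] unfolding L2_norm_power2[symmetric] by (simp add: L2_norm_norm abs_le_iff)
  also have "\<dots> = (L2_norm \<Omega> f + L2_norm \<Omega> g)\<^sup>2" by (simp add: power2_sum)
  finally show ?thesis by (rule power2_le_imp_le) (simp add: L2_norm_nonneg)
qed

lemma L2_norm_diff_le:
  assumes "L2_fun \<Omega> f" "L2_fun \<Omega> g"
  shows "L2_norm \<Omega> (\<lambda>x. f x - g x) \<le> L2_norm \<Omega> f + L2_norm \<Omega> g"
  using L2_norm_triangle[OF assms(1) L2_fun_scaleR[OF assms(2), of "-1"]] by (simp add: L2_norm_def)

section \<open>Test functions and differences in \<open>H1_0\<close>\<close>

lemma smooth_fun_iterated: "smooth_fun \<phi> \<Longrightarrow> foldr pderivative ks \<phi> differentiable_on UNIV"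
  by (simp add: smooth_fun_def)

lemma pderivative_diff:
  assumes "\<phi> differentiable_on UNIV" "\<psi> differentiable_on UNIV"
  shows "pderivative k (\<lambda>x. \<phi> x - \<psi> x) x = pderivative k \<phi> x - pderivative k \<psi> x"
proof -
  have "\<phi> differentiable (at x)" "\<psi> differentiable (at x)" using assms by (auto simp: differentiable_on_def)
  then have "((\<lambda>x. \<phi> x - \<psi> x) has_derivative
      (\<lambda>h. frechet_derivative \<phi> (at x) h - frechet_derivative \<psi> (at x) h)) (at x)"
    by (intro has_derivative_diff) (auto simp: frechet_derivative_works)
  then show ?thesis by (simp add: pderivative_def frechet_derivative_at[symmetric])
qed

lemma smooth_fun_diff:
  assumes "smooth_fun \<phi>" "smooth_fun \<psi>"
  shows "smooth_fun (\<lambda>x. \<phi> x - \<psi> x)"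
proof -
  have "foldr pderivative ks (\<lambda>x. \<phi> x - \<psi> x) = (\<lambda>x. foldr pderivative ks \<phi> x - foldr pderivative ks \<psi> x)" for ks
    by (induction ks) (use assms in \<open>auto simp: pderivative_diff smooth_fun_iterated\<close>)
  then show ?thesis using assms unfolding smooth_fun_def by (auto intro: differentiable_on_diff)
qed

lemma test_fun_diff:
  assumes "test_fun \<Omega> \<phi>" "test_fun \<Omega> \<psi>"
  shows "test_fun \<Omega> (\<lambda>x. \<phi> x - \<psi> x)"
proof -
  have "closure {x. \<phi> x - \<psi> x \<noteq> 0} \<subseteq> closure ({x. \<phi> x \<noteq> 0} \<union> {x. \<psi> x \<noteq> 0})"
    by (intro closure_mono) auto
  then have sub: "closure {x. \<phi> x - \<psi> x \<noteq> 0} \<subseteq> closure {x. \<phi> x \<noteq> 0} \<union> closure {x. \<psi> x \<noteq> 0}"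
    by (simp add: closure_Un)
  moreover have "compact (closure {x. \<phi> x \<noteq> 0} \<union> closure {x. \<psi> x \<noteq> 0})"
    using assms by (auto simp: test_fun_def)
  ultimately have "compact (closure {x. \<phi> x - \<psi> x \<noteq> 0})"
    by (meson closed_closure compact_Int_closed compact_closure bounded_subset compact_imp_bounded closure_subset order_trans)
  then show ?thesis using assms sub smooth_fun_diff by (auto simp: test_fun_def)
qed

locale bounded_open_set =
  fixes \<Omega> :: "(real^'d) set"
  assumes open_\<Omega>: "open \<Omega>" and bounded_\<Omega>: "bounded \<Omega>"
begin

lemma sets_\<Omega>: "\<Omega> \<in> sets lebesgue"
  using open_\<Omega> by simp

lemma finite_measure_\<Omega>: "finite_measure (lebesgue_on \<Omega>)"
  using open_\<Omega> bounded_\<Omega> by (intro finite_measure_lebesgue_on lmeasurable_open)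

lemma continuous_L2_fun:
  assumes "continuous_on UNIV g"
  shows "L2_fun \<Omega> g"
proof -
  have g: "continuous_on (closure \<Omega>) g" "continuous_on \<Omega> g" using assms continuous_on_subset by auto
  have m: "g \<in> borel_measurable (lebesgue_on \<Omega>)"
    using g sets_\<Omega> by (intro continuous_imp_measurable_on_sets_lebesgue)
  have "compact (g ` closure \<Omega>)" using g bounded_\<Omega> by (intro compact_continuous_image) auto
  then obtain B where "\<forall>y \<in> g ` closure \<Omega>. norm y \<le> B"
    using compact_imp_bounded bounded_iff by metis
  then have B: "\<And>x. x \<in> \<Omega> \<Longrightarrow> norm (g x) \<le> B" using closure_subset[of \<Omega>] by blast
  have "integrable (lebesgue_on \<Omega>) (\<lambda>x. (norm (g x))\<^sup>2)"
    using m B by (intro finite_measure.integrable_const_bound[OF finite_measure_\<Omega>, where B = "B\<^sup>2"]) (auto intro!: AE_I2 power_mono)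
  then show ?thesis using m by (simp add: L2_fun_def)
qed

lemma test_fun_L2:
  assumes "test_fun \<Omega> \<phi>"
  shows "L2_fun \<Omega> \<phi>" "L2_fun \<Omega> (pderivative k \<phi>)" "L2_fun \<Omega> (classical_gradient \<phi>)"
proof -
  have s: "smooth_fun \<phi>" using assms by (simp add: test_fun_def)
  have c: "continuous_on UNIV \<phi>" "\<And>k. continuous_on UNIV (pderivative k \<phi>)"
    using smooth_fun_iterated[OF s, of "[]"] smooth_fun_iterated[OF s, of "[_]"]
    by (auto intro: differentiable_imp_continuous_on)
  then show "L2_fun \<Omega> \<phi>" "L2_fun \<Omega> (pderivative k \<phi>)" by (auto intro: continuous_L2_fun)
  have "continuous_on UNIV (classical_gradient \<phi>)"
    unfolding classical_gradient_def by (intro continuous_on_vec_lambda c)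
  then show "L2_fun \<Omega> (classical_gradient \<phi>)" by (rule continuous_L2_fun)
qed

lemma weak_gradient_diff:
  assumes "weak_gradient \<Omega> w G" "weak_gradient \<Omega> v H"
  shows "weak_gradient \<Omega> (\<lambda>x. w x - v x) (\<lambda>x. G x - H x)"
  unfolding weak_gradient_def
proof (intro conjI allI impI)
  have L: "L2_fun \<Omega> w" "L2_fun \<Omega> v" "L2_fun \<Omega> G" "L2_fun \<Omega> H"
    using assms by (auto simp: weak_gradient_def)
  then show "L2_fun \<Omega> (\<lambda>x. w x - v x)" "L2_fun \<Omega> (\<lambda>x. G x - H x)" by (auto intro: L2_fun_diff)
  fix \<phi> k assume \<phi>: "test_fun \<Omega> \<phi>"
  note t = test_fun_L2[OF \<phi>]
  have "L2_inner \<Omega> (\<lambda>x. w x - v x) (pderivative k \<phi>) = - L2_inner \<Omega> (\<lambda>x. G x $ k - H x $ k) \<phi>"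
    using assms \<phi> L t L2_fun_component[of \<Omega> G k] L2_fun_component[of \<Omega> H k]
    by (simp add: L2_inner_diff) (simp add: L2_inner_def weak_gradient_def)
  then show "(LINT x|lebesgue_on \<Omega>. (w x - v x) * pderivative k \<phi> x) = - (LINT x|lebesgue_on \<Omega>. (G x - H x) $ k * \<phi> x)"
    by (simp add: L2_inner_def)
qed

text \<open>Makes the error a legitimate test function in both weak formulations. It is approximated
  by the differences of the approximating test functions.\<close>

lemma H1_0_diff:
  assumes "w \<in> H1_0 \<Omega>" "v \<in> H1_0 \<Omega>"
  shows "(\<lambda>x. w x - v x) \<in> H1_0 \<Omega>"
proof -
  obtain G \<phi> where w: "weak_gradient \<Omega> w G" "\<And>n. test_fun \<Omega> (\<phi> n)"
    "(\<lambda>n. L2_norm \<Omega> (\<lambda>x. \<phi> n x - w x)) \<longlonglongrightarrow> 0"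
    "(\<lambda>n. L2_norm \<Omega> (\<lambda>x. classical_gradient (\<phi> n) x - G x)) \<longlonglongrightarrow> 0"
    using assms(1) unfolding H1_0_def by blast
  obtain H \<psi> where v: "weak_gradient \<Omega> v H" "\<And>n. test_fun \<Omega> (\<psi> n)"
    "(\<lambda>n. L2_norm \<Omega> (\<lambda>x. \<psi> n x - v x)) \<longlonglongrightarrow> 0"
    "(\<lambda>n. L2_norm \<Omega> (\<lambda>x. classical_gradient (\<psi> n) x - H x)) \<longlonglongrightarrow> 0"
    using assms(2) unfolding H1_0_def by blast
  have L: "L2_fun \<Omega> w" "L2_fun \<Omega> v" "L2_fun \<Omega> G" "L2_fun \<Omega> H"
    using w(1) v(1) by (auto simp: weak_gradient_def)
  have squeeze: "a \<longlonglongrightarrow> 0" if "b \<longlonglongrightarrow> 0" "c \<longlonglongrightarrow> 0" "\<And>n. 0 \<le> a n" "\<And>n. a n \<le> b n + c n" for a b c :: "nat \<Rightarrow> real"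
    by (rule tendsto_sandwich[of "\<lambda>_. 0" a _ "\<lambda>n. b n + c n"])
      (use that tendsto_add[OF that(1,2)] in auto)
  have "(\<lambda>n. L2_norm \<Omega> (\<lambda>x. (\<phi> n x - \<psi> n x) - (w x - v x))) \<longlonglongrightarrow> 0"
  proof (rule squeeze[OF w(3) v(3)])
    fix n
    show "L2_norm \<Omega> (\<lambda>x. (\<phi> n x - \<psi> n x) - (w x - v x)) \<le> L2_norm \<Omega> (\<lambda>x. \<phi> n x - w x) + L2_norm \<Omega> (\<lambda>x. \<psi> n x - v x)"
      using L2_norm_diff_le[OF L2_fun_diff[OF test_fun_L2(1)[OF w(2)[of n]] L(1)] L2_fun_diff[OF test_fun_L2(1)[OF v(2)[of n]] L(2)]]
      by (simp add: algebra_simps)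
  qed (rule L2_norm_nonneg)
  moreover have "(\<lambda>n. L2_norm \<Omega> (\<lambda>x. classical_gradient (\<lambda>x. \<phi> n x - \<psi> n x) x - (G x - H x))) \<longlonglongrightarrow> 0"
  proof (rule squeeze[OF w(4) v(4)])
    fix n
    have "smooth_fun (\<phi> n)" "smooth_fun (\<psi> n)" using w(2) v(2) by (auto simp: test_fun_def)
    then have "\<phi> n differentiable_on UNIV" "\<psi> n differentiable_on UNIV"
      using smooth_fun_iterated[of _ "[]"] by auto
    then have "classical_gradient (\<lambda>x. \<phi> n x - \<psi> n x) = (\<lambda>x. classical_gradient (\<phi> n) x - classical_gradient (\<psi> n) x)"
      by (auto simp: classical_gradient_def vec_eq_iff pderivative_diff)
    then show "L2_norm \<Omega> (\<lambda>x. classical_gradient (\<lambda>x. \<phi> n x - \<psi> n x) x - (G x - H x))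
      \<le> L2_norm \<Omega> (\<lambda>x. classical_gradient (\<phi> n) x - G x) + L2_norm \<Omega> (\<lambda>x. classical_gradient (\<psi> n) x - H x)"
      using L2_norm_diff_le[OF L2_fun_diff[OF test_fun_L2(3)[OF w(2)[of n]] L(3)] L2_fun_diff[OF test_fun_L2(3)[OF v(2)[of n]] L(4)]]
      by (simp add: algebra_simps)
  qed (rule L2_norm_nonneg)
  ultimately show ?thesis
    unfolding H1_0_def using weak_gradient_diff[OF w(1) v(1)] test_fun_diff[OF w(2) v(2)]
    by (intro CollectI exI[of _ "\<lambda>x. G x - H x"] exI[of _ "\<lambda>n x. \<phi> n x - \<psi> n x"] conjI allI) auto
qed

end

section \<open>Energy inequality\<close>

text \<open>Write A G - A' G' = A' (G - G') + (A - A') G, so that the Lipschitz difference meets the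
  bounded gradient G of the exact solution. With H = G - G' this leaves ca |H|^2 - N |e| |H|, and
  completing the square bounds it below by -N^2 e^2 / (4 ca), the origin of the constant in
  lam.\<close>

lemma quasilinear_monotone:
  fixes G G' :: "real^'d" and A A' B B' :: "'d \<Rightarrow> real" and e :: real
  assumes const: "0 < ca" "0 \<le> Ca" "0 \<le> Cb"
    and A: "\<And>k. ca \<le> A' k" "\<And>k. \<bar>A k - A' k\<bar> \<le> Ca * \<bar>e\<bar>"
    and B: "\<And>k. \<bar>B k - B' k\<bar> \<le> Cb * \<bar>e\<bar>" and G: "norm G \<le> Cu"
  shows "- ((Ca * Cu + Cb * sqrt (real CARD('d)))\<^sup>2 / (4 * ca)) * e\<^sup>2
    \<le> (\<Sum>k\<in>UNIV. ((A k * G $ k + B k) - (A' k * G' $ k + B' k)) * (G - G') $ k)"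
proof -
  define H where "H = G - G'"
  define N where "N = Ca * Cu + Cb * sqrt (real CARD('d))"
  have norm_L2: "norm x = L2_set (\<lambda>k. x $ k) UNIV" for x :: "real^'d"
    by (simp add: norm_vec_def L2_set_def)
  have GH: "(\<Sum>k\<in>UNIV. \<bar>G $ k\<bar> * \<bar>H $ k\<bar>) \<le> Cu * norm H"
    using L2_set_mult_ineq[of "\<lambda>k. G $ k" "\<lambda>k. H $ k" UNIV] mult_right_mono[OF G norm_ge_zero[of H]]
    by (simp add: norm_L2[symmetric])
  have H1: "(\<Sum>k\<in>UNIV. \<bar>H $ k\<bar>) \<le> sqrt (real CARD('d)) * norm H"
    using L2_set_mult_ineq[of "\<lambda>k. 1" "\<lambda>k. H $ k" UNIV]
    by (simp add: norm_L2[symmetric] L2_set_constant)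
  have HH: "(\<Sum>k\<in>UNIV. H $ k * H $ k) = (norm H)\<^sup>2"
    by (simp add: norm_L2 L2_set_def sum_nonneg power2_eq_square)
  have "ca * (norm H)\<^sup>2 - \<bar>e\<bar> * N * norm H \<le> (\<Sum>k\<in>UNIV. ca * (H $ k * H $ k)) -
      (Ca * \<bar>e\<bar> * (\<Sum>k\<in>UNIV. \<bar>G $ k\<bar> * \<bar>H $ k\<bar>) + Cb * \<bar>e\<bar> * (\<Sum>k\<in>UNIV. \<bar>H $ k\<bar>))"
  proof -
    have "Ca * \<bar>e\<bar> * (\<Sum>k\<in>UNIV. \<bar>G $ k\<bar> * \<bar>H $ k\<bar>) + Cb * \<bar>e\<bar> * (\<Sum>k\<in>UNIV. \<bar>H $ k\<bar>)
      \<le> Ca * \<bar>e\<bar> * (Cu * norm H) + Cb * \<bar>e\<bar> * (sqrt (real CARD('d)) * norm H)"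
      using GH H1 const by (intro add_mono mult_left_mono) auto
    then show ?thesis by (simp add: HH N_def algebra_simps flip: sum_distrib_left)
  qed
  also have "\<dots> = (\<Sum>k\<in>UNIV. ca * (H $ k * H $ k) - Ca * \<bar>e\<bar> * (\<bar>G $ k\<bar> * \<bar>H $ k\<bar>) - Cb * \<bar>e\<bar> * \<bar>H $ k\<bar>)"
    by (simp add: sum_subtractf sum_distrib_left)
  also have "\<dots> \<le> (\<Sum>k\<in>UNIV. ((A k * G $ k + B k) - (A' k * G' $ k + B' k)) * H $ k)"
  proof (rule sum_mono)
    fix k
    have "ca * (H $ k * H $ k) \<le> A' k * (H $ k * H $ k)" using A(1) by (intro mult_right_mono) auto
    moreover have "\<bar>(A k - A' k) * (G $ k * H $ k)\<bar> \<le> Ca * \<bar>e\<bar> * (\<bar>G $ k\<bar> * \<bar>H $ k\<bar>)"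
      unfolding abs_mult[of "A k - A' k"] abs_mult[of "G $ k"] using A(2) by (intro mult_right_mono) auto
    moreover have "\<bar>(B k - B' k) * H $ k\<bar> \<le> Cb * \<bar>e\<bar> * \<bar>H $ k\<bar>"
      unfolding abs_mult[of "B k - B' k"] using B by (intro mult_right_mono) auto
    moreover have "((A k * G $ k + B k) - (A' k * G' $ k + B' k)) * H $ k
      = A' k * (H $ k * H $ k) + (A k - A' k) * (G $ k * H $ k) + (B k - B' k) * H $ k"
      by (simp add: H_def algebra_simps)
    ultimately show "ca * (H $ k * H $ k) - Ca * \<bar>e\<bar> * (\<bar>G $ k\<bar> * \<bar>H $ k\<bar>) - Cb * \<bar>e\<bar> * \<bar>H $ k\<bar>
      \<le> ((A k * G $ k + B k) - (A' k * G' $ k + B' k)) * H $ k"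
      unfolding abs_le_iff by linarith
  qed
  finally have "ca * (norm H)\<^sup>2 - \<bar>e\<bar> * N * norm H \<le> (\<Sum>k\<in>UNIV. ((A k * G $ k + B k) - (A' k * G' $ k + B' k)) * H $ k)" .
  moreover have "- (N\<^sup>2 / (4 * ca)) * e\<^sup>2 \<le> ca * (norm H)\<^sup>2 - \<bar>e\<bar> * N * norm H"
  proof -
    have "0 \<le> ca * (norm H - \<bar>e\<bar> * N / (2 * ca))\<^sup>2" using const by simp
    also have "\<dots> = ca * (norm H)\<^sup>2 - \<bar>e\<bar> * N * norm H + N\<^sup>2 / (4 * ca) * e\<^sup>2"
      using const by (simp add: power2_diff power_divide power_mult_distrib power2_eq_square field_simps)
    finally show ?thesis by simp
  qed
  ultimately show ?thesis by (simp add: H_def N_def)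
qed

context bounded_open_set begin

text \<open>Both weak formulations are tested with the error and subtracted. Here g and g' stand for
  the Caputo derivative and the L1 operator, so nothing about time enters yet.\<close>

lemma weak_elliptic_difference:
  fixes a b :: "'d \<Rightarrow> real^'d \<Rightarrow> real \<Rightarrow> real \<Rightarrow> real"
  assumes const: "0 < ca" "0 \<le> Ca" "0 \<le> Cb"
    and a: "\<And>k x v. x \<in> \<Omega> \<Longrightarrow> ca \<le> a k x s v"
      "\<And>k x v w. x \<in> \<Omega> \<Longrightarrow> \<bar>a k x s v - a k x s w\<bar> \<le> Ca * \<bar>v - w\<bar>"
    and b: "\<And>k x v w. x \<in> \<Omega> \<Longrightarrow> \<bar>b k x s v - b k x s w\<bar> \<le> Cb * \<bar>v - w\<bar>"
    and f: "\<And>x v w. x \<in> \<Omega> \<Longrightarrow> v \<ge> w \<Longrightarrow> f x s v - f x s w \<ge> - lam0 * (v - w)"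
    and u: "weak_elliptic \<Omega> a b f s g u" and U: "weak_elliptic \<Omega> a b f s g' U"
    and G: "weak_gradient \<Omega> u G" "Linf_norm \<Omega> G \<le> ereal Cu"
  defines "e \<equiv> \<lambda>x. u x - U x"
  shows "L2_inner \<Omega> g e - L2_inner \<Omega> g' e
    \<le> (lam0 + (Ca * Cu + Cb * sqrt (real CARD('d)))\<^sup>2 / (4 * ca)) * (L2_norm \<Omega> e)\<^sup>2"
proof -
  obtain G' where G': "weak_gradient \<Omega> U G'" using U unfolding weak_elliptic_def H1_0_def by blast
  have e: "e \<in> H1_0 \<Omega>" unfolding e_def using u U by (intro H1_0_diff) (auto simp: weak_elliptic_def)
  have H: "weak_gradient \<Omega> e (\<lambda>x. G x - G' x)" unfolding e_def by (rule weak_gradient_diff[OF G(1) G'])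
  define q where "q = (Ca * Cu + Cb * sqrt (real CARD('d)))\<^sup>2 / (4 * ca)"
  define Q where "Q x = (\<Sum>k\<in>UNIV. (a k x s (u x) * G x $ k + b k x s (u x)) * (G x - G' x) $ k)" for x
  define Q' where "Q' x = (\<Sum>k\<in>UNIV. (a k x s (U x) * G' x $ k + b k x s (U x)) * (G x - G' x) $ k)" for x
  have I: "integrable (lebesgue_on \<Omega>) Q" "integrable (lebesgue_on \<Omega>) (\<lambda>x. f x s (u x) * e x)"
    "L2_inner \<Omega> g e + (LINT x|lebesgue_on \<Omega>. Q x) + (LINT x|lebesgue_on \<Omega>. f x s (u x) * e x) = 0"
    using u e G(1) H unfolding weak_elliptic_def L2_inner_def Q_def[abs_def] by blast+
  have I': "integrable (lebesgue_on \<Omega>) Q'" "integrable (lebesgue_on \<Omega>) (\<lambda>x. f x s (U x) * e x)"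
    "L2_inner \<Omega> g' e + (LINT x|lebesgue_on \<Omega>. Q' x) + (LINT x|lebesgue_on \<Omega>. f x s (U x) * e x) = 0"
    using U e G' H unfolding weak_elliptic_def L2_inner_def Q'_def[abs_def] by blast+
  have e2: "integrable (lebesgue_on \<Omega>) (\<lambda>x. (e x)\<^sup>2)"
    using H by (auto simp: weak_gradient_def L2_fun_def)
  have "AE x in lebesgue_on \<Omega>. ereal (norm (G x)) \<le> Linf_norm \<Omega> G"
    unfolding Linf_norm_def by (rule esssup_AE)
  then have GC: "AE x in lebesgue_on \<Omega>. norm (G x) \<le> Cu"
  proof eventually_elim
    case (elim x)
    then have "ereal (norm (G x)) \<le> ereal Cu" using G(2) by (rule order_trans)
    then show ?case by simp
  qed
  have "(LINT x|lebesgue_on \<Omega>. - (lam0 + q) * (e x)\<^sup>2)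
      \<le> (LINT x|lebesgue_on \<Omega>. (Q x - Q' x) + (f x s (u x) * e x - f x s (U x) * e x))"
  proof (rule integral_mono_AE)
    show "AE x in lebesgue_on \<Omega>. - (lam0 + q) * (e x)\<^sup>2 \<le> (Q x - Q' x) + (f x s (u x) * e x - f x s (U x) * e x)"
      using GC AE_space
    proof eventually_elim
      case (elim x)
      then have x: "x \<in> \<Omega>" by simp
      have "- q * (e x)\<^sup>2 \<le> (\<Sum>k\<in>UNIV. ((a k x s (u x) * G x $ k + b k x s (u x)) -
          (a k x s (U x) * G' x $ k + b k x s (U x))) * (G x - G' x) $ k)"
        unfolding q_def using const a[OF x] b[OF x] elim(1)
        by (intro quasilinear_monotone) (auto simp: e_def)
      also have "\<dots> = Q x - Q' x" by (simp add: Q_def Q'_def sum_subtractf left_diff_distrib)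
      finally have 1: "- q * (e x)\<^sup>2 \<le> Q x - Q' x" .
      have "- lam0 * (e x)\<^sup>2 \<le> (f x s (u x) - f x s (U x)) * e x"
      proof (cases "U x \<le> u x")
        case True
        then have "- lam0 * (u x - U x) * e x \<le> (f x s (u x) - f x s (U x)) * e x"
          using f[OF x True] by (intro mult_right_mono) (auto simp: e_def)
        then show ?thesis by (simp add: e_def power2_eq_square)
      next
        case False
        \<comment> \<open>Where U exceeds u, the one-sided condition is used with the roles
          exchanged and multiplied by the positive number \<open>- e x\<close>.\<close>
        then have "- lam0 * (U x - u x) * (- e x) \<le> (f x s (U x) - f x s (u x)) * (- e x)"
          using f[OF x, of "u x" "U x"] by (intro mult_right_mono) (auto simp: e_def)
        then show ?thesis by (simp add: e_def power2_eq_square algebra_simps)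
      qed
      with 1 show ?case by (simp add: algebra_simps)
    qed
  qed (use I I' e2 in auto)
  also have "\<dots> = ((LINT x|lebesgue_on \<Omega>. Q x) - (LINT x|lebesgue_on \<Omega>. Q' x)) +
      ((LINT x|lebesgue_on \<Omega>. f x s (u x) * e x) - (LINT x|lebesgue_on \<Omega>. f x s (U x) * e x))"
    using I I' by simp
  also have "\<dots> = L2_inner \<Omega> g' e - L2_inner \<Omega> g e" using I(3) I'(3) by linarith
  finally have "- (lam0 + q) * (LINT x|lebesgue_on \<Omega>. (e x)\<^sup>2) \<le> L2_inner \<Omega> g' e - L2_inner \<Omega> g e"
    by simp
  moreover have "(LINT x|lebesgue_on \<Omega>. (e x)\<^sup>2) = (L2_norm \<Omega> e)\<^sup>2"
    unfolding L2_norm_power2 L2_inner_def by (simp add: power2_eq_square)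
  ultimately show ?thesis by (simp add: q_def algebra_simps)
qed

end

text \<open>By Cauchy-Schwarz, pairing with a fixed e is continuous in L2, so convergence of the
  difference quotients carries over to real functions.\<close>

lemma L2_time_derivative_inner:
  assumes v: "L2_time_derivative \<Omega> T v w" and e: "L2_fun \<Omega> e" and s: "s \<in> {0<..T}"
  shows "((\<lambda>s. L2_inner \<Omega> (v s) e) has_real_derivative L2_inner \<Omega> (w s) e) (at s within {0<..T})"
proof -
  have L: "L2_fun \<Omega> (v x)" "L2_fun \<Omega> (w x)" if "x \<in> {0<..T}" for x
    using v that by (auto simp: L2_time_derivative_def)
  let ?q = "\<lambda>y. L2_norm \<Omega> (\<lambda>x. (v y x - v s x) / (y - s) - w s x)"
  have lim: "(?q \<longlongrightarrow> 0) (at s within {0<..T})"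
    using v s by (auto simp: L2_time_derivative_def)
  have "((\<lambda>y. (L2_inner \<Omega> (v y) e - L2_inner \<Omega> (v s) e) / (y - s) - L2_inner \<Omega> (w s) e) \<longlongrightarrow> 0) (at s within {0<..T})"
  proof (rule Lim_null_comparison)
    show "((\<lambda>y. ?q y * L2_norm \<Omega> e) \<longlongrightarrow> 0) (at s within {0<..T})"
      using tendsto_mult_right[OF lim, of "L2_norm \<Omega> e"] by simp
    show "\<forall>\<^sub>F y in at s within {0<..T}. norm ((L2_inner \<Omega> (v y) e - L2_inner \<Omega> (v s) e) / (y - s) - L2_inner \<Omega> (w s) e) \<le> ?q y * L2_norm \<Omega> e"
      unfolding eventually_at_filter
    proof (intro always_eventually allI impI)
      fix y assume "y \<noteq> s" and y: "y \<in> {0<..T}"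
      have d: "L2_fun \<Omega> (\<lambda>x. (v y x - v s x) / (y - s))" using L y s by (intro L2_fun_divide L2_fun_diff) auto
      have "(L2_inner \<Omega> (v y) e - L2_inner \<Omega> (v s) e) / (y - s) - L2_inner \<Omega> (w s) e
        = L2_inner \<Omega> (\<lambda>x. (v y x - v s x) / (y - s) - w s x) e"
        using L[OF y] L[OF s] e d by (simp add: L2_inner_diff L2_inner_divide)
      then show "norm ((L2_inner \<Omega> (v y) e - L2_inner \<Omega> (v s) e) / (y - s) - L2_inner \<Omega> (w s) e) \<le> ?q y * L2_norm \<Omega> e"
        using L2_Cauchy_Schwarz[OF L2_fun_diff[OF d L(2)[OF s]] e] by simp
    qed
  qed
  then show ?thesis unfolding has_field_derivative_iff by (subst LIM_zero_iff[symmetric])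
qed

lemma L2_continuous_inner:
  assumes v: "L2_continuous \<Omega> T v" and e: "L2_fun \<Omega> e"
  shows "continuous_on {0..T} (\<lambda>s. L2_inner \<Omega> (v s) e)"
  unfolding continuous_on_def
proof
  fix s assume s: "s \<in> {0..T}"
  have L: "L2_fun \<Omega> (v x)" if "x \<in> {0..T}" for x using v that by (auto simp: L2_continuous_def)
  have lim: "((\<lambda>y. L2_norm \<Omega> (\<lambda>x. v y x - v s x)) \<longlongrightarrow> 0) (at s within {0..T})"
    using v s by (auto simp: L2_continuous_def)
  have "((\<lambda>y. L2_inner \<Omega> (v y) e - L2_inner \<Omega> (v s) e) \<longlongrightarrow> 0) (at s within {0..T})"
  proof (rule Lim_null_comparison)
    show "((\<lambda>y. L2_norm \<Omega> (\<lambda>x. v y x - v s x) * L2_norm \<Omega> e) \<longlongrightarrow> 0) (at s within {0..T})"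
      using tendsto_mult_right[OF lim, of "L2_norm \<Omega> e"] by simp
    show "\<forall>\<^sub>F y in at s within {0..T}. norm (L2_inner \<Omega> (v y) e - L2_inner \<Omega> (v s) e) \<le> L2_norm \<Omega> (\<lambda>x. v y x - v s x) * L2_norm \<Omega> e"
      unfolding eventually_at_filter
    proof (intro always_eventually allI impI)
      fix y assume "y \<noteq> s" and y: "y \<in> {0..T}"
      show "norm (L2_inner \<Omega> (v y) e - L2_inner \<Omega> (v s) e) \<le> L2_norm \<Omega> (\<lambda>x. v y x - v s x) * L2_norm \<Omega> e"
        using L2_Cauchy_Schwarz[OF L2_fun_diff[OF L[OF y] L[OF s]] e] L2_inner_diff[OF L[OF y] L[OF s] e] by simp
    qed
  qed
  then show "((\<lambda>s. L2_inner \<Omega> (v s) e) \<longlongrightarrow> L2_inner \<Omega> (v s) e) (at s within {0..T})"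
    by (subst LIM_zero_iff[symmetric])
qed

text \<open>Needed because \<open>caputo\<close> integrates over [0, t], while measurability of the
  time derivative is available on (0, T].\<close>

lemma integral_lebesgue_on_Icc_Ioc:
  fixes f :: "real \<Rightarrow> real"
  assumes "a \<le> b"
  shows "integrable (lebesgue_on {a..b}) f \<longleftrightarrow> integrable (lebesgue_on {a<..b}) f"
    and "(LINT s|lebesgue_on {a..b}. f s) = (LINT s|lebesgue_on {a<..b}. f s)"
proof -
  let ?F = "\<lambda>s. indicator {a..b} s *\<^sub>R f s" and ?G = "\<lambda>s. indicator {a<..b} s *\<^sub>R f s"
  let ?p = "\<lambda>s. indicator {a} s *\<^sub>R f a"
  have F: "?F = (\<lambda>s. ?G s + ?p s)" and G: "?G = (\<lambda>s. ?F s - ?p s)"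
    using assms by (auto simp: fun_eq_iff indicator_def)
  have p: "integrable lebesgue ?p" "integral\<^sup>L lebesgue ?p = 0" by auto
  have iff: "integrable lebesgue ?F \<longleftrightarrow> integrable lebesgue ?G"
    using p(1) Bochner_Integration.integrable_add[of lebesgue ?G ?p] Bochner_Integration.integrable_diff[of lebesgue ?F ?p]
    unfolding F[symmetric] G[symmetric] by blast
  show "integrable (lebesgue_on {a..b}) f \<longleftrightarrow> integrable (lebesgue_on {a<..b}) f"
    using iff by (simp add: integrable_restrict_space)
  have eq: "integral\<^sup>L lebesgue ?F = integral\<^sup>L lebesgue ?G"
  proof (cases "integrable lebesgue ?G")
    case True
    from Bochner_Integration.integral_add[OF this p(1)] show ?thesis
      unfolding F[symmetric] p(2) by (simp only: add_0_right)
  next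
    case False
    \<comment> \<open>Without integrability both integrals have the default value 0.\<close>
    then show ?thesis using iff by (simp add: not_integrable_integral_eq)
  qed
  have r: "(LINT s|lebesgue_on A. f s) = (LINT s|lebesgue. indicator A s *\<^sub>R f s)" if "A \<in> sets lebesgue" for A
    by (rule integral_restrict_space) (use that in auto)
  have "{a..b} \<in> sets lebesgue" "{a<..b} \<in> sets lebesgue" by auto
  then show "(LINT s|lebesgue_on {a..b}. f s) = (LINT s|lebesgue_on {a<..b}. f s)"
    by (simp only: r eq)
qed

text \<open>Fubini's theorem: the inner product in space passes under the integral in time. Absolute
  integrability on the product follows from Cauchy-Schwarz in space and the assumed integrability of
  the kernel times \<open>L2_norm \<Omega> (u' s)\<close>.\<close>

lemma (in bounded_open_set) caputo_inner:
  fixes u' :: "real \<Rightarrow> real^'d \<Rightarrow> real"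
  assumes meas: "(\<lambda>(s, x). u' s x) \<in> borel_measurable (lebesgue_on {0<..T} \<Otimes>\<^sub>M lebesgue_on \<Omega>)"
    and t: "t \<in> {0<..T}" and L: "\<And>s. s \<in> {0<..T} \<Longrightarrow> L2_fun \<Omega> (u' s)" and e: "L2_fun \<Omega> e"
    and int: "integrable (lebesgue_on {0..t}) (\<lambda>s. (t - s) powr (-\<alpha>) * L2_norm \<Omega> (u' s))"
  shows "integrable (lebesgue_on {0..t}) (\<lambda>s. (t - s) powr (-\<alpha>) * L2_inner \<Omega> (u' s) e)"
    and "L2_inner \<Omega> (caputo \<alpha> u' t) e =
      1 / Gamma (1 - \<alpha>) * (LINT s|lebesgue_on {0..t}. (t - s) powr (-\<alpha>) * L2_inner \<Omega> (u' s) e)"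
proof -
  let ?A = "lebesgue_on {0<..t}" and ?S = "lebesgue_on \<Omega>"
  define h where "h s x = (t - s) powr (-\<alpha>) * (u' s x * e x)" for s x
  have "bounded {0<..t}" by (rule bounded_subset[of "{0..t}"]) auto
  then have "{0<..t} \<in> lmeasurable" by (rule bounded_set_imp_lmeasurable) simp
  then have A: "sigma_finite_measure ?A"
    using finite_measure_lebesgue_on finite_measure.axioms(1) by blast
  have S: "sigma_finite_measure ?S"
    using finite_measure_\<Omega> finite_measure.axioms(1) by blast
  have P: "pair_sigma_finite ?A ?S" using A S by (rule pair_sigma_finite.intro)
  have id_meas: "(\<lambda>s. s) \<in> ?A \<rightarrow>\<^sub>M lebesgue_on {0<..T}"
    by (rule measurable_restrict_mono[of _ lebesgue "{0<..T}"]) (use t in \<open>auto intro: measurable_ident\<close>)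
  have u_meas: "(\<lambda>z. u' (fst z) (snd z)) \<in> borel_measurable (?A \<Otimes>\<^sub>M ?S)"
  proof -
    have "(\<lambda>z. (fst z, snd z)) \<in> ?A \<Otimes>\<^sub>M ?S \<rightarrow>\<^sub>M lebesgue_on {0<..T} \<Otimes>\<^sub>M ?S"
      using measurable_compose[OF measurable_fst id_meas] by (intro measurable_Pair) auto
    from measurable_compose[OF this meas] show ?thesis by simp
  qed
  have s_meas: "(\<lambda>s. (t - s) powr (-\<alpha>)) \<in> borel_measurable ?A"
    using id_borel_measurable_lebesgue_on[of "{0<..t}"] by (auto simp: id_def)
  have e_meas: "e \<in> borel_measurable ?S" using e by (rule L2_fun_measurable)
  have h_meas: "(\<lambda>(s, x). h s x) \<in> borel_measurable (?A \<Otimes>\<^sub>M ?S)"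
    unfolding h_def split_beta'
    using u_meas measurable_compose[OF measurable_fst s_meas] measurable_compose[OF measurable_snd e_meas]
    by (intro borel_measurable_times) auto
  have sec: "integrable ?S (h s)" "(LINT x|?S. norm (h s x)) \<le> (t - s) powr (-\<alpha>) * L2_norm \<Omega> (u' s) * L2_norm \<Omega> e"
    if "s \<in> {0<..t}" for s
  proof -
    have s: "s \<in> {0<..T}" using that t by auto
    show "integrable ?S (h s)"
      unfolding h_def[abs_def] by (intro integrable_mult_right L2_mult_integrable L e s)
    have "(LINT x|?S. norm (h s x)) = (t - s) powr (-\<alpha>) * L2_inner \<Omega> (\<lambda>x. norm (u' s x)) (\<lambda>x. norm (e x))"
      by (simp add: h_def abs_mult L2_inner_def)
    also have "\<dots> \<le> (t - s) powr (-\<alpha>) * (L2_norm \<Omega> (u' s) * L2_norm \<Omega> e)"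
      using abs_le_D1[OF L2_Cauchy_Schwarz[OF L2_fun_norm[OF L[OF s]] L2_fun_norm[OF e]], unfolded L2_norm_norm]
      by (intro mult_left_mono) auto
    finally show "(LINT x|?S. norm (h s x)) \<le> (t - s) powr (-\<alpha>) * L2_norm \<Omega> (u' s) * L2_norm \<Omega> e" by simp
  qed
  have hint: "integrable (?A \<Otimes>\<^sub>M ?S) (\<lambda>(s, x). h s x)"
  proof (rule pair_sigma_finite.Fubini_integrable[OF P h_meas])
    show "integrable ?A (\<lambda>s. LINT x|?S. norm (case (s, x) of (s, x) \<Rightarrow> h s x))"
    proof (rule Bochner_Integration.integrable_bound)
      show "integrable ?A (\<lambda>s. (t - s) powr (-\<alpha>) * L2_norm \<Omega> (u' s) * L2_norm \<Omega> e)"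
        using int t by (intro integrable_mult_left) (simp add: integral_lebesgue_on_Icc_Ioc(1))
      show "(\<lambda>s. LINT x|?S. norm (case (s, x) of (s, x) \<Rightarrow> h s x)) \<in> borel_measurable ?A"
        using h_meas by (intro sigma_finite_measure.borel_measurable_lebesgue_integral[OF S]) (auto simp: split_beta')
      show "AE s in ?A. norm (LINT x|?S. norm (case (s, x) of (s, x) \<Rightarrow> h s x)) \<le> norm ((t - s) powr (-\<alpha>) * L2_norm \<Omega> (u' s) * L2_norm \<Omega> e)"
        using sec(2) by (intro AE_I2) (auto simp: L2_norm_nonneg abs_of_nonneg)
    qed
    show "AE s in ?A. integrable ?S (\<lambda>x. case (s, x) of (s, x) \<Rightarrow> h s x)"
      using sec(1) by (intro AE_I2) auto
  qed
  have inner: "(LINT x|?S. h s x) = (t - s) powr (-\<alpha>) * L2_inner \<Omega> (u' s) e" for s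
    by (simp add: h_def L2_inner_def)
  have "integrable ?A (\<lambda>s. LINT x|?S. h s x)"
    using pair_sigma_finite.integrable_fst[OF P hint] by simp
  then show "integrable (lebesgue_on {0..t}) (\<lambda>s. (t - s) powr (-\<alpha>) * L2_inner \<Omega> (u' s) e)"
    using t by (simp add: inner integral_lebesgue_on_Icc_Ioc(1))
  have "caputo \<alpha> u' t x * e x = 1 / Gamma (1 - \<alpha>) * (LINT s|?A. h s x)" for x
  proof -
    have "caputo \<alpha> u' t x * e x = 1 / Gamma (1 - \<alpha>) * ((LINT s|?A. (t - s) powr (-\<alpha>) * u' s x) * e x)"
      using t by (simp add: caputo_def integral_lebesgue_on_Icc_Ioc(2))
    also have "(LINT s|?A. (t - s) powr (-\<alpha>) * u' s x) * e x = (LINT s|?A. (t - s) powr (-\<alpha>) * u' s x * e x)"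
      by simp
    finally show ?thesis by (simp add: h_def mult.assoc)
  qed
  then have "L2_inner \<Omega> (caputo \<alpha> u' t) e = 1 / Gamma (1 - \<alpha>) * (LINT x|?S. LINT s|?A. h s x)"
    by (simp add: L2_inner_def)
  also have "(LINT x|?S. LINT s|?A. h s x) = (LINT s|?A. LINT x|?S. h s x)"
    using pair_sigma_finite.Fubini_integral[OF P hint] by simp
  finally show "L2_inner \<Omega> (caputo \<alpha> u' t) e =
      1 / Gamma (1 - \<alpha>) * (LINT s|lebesgue_on {0..t}. (t - s) powr (-\<alpha>) * L2_inner \<Omega> (u' s) e)"
    using t by (simp add: inner integral_lebesgue_on_Icc_Ioc(2))
qed

section \<open>The L1 operator paired with L2 functions\<close>

lemma kernel_lebesgue_integral:
  fixes a b c \<alpha> :: real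
  assumes "a \<le> b" "b \<le> c" "\<alpha> < 1"
  shows "(LINT s|lebesgue_on {a..b}. (c - s) powr (-\<alpha>)) = ((c - a) powr (1 - \<alpha>) - (c - b) powr (1 - \<alpha>)) / (1 - \<alpha>)"
proof -
  note k = kernel_has_integral[OF assms]
  have "(\<lambda>s. (c - s) powr (-\<alpha>)) absolutely_integrable_on {a..b}"
    using k by (intro nonnegative_absolutely_integrable_1) auto
  then have "integrable (lebesgue_on {a..b}) (\<lambda>s. (c - s) powr (-\<alpha>))"
    by (simp add: set_integrable_def integrable_restrict_space)
  then have "(LINT s|lebesgue_on {a..b}. (c - s) powr (-\<alpha>)) = integral {a..b} (\<lambda>s. (c - s) powr (-\<alpha>))"
    by (rule lebesgue_integral_eq_integral) simp
  then show ?thesis using k by (simp add: has_integral_iff)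
qed

lemma Gamma_2_minus: "\<alpha> < 1 \<Longrightarrow> Gamma (2 - \<alpha>) = (1 - \<alpha>) * Gamma (1 - \<alpha> :: real)"
  using Gamma_plus1[of "1 - \<alpha>"] nonpos_Ints_nonpos[of "1 - \<alpha>"] by auto

context mesh begin

lemma L1_operator_eq:
  assumes "m \<in> {1..M}"
  shows "L1_operator \<alpha> t U m x = 1 / Gamma (2 - \<alpha>) * (\<Sum>j=1..m. (U j x - U (j - 1) x) * wt \<alpha> t m j)"
proof -
  have G: "1 / Gamma (2 - \<alpha>) = 1 / Gamma (1 - \<alpha>) * (1 / (1 - \<alpha>))"
    using \<alpha> by (simp add: Gamma_2_minus)
  have "(U j x - U (j - 1) x) / (t j - t (j - 1)) * (LINT s|lebesgue_on {t (j - 1)..t j}. (t m - s) powr (-\<alpha>))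
     = 1 / (1 - \<alpha>) * ((U j x - U (j - 1) x) * wt \<alpha> t m j)" if "j \<in> {1..m}" for j
    using that assms \<alpha> t_pred[of j] t_le[of j m] by (simp add: kernel_lebesgue_integral wt_def)
  then show ?thesis
    unfolding L1_operator_def G mult.assoc[of "1 / Gamma (1 - \<alpha>)"] by (simp add: sum_distrib_left)
qed

lemma L2_inner_L1_operator:
  assumes "m \<in> {1..M}" and U: "\<And>j. j \<le> m \<Longrightarrow> L2_fun \<Omega> (U j)" and h: "L2_fun \<Omega> h"
  shows "L2_fun \<Omega> (L1_operator \<alpha> t U m)"
    and "L2_inner \<Omega> (L1_operator \<alpha> t U m) h = 1 / Gamma (2 - \<alpha>) * L1_sum \<alpha> t (\<lambda>j. L2_inner \<Omega> (U j) h) m"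
proof -
  let ?f = "\<lambda>j x. wt \<alpha> t m j * (U j x - U (j - 1) x)"
  have f: "L2_fun \<Omega> (?f j)" if "j \<in> {1..m}" for j
    using that by (intro L2_fun_cmult L2_fun_diff U) auto
  have eq: "L1_operator \<alpha> t U m = (\<lambda>x. 1 / Gamma (2 - \<alpha>) * (\<Sum>j\<in>{1..m}. ?f j x))"
    unfolding L1_operator_eq[OF assms(1), abs_def] by (simp add: mult.commute)
  show "L2_fun \<Omega> (L1_operator \<alpha> t U m)"
    unfolding eq by (intro L2_fun_cmult L2_fun_sum f)
  have "L2_inner \<Omega> (\<lambda>x. \<Sum>j\<in>{1..m}. ?f j x) h = (\<Sum>j\<in>{1..m}. L2_inner \<Omega> (?f j) h)"
    using f h by (rule L2_inner_sum)
  also have "\<dots> = L1_sum \<alpha> t (\<lambda>j. L2_inner \<Omega> (U j) h) m"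
    unfolding L1_sum_def
  proof (rule sum.cong)
    fix j assume j: "j \<in> {1..m}"
    then have "L2_fun \<Omega> (U j)" "L2_fun \<Omega> (U (j - 1))" using U by auto
    then show "L2_inner \<Omega> (?f j) h = (L2_inner \<Omega> (U j) h - L2_inner \<Omega> (U (j - 1)) h) * wt \<alpha> t m j"
      using h by (simp add: L2_inner_cmult L2_inner_diff mult.commute)
  qed simp
  finally show "L2_inner \<Omega> (L1_operator \<alpha> t U m) h = 1 / Gamma (2 - \<alpha>) * L1_sum \<alpha> t (\<lambda>j. L2_inner \<Omega> (U j) h) m"
    unfolding eq L2_inner_cmult by simp
qed

text \<open>In the form of \<open>L1_sum_Abel\<close> earlier values have nonpositive coefficients,
  so replacing their inner products with \<open>e m\<close> by the larger products of norms lowers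
  the sum. The last term is an equality.\<close>

lemma L1_sum_energy:
  assumes m: "m \<in> {1..M}" and e: "\<And>j. j \<le> m \<Longrightarrow> L2_fun \<Omega> (e j)"
  shows "L1_sum \<alpha> t (\<lambda>j. L2_norm \<Omega> (e j)) m * L2_norm \<Omega> (e m) \<le> L1_sum \<alpha> t (\<lambda>j. L2_inner \<Omega> (e j) (e m)) m"
proof -
  define v where "v j = L2_norm \<Omega> (e j)" for j
  have CS: "L2_inner \<Omega> (e j) (e m) \<le> v j * v m" if "j \<le> m" for j
    using L2_Cauchy_Schwarz[of \<Omega> "e j" "e m"] e that by (simp add: v_def abs_le_iff)
  have m1: "1 \<le> m" "m \<le> M" using m by auto
  have "L1_sum \<alpha> t v m * v m = wt \<alpha> t m m * (v m * v m)
      - (\<Sum>j\<in>{1..<m}. (wt \<alpha> t m (Suc j) - wt \<alpha> t m j) * (v j * v m)) - wt \<alpha> t m 1 * (v 0 * v m)"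
    unfolding L1_sum_Abel[OF m1(1)] by (simp add: left_diff_distrib sum_distrib_right mult.assoc)
  also have "\<dots> \<le> wt \<alpha> t m m * L2_inner \<Omega> (e m) (e m)
      - (\<Sum>j\<in>{1..<m}. (wt \<alpha> t m (Suc j) - wt \<alpha> t m j) * L2_inner \<Omega> (e j) (e m)) - wt \<alpha> t m 1 * L2_inner \<Omega> (e 0) (e m)"
  proof (intro diff_mono)
    show "wt \<alpha> t m m * (v m * v m) \<le> wt \<alpha> t m m * L2_inner \<Omega> (e m) (e m)"
      by (simp add: v_def L2_norm_power2[symmetric] power2_eq_square)
    show "(\<Sum>j\<in>{1..<m}. (wt \<alpha> t m (Suc j) - wt \<alpha> t m j) * L2_inner \<Omega> (e j) (e m))
        \<le> (\<Sum>j\<in>{1..<m}. (wt \<alpha> t m (Suc j) - wt \<alpha> t m j) * (v j * v m))"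
      using CS wt_mono m1 by (intro sum_mono mult_left_mono) auto
    show "wt \<alpha> t m 1 * L2_inner \<Omega> (e 0) (e m) \<le> wt \<alpha> t m 1 * (v 0 * v m)"
      using CS wt_pos[of 1 m] m1 by (intro mult_left_mono) auto
  qed
  also have "\<dots> = L1_sum \<alpha> t (\<lambda>j. L2_inner \<Omega> (e j) (e m)) m"
    unfolding L1_sum_Abel[OF m1(1)] ..
  finally show ?thesis by (simp add: v_def[abs_def])
qed

text \<open>Serves the case of a vanishing error, in which the energy inequality cannot be divided
  by \<open>v m\<close>.\<close>

lemma L1_sum_nonpos:
  assumes m: "m \<in> {1..M}" and v: "\<And>j. 0 \<le> v j" "v m = 0"
  shows "L1_sum \<alpha> t v m \<le> 0"
proof -
  have "0 \<le> (\<Sum>j\<in>{1..<m}. (wt \<alpha> t m (Suc j) - wt \<alpha> t m j) * v j)"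
    using wt_mono m v by (intro sum_nonneg mult_nonneg_nonneg) auto
  moreover have "0 \<le> wt \<alpha> t m 1 * v 0"
    using wt_pos[of 1 m] m v by (intro mult_nonneg_nonneg) auto
  ultimately show ?thesis using L1_sum_Abel[of m v] m v by auto
qed

end

text \<open>Links the measurable time derivative in the notion of solution with the one in the
  regularity hypothesis: the two agree once paired with e.\<close>

lemma scalar_derivative_unique:
  assumes "L2_time_derivative \<Omega> T v w" "L2_time_derivative \<Omega> T v w'" "L2_fun \<Omega> e" "s \<in> {0<..T}"
  shows "L2_inner \<Omega> (w s) e = L2_inner \<Omega> (w' s) e"
proof -
  note d = L2_time_derivative_inner[OF assms(1,3,4)] L2_time_derivative_inner[OF assms(2,3,4)]
  have "s islimpt {0<..<s}" using assms(4) by (simp add: islimpt_greaterThanLessThan2)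
  then have "s islimpt {0<..T}" using assms(4) by (elim islimpt_subset) auto
  then have "at s within {0<..T} \<noteq> bot" by (simp add: trivial_limit_within)
  then show ?thesis using d unfolding has_field_derivative_iff by (rule tendsto_unique)
qed

text \<open>With \<open>e m\<close> as test function at all times, \<psi> is a scalar function whose
  second derivative is at most \<open>C * v m * s powr (\<sigma> - 2)\<close>. The truncation term
  thus carries a factor \<open>v m\<close>, as do the energy and the lower-order terms, and this
  factor cancels.\<close>

lemma error_inequality:
  fixes \<Omega> :: "(real^'d) set"
    and a b :: "'d \<Rightarrow> real^'d \<Rightarrow> real \<Rightarrow> real \<Rightarrow> real"
    and u :: "real \<Rightarrow> real^'d \<Rightarrow> real" and t :: "nat \<Rightarrow> real"
  assumes \<Omega>: "open \<Omega>" "bounded \<Omega>" and mesh: "graded_mesh \<alpha> t M r c" and TM: "t M = T"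
    and constants: "0 < ca" "Ca \<ge> 0" "Cb \<ge> 0"
    and a_bounds: "\<And>k x s v. x \<in> \<Omega> \<Longrightarrow> s > 0 \<Longrightarrow> ca \<le> a k x s v"
    and a_lipschitz: "\<And>k x s v w. x \<in> \<Omega> \<Longrightarrow> s > 0 \<Longrightarrow> \<bar>a k x s v - a k x s w\<bar> \<le> Ca * \<bar>v - w\<bar>"
    and b_lipschitz: "\<And>k x s v w. x \<in> \<Omega> \<Longrightarrow> s > 0 \<Longrightarrow> \<bar>b k x s v - b k x s w\<bar> \<le> Cb * \<bar>v - w\<bar>"
    and f_one_sided: "\<And>x s v w. x \<in> \<Omega> \<Longrightarrow> s > 0 \<Longrightarrow> v \<ge> w \<Longrightarrow> f x s v - f x s w \<ge> - lam0 * (v - w)"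
    and solution: "parabolic_solution \<Omega> T \<alpha> a b f u0 u"
    and \<sigma>: "0 < \<sigma>" "\<sigma> < 2" "\<sigma> \<noteq> 1"
    and du: "L2_time_derivative \<Omega> T u du1" "L2_time_derivative \<Omega> T du1 du2"
    and reg: "0 \<le> C" "\<And>s. s \<in> {0<..T} \<Longrightarrow> L2_norm \<Omega> (du2 s) \<le> C * s powr (\<sigma> - 2)"
    and gradient_bound: "\<And>s. s \<in> {0..T} \<Longrightarrow> \<exists>G. weak_gradient \<Omega> (u s) G \<and> Linf_norm \<Omega> G \<le> ereal Cu"
    and U: "semidiscrete_solution \<Omega> \<alpha> a b f u0 M t U"
    and m: "m \<in> {1..M}"
  defines "v \<equiv> \<lambda>j. L2_norm \<Omega> (\<lambda>x. u (t j) x - U j x)"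
    and "lam \<equiv> lam0 + (Ca * Cu + Cb * sqrt (real CARD('d)))\<^sup>2 / (4 * ca)"
  shows "v 0 = 0"
    and "L1_sum \<alpha> t v m - lam * Gamma (2 - \<alpha>) * v m \<le> (1 - \<alpha>) * (C * graded_mesh.truncation_bound_const \<alpha> r c \<sigma>) *
      (t 1 powr (\<sigma> - \<alpha>) * (t 1 / t m) powr graded_mesh.truncation_exponent \<alpha> r \<sigma>)"
proof -
  interpret graded_mesh \<alpha> t M r c by (rule mesh)
  have B: "bounded_open_set \<Omega>" using \<Omega> by (rule bounded_open_set.intro)
  define e where "e j x = u (t j) x - U j x" for j x
  have v: "v j = L2_norm \<Omega> (e j)" for j by (simp add: v_def e_def[abs_def])
  have cont: "L2_continuous \<Omega> T u" and u_0: "AE x in lebesgue_on \<Omega>. u 0 x = u0 x"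
    using solution by (auto simp: parabolic_solution_def)
  obtain u' where u': "L2_time_derivative \<Omega> T u u'"
    "(\<lambda>(s, x). u' s x) \<in> borel_measurable (lebesgue_on {0<..T} \<Otimes>\<^sub>M lebesgue_on \<Omega>)"
    "\<And>s. s \<in> {0<..T} \<Longrightarrow> integrable (lebesgue_on {0..s}) (\<lambda>y. (s - y) powr (-\<alpha>) * L2_norm \<Omega> (u' y))"
    "\<And>s. s \<in> {0<..T} \<Longrightarrow> weak_elliptic \<Omega> a b f s (caputo \<alpha> u' s) (u s)"
    using solution unfolding parabolic_solution_def by blast
  have t_in: "t j \<in> {0..T}" if "j \<le> M" for j using t_nonneg[OF that] t_le[OF that] TM by auto
  have Lu: "L2_fun \<Omega> (u (t j))" if "j \<le> M" for j
    using cont t_in[OF that] by (simp add: L2_continuous_def)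
  have U_0: "AE x in lebesgue_on \<Omega>. U 0 x = u0 x" using U by (simp add: semidiscrete_solution_def)
  have eq0: "AE x in lebesgue_on \<Omega>. u (t 0) x = U 0 x" using u_0 U_0 t_0 by auto
  have LU: "L2_fun \<Omega> (U j)" if "j \<le> M" for j
  proof (cases "j = 0")
    case True
    have meas: "U 0 \<in> borel_measurable (lebesgue_on \<Omega>)"
      by (rule borel_measurable_lebesgue_on_cong_AE[of \<Omega> "u (t 0)"]) (use \<Omega> Lu[of 0] eq0 in \<open>auto simp: L2_fun_def\<close>)
    have "integrable (lebesgue_on \<Omega>) (\<lambda>x. (norm (U 0 x))\<^sup>2)"
      by (rule integrable_cong_AE_imp[of "lebesgue_on \<Omega>" "\<lambda>x. (norm (u (t 0) x))\<^sup>2"])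
        (use Lu[of 0] meas eq0 in \<open>auto simp: L2_fun_def\<close>)
    then show ?thesis using True meas by (simp add: L2_fun_def)
  next
    case False
    then have "U j \<in> H1_0 \<Omega>" using U that by (auto simp: semidiscrete_solution_def weak_elliptic_def)
    then show ?thesis by (auto simp: H1_0_def weak_gradient_def)
  qed
  have Le: "L2_fun \<Omega> (e j)" if "j \<le> M" for j
    unfolding e_def[abs_def] using Lu[OF that] LU[OF that] by (rule L2_fun_diff)
  show v0: "v 0 = 0"
  proof -
    have "(LINT x|lebesgue_on \<Omega>. (norm (e 0 x))\<^sup>2) = (LINT x|lebesgue_on \<Omega>. 0)"
      using Le[of 0] eq0 by (intro integral_cong_AE) (auto simp: L2_fun_def e_def)
    then show ?thesis by (simp add: v L2_norm_def)
  qed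
  have tm: "t m \<in> {0<..T}" "0 < t m" using t_pos[of m] t_in[of m] m by auto
  have mM: "m \<le> M" using m by simp
  define \<psi> where "\<psi> s = L2_inner \<Omega> (u s) (e m)" for s
  define \<psi>' where "\<psi>' s = L2_inner \<Omega> (du1 s) (e m)" for s
  define \<psi>'' where "\<psi>'' s = L2_inner \<Omega> (du2 s) (e m)" for s
  define g where "g = caputo \<alpha> u' (t m)"
  have Lu': "L2_fun \<Omega> (u' s)" "L2_fun \<Omega> (du2 s)" if "s \<in> {0<..T}" for s
    using u'(1) du(2) that by (auto simp: L2_time_derivative_def)
  note cap = bounded_open_set.caputo_inner[OF B u'(2) tm(1) Lu'(1) Le[OF mM] u'(3)[OF tm(1)]]
  define I where "I = (LINT s|lebesgue_on {0..t m}. (t m - s) powr (-\<alpha>) * L2_inner \<Omega> (u' s) (e m))"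
  have I: "((\<lambda>s. (t m - s) powr (-\<alpha>) * \<psi>' s) has_integral I) {0..t m}"
  proof -
    have "((\<lambda>s. (t m - s) powr (-\<alpha>) * L2_inner \<Omega> (u' s) (e m)) has_integral I) {0..t m}"
      unfolding I_def by (rule has_integral_integral_lebesgue_on[OF cap(1)]) simp_all
    then show ?thesis
    \<comment> \<open>The two versions of the derivative agree on (0, t_m] after pairing, and the
      point 0 is negligible.\<close>
    proof (rule has_integral_spike_eq[THEN iffD1, of "{0}", rotated -1])
      fix s assume "s \<in> {0..t m} - {0}"
      then have "s \<in> {0<..T}" using tm by auto
      then show "(t m - s) powr (-\<alpha>) * \<psi>' s = (t m - s) powr (-\<alpha>) * L2_inner \<Omega> (u' s) (e m)"
        unfolding \<psi>'_def using scalar_derivative_unique[OF du(1) u'(1) Le[OF mM]] by simp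
    qed simp
  qed
  define X where "X = truncation_bound_const \<sigma> * (t 1 powr (\<sigma> - \<alpha>) * (t 1 / t m) powr truncation_exponent \<sigma>)"
  have X: "0 \<le> X"
    unfolding X_def truncation_bound_const_def first_step_const_def ratio_def
    using \<alpha> \<sigma> r trunc_const_pos by (intro mult_nonneg_nonneg add_nonneg_nonneg divide_nonneg_nonneg) auto
  have vm: "0 \<le> v m" by (simp add: v L2_norm_nonneg)
  have trunc: "\<bar>L1_sum \<alpha> t (\<lambda>j. \<psi> (t j)) m / (1 - \<alpha>) - I\<bar> \<le> C * v m * X"
    unfolding X_def mult.assoc[symmetric]
    unfolding mult.assoc[of "C * v m * truncation_bound_const \<sigma>"]
  proof (rule truncation_error[OF m \<sigma>, where \<psi>' = \<psi>' and \<psi>'' = \<psi>''])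
    show "0 \<le> C * v m" using reg(1) vm by simp
    show "continuous_on {0..t M} \<psi>"
      unfolding \<psi>_def TM using cont Le[OF mM] by (rule L2_continuous_inner)
    show "(\<psi> has_real_derivative \<psi>' s) (at s within {0<..t M})" if "s \<in> {0<..t M}" for s
      unfolding \<psi>_def \<psi>'_def TM using L2_time_derivative_inner[OF du(1) Le[OF mM]] that TM by simp
    show "(\<psi>' has_real_derivative \<psi>'' s) (at s within {0<..t M})" if "s \<in> {0<..t M}" for s
      unfolding \<psi>'_def \<psi>''_def TM using L2_time_derivative_inner[OF du(2) Le[OF mM]] that TM by simp
    show "\<bar>\<psi>'' s\<bar> \<le> C * v m * s powr (\<sigma> - 2)" if "s \<in> {0<..t M}" for s
    proof -
      have s: "s \<in> {0<..T}" using that TM by simp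
      have "\<bar>\<psi>'' s\<bar> \<le> L2_norm \<Omega> (du2 s) * v m"
        unfolding \<psi>''_def v using Lu'(2)[OF s] Le[OF mM] by (rule L2_Cauchy_Schwarz)
      also have "\<dots> \<le> (C * s powr (\<sigma> - 2)) * v m" using reg(2)[OF s] vm by (rule mult_right_mono)
      finally show ?thesis by (simp add: mult_ac)
    qed
    show "((\<lambda>s. (t m - s) powr - \<alpha> * \<psi>' s) has_integral I) {0..t m}" by (rule I)
  qed
  define \<Gamma> where "\<Gamma> = Gamma (2 - \<alpha>)"
  have \<Gamma>: "0 < \<Gamma>" using \<alpha> by (simp add: \<Gamma>_def)
  obtain G where G: "weak_gradient \<Omega> (u (t m)) G" "Linf_norm \<Omega> G \<le> ereal Cu"
    using gradient_bound[of "t m"] tm by auto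
  have "L2_inner \<Omega> g (e m) - L2_inner \<Omega> (L1_operator \<alpha> t U m) (e m) \<le> lam * (v m)\<^sup>2"
    unfolding v lam_def e_def[abs_def]
  proof (rule bounded_open_set.weak_elliptic_difference[OF B constants, where s = "t m" and a = a and b = b and f = f and G = G])
    show "weak_elliptic \<Omega> a b f (t m) g (u (t m))" unfolding g_def using u'(4)[OF tm(1)] .
    show "weak_elliptic \<Omega> a b f (t m) (L1_operator \<alpha> t U m) (U m)"
      using U m by (simp add: semidiscrete_solution_def)
  qed (use tm a_bounds a_lipschitz b_lipschitz f_one_sided G in auto)
  moreover have "L2_inner \<Omega> (L1_operator \<alpha> t U m) (e m) = 1 / \<Gamma> * L1_sum \<alpha> t (\<lambda>j. L2_inner \<Omega> (U j) (e m)) m"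
    unfolding \<Gamma>_def using m LU Le by (intro L2_inner_L1_operator) auto
  \<comment> \<open>Gamma(2 - \<alpha>) = (1 - \<alpha>) Gamma(1 - \<alpha>) brings both operators
    to the same normalization.\<close>
  moreover have "L2_inner \<Omega> g (e m) = 1 / \<Gamma> * ((1 - \<alpha>) * I)"
    unfolding g_def I_def \<Gamma>_def using cap(2) \<alpha> by (simp add: Gamma_2_minus)
  ultimately have "1 / \<Gamma> * ((1 - \<alpha>) * I - L1_sum \<alpha> t (\<lambda>j. L2_inner \<Omega> (U j) (e m)) m) \<le> lam * (v m)\<^sup>2"
    by (simp add: right_diff_distrib)
  then have 1: "(1 - \<alpha>) * I - L1_sum \<alpha> t (\<lambda>j. L2_inner \<Omega> (U j) (e m)) m \<le> \<Gamma> * (lam * (v m)\<^sup>2)"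
    using \<Gamma> by (simp add: field_simps)
  have "L1_sum \<alpha> t (\<lambda>j. L2_inner \<Omega> (e j) (e m)) m = L1_sum \<alpha> t (\<lambda>j. \<psi> (t j) - L2_inner \<Omega> (U j) (e m)) m"
    unfolding L1_sum_def
  proof (rule sum.cong)
    fix j assume "j \<in> {1..m}"
    then have j: "j \<le> M" "j - 1 \<le> M" using mM by auto
    have "L2_inner \<Omega> (e i) (e m) = \<psi> (t i) - L2_inner \<Omega> (U i) (e m)" if "i \<le> M" for i
      unfolding \<psi>_def e_def[of i, abs_def] using Lu[OF that] LU[OF that] Le[OF mM] by (rule L2_inner_diff)
    then show "(L2_inner \<Omega> (e j) (e m) - L2_inner \<Omega> (e (j - 1)) (e m)) * wt \<alpha> t m j =
      (\<psi> (t j) - L2_inner \<Omega> (U j) (e m) - (\<psi> (t (j - 1)) - L2_inner \<Omega> (U (j - 1)) (e m))) * wt \<alpha> t m j"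
      using j by simp
  qed simp
  then have 2: "L1_sum \<alpha> t v m * v m \<le> L1_sum \<alpha> t (\<lambda>j. \<psi> (t j)) m - L1_sum \<alpha> t (\<lambda>j. L2_inner \<Omega> (U j) (e m)) m"
    using L1_sum_energy[OF m, of \<Omega> e] Le mM by (simp add: v[abs_def] L1_sum_diff)
  have 3: "L1_sum \<alpha> t (\<lambda>j. \<psi> (t j)) m - (1 - \<alpha>) * I \<le> (1 - \<alpha>) * (C * v m * X)"
  proof -
    have "(1 - \<alpha>) * (L1_sum \<alpha> t (\<lambda>j. \<psi> (t j)) m / (1 - \<alpha>) - I) \<le> (1 - \<alpha>) * (C * v m * X)"
      using trunc \<alpha> by (intro mult_left_mono) auto
    then show ?thesis using \<alpha> by (simp add: right_diff_distrib)
  qed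
  have "L1_sum \<alpha> t v m - lam * \<Gamma> * v m \<le> (1 - \<alpha>) * C * X"
  proof (cases "v m = 0")
    case True
    then have "L1_sum \<alpha> t v m \<le> 0" using L1_sum_nonpos[OF m, of v] by (simp add: v L2_norm_nonneg)
    moreover have "0 \<le> (1 - \<alpha>) * C * X" using \<alpha> reg(1) X by simp
    ultimately show ?thesis using True by simp
  next
    case False
    then have "0 < v m" using vm by simp
    have "(L1_sum \<alpha> t v m - lam * \<Gamma> * v m) * v m \<le> (1 - \<alpha>) * C * X * v m"
      using 1 2 3 by (simp add: algebra_simps power2_eq_square)
    then show ?thesis using \<open>0 < v m\<close> by simp
  qed
  then show "L1_sum \<alpha> t v m - lam * Gamma (2 - \<alpha>) * v m \<le> (1 - \<alpha>) * (C * truncation_bound_const \<sigma>) *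
      (t 1 powr (\<sigma> - \<alpha>) * (t 1 / t m) powr truncation_exponent \<sigma>)"
    by (simp add: X_def \<Gamma>_def mult_ac)
qed

section \<open>Error bound\<close>

lemma (in mesh) error_bound_pos:
  assumes M: "1 \<le> M" and m: "m \<in> {1..M}"
  shows "0 < error_bound \<alpha> \<sigma> r M t m"
proof -
  have t: "0 < t 1" "t 1 \<le> t m" "0 < t m" using t_pos[of 1] t_le[of 1 m] t_pos[of m] m by auto
  then have "0 \<le> ln (t m / t 1)" by (intro ln_ge_zero) auto
  then have "0 < 1 + ln (t m / t 1)" by simp
  then show ?thesis using M t by (simp add: error_bound_def Let_def)
qed

text \<open>Since p - 1 = min(\<alpha>, (2 - \<alpha>)/r - \<nu>), the alternatives p > 1, p = 1 and
  p < 1 are the three ranges of r in the theorem. The remaining power of t_1 has exponent \<nu> in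
  the first two and (2 - \<alpha>)/r in the third, and t_1 is bounded by c2 M^(-r).\<close>

lemma (in graded_op) power_mass_le_error_bound:
  assumes c2: "0 < c2" and t1: "t 1 \<le> c2 * real M powr (-r)" and m: "m \<in> {1..M}" and \<sigma>: "0 < \<sigma>"
  defines "p \<equiv> truncation_exponent \<sigma>"
  shows "t 1 powr (\<sigma> - \<alpha>) * (t m powr (\<alpha> - 1) * power_mass p m) \<le>
    (c2 powr (1 + \<sigma> - \<alpha>) + c2 powr ((2 - \<alpha>) / r)) * (1 + 1 / \<bar>p - 1\<bar>) * error_bound \<alpha> \<sigma> r M t m"
proof -
  define \<nu> where "\<nu> = 1 + \<sigma> - \<alpha>"
  have \<nu>: "0 < \<nu>" using \<alpha> \<sigma> by (simp add: \<nu>_def)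
  have p: "p = min (\<alpha> + 1) ((2 - \<alpha>) / r - \<nu> + 1)" by (simp add: p_def truncation_exponent_def \<nu>_def)
  have t: "0 < t 1" "t 1 \<le> t m" "0 < t m" using t_1_pos t_1_le[of m] t_pos[of m] m by auto
  have M: "0 < real M" using M_pos by simp
  have le: "t 1 powr q \<le> c2 powr q * real M powr (- r * q)" if "0 \<le> q" for q
  proof -
    have "t 1 powr q \<le> (c2 * real M powr (-r)) powr q" using t1 t that by (intro powr_mono2) auto
    then show ?thesis using c2 by (simp add: powr_mult powr_powr)
  qed
  have eb: "0 < error_bound \<alpha> \<sigma> r M t m" using M_pos m by (rule error_bound_pos)
  \<comment> \<open>For p = 1 the division by 0 gives k = 1, which is what the logarithmic case
    needs.\<close>
  define k where "k = 1 + 1 / \<bar>p - 1\<bar>"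
  have k: "1 \<le> k" by (simp add: k_def)
  have fin: "X \<le> (c2 powr (1 + \<sigma> - \<alpha>) + c2 powr ((2 - \<alpha>) / r)) * (1 + 1 / \<bar>p - 1\<bar>) * error_bound \<alpha> \<sigma> r M t m"
    if "X \<le> y * k * error_bound \<alpha> \<sigma> r M t m" "y \<in> {c2 powr (1 + \<sigma> - \<alpha>), c2 powr ((2 - \<alpha>) / r)}" for X y
  proof -
    have "y * k * error_bound \<alpha> \<sigma> r M t m \<le> (c2 powr (1 + \<sigma> - \<alpha>) + c2 powr ((2 - \<alpha>) / r)) * k * error_bound \<alpha> \<sigma> r M t m"
      using that(2) k eb by (intro mult_right_mono) auto
    with that(1) show ?thesis unfolding k_def by (rule order_trans)
  qed
  have first: "t 1 powr (\<sigma> - \<alpha>) * (t m powr (\<alpha> - 1) * (t 1 * z)) = t 1 powr \<nu> * t m powr (\<alpha> - 1) * z" for z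
  proof -
    have "t 1 powr (\<sigma> - \<alpha>) * t 1 = t 1 powr \<nu>"
      using t powr_mult_base[of "t 1" "\<sigma> - \<alpha>"] by (simp add: \<nu>_def mult.commute add_diff_eq)
    then show ?thesis by (metis mult.assoc mult.commute)
  qed
  consider "r < (2 - \<alpha>) / \<nu>" | "r = (2 - \<alpha>) / \<nu>" | "r > (2 - \<alpha>) / \<nu>" by linarith
  then show ?thesis
  proof cases
    case 1
    then have "\<nu> < (2 - \<alpha>) / r" using \<nu> r by (simp add: field_simps)
    then have "1 < p" unfolding p using \<alpha> by auto
    then have "t 1 powr (\<sigma> - \<alpha>) * (t m powr (\<alpha> - 1) * power_mass p m) = t 1 powr \<nu> * t m powr (\<alpha> - 1) * k"
      by (simp only: power_mass_def first if_True) (simp add: k_def)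
    also have "\<dots> \<le> (c2 powr \<nu> * real M powr (- r * \<nu>)) * t m powr (\<alpha> - 1) * k"
      using le[of \<nu>] \<nu> k by (intro mult_right_mono) auto
    also have "\<dots> = c2 powr \<nu> * k * error_bound \<alpha> \<sigma> r M t m"
    proof -
      have "error_bound \<alpha> \<sigma> r M t m = real M powr (- r * \<nu>) * t m powr (\<alpha> - 1)"
        using 1 unfolding error_bound_def Let_def \<nu>_def[symmetric] by (simp add: mult.commute)
      then show ?thesis by (simp add: mult_ac)
    qed
    finally show ?thesis by (rule fin) (simp add: \<nu>_def)
  next
    case 2
    then have eq: "\<nu> = (2 - \<alpha>) / r" "r * \<nu> = 2 - \<alpha>" using \<nu> r \<alpha> by (simp_all add: field_simps)
    then have "p = 1" unfolding p using \<alpha> by auto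
    then have "t 1 powr (\<sigma> - \<alpha>) * (t m powr (\<alpha> - 1) * power_mass p m) = t 1 powr \<nu> * t m powr (\<alpha> - 1) * (1 + ln (t m / t 1))"
      by (simp only: power_mass_def first less_irrefl if_False if_True refl)
    also have "\<dots> \<le> (c2 powr \<nu> * real M powr (- r * \<nu>)) * t m powr (\<alpha> - 1) * (1 + ln (t m / t 1))"
      using le[of \<nu>] \<nu> t by (intro mult_right_mono add_nonneg_nonneg ln_ge_zero) auto
    also have "\<dots> = c2 powr \<nu> * k * error_bound \<alpha> \<sigma> r M t m"
    proof -
      have "- r * \<nu> = - (2 - \<alpha>)" using eq(2) by simp
      moreover have "error_bound \<alpha> \<sigma> r M t m = real M powr (- (2 - \<alpha>)) * t m powr (\<alpha> - 1) * (1 + ln (t m / t 1))"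
        using 2 unfolding error_bound_def Let_def \<nu>_def[symmetric] by simp
      ultimately show ?thesis using \<open>p = 1\<close> by (simp add: k_def mult_ac)
    qed
    finally show ?thesis by (rule fin) (simp add: \<nu>_def)
  next
    case 3
    then have lt: "(2 - \<alpha>) / r < \<nu>" using \<nu> r by (simp add: field_simps)
    then have p1: "p < 1" "p = (2 - \<alpha>) / r + \<alpha> - \<sigma>" unfolding p using \<alpha> by (auto simp: \<nu>_def)
    have "t 1 powr (\<sigma> - \<alpha>) * (t m powr (\<alpha> - 1) * power_mass p m) =
        t 1 powr (\<sigma> - \<alpha>) * (t m powr (\<alpha> - 1) * (t m * (t 1 / t m) powr p)) * k"
      using p1(1) by (simp add: power_mass_def k_def mult_ac)
    also have "t 1 powr (\<sigma> - \<alpha>) * (t m powr (\<alpha> - 1) * (t m * (t 1 / t m) powr p)) = t 1 powr ((2 - \<alpha>) / r) * t m powr (\<sigma> - (2 - \<alpha>) / r)"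
    proof -
      have "t 1 powr (\<sigma> - \<alpha>) * t 1 powr p = t 1 powr ((2 - \<alpha>) / r)"
        by (simp add: p1(2) flip: powr_add)
      moreover have "t m powr (\<alpha> - 1) * (t m / t m powr p) = t m powr (\<sigma> - (2 - \<alpha>) / r)"
      proof -
        have "t m powr (\<alpha> - 1) * (t m powr 1 / t m powr p) = t m powr (\<alpha> - 1 + (1 - p))"
          by (simp only: powr_add powr_diff)
        then show ?thesis using t by (simp add: p1(2))
      qed
      moreover have "t 1 powr (\<sigma> - \<alpha>) * (t m powr (\<alpha> - 1) * (t m * (t 1 / t m) powr p))
          = (t 1 powr (\<sigma> - \<alpha>) * t 1 powr p) * (t m powr (\<alpha> - 1) * (t m / t m powr p))"
        using t by (simp add: powr_divide)
      ultimately show ?thesis by (simp only:)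
    qed
    also have "\<dots> * k \<le> (c2 powr ((2 - \<alpha>) / r) * real M powr (- r * ((2 - \<alpha>) / r))) * t m powr (\<sigma> - (2 - \<alpha>) / r) * k"
      using le[of "(2 - \<alpha>) / r"] \<alpha> r k by (intro mult_right_mono) auto
    also have "\<dots> = c2 powr ((2 - \<alpha>) / r) * k * error_bound \<alpha> \<sigma> r M t m"
    proof -
      have "- r * ((2 - \<alpha>) / r) = - (2 - \<alpha>)" using r by simp
      moreover have "error_bound \<alpha> \<sigma> r M t m = real M powr (- (2 - \<alpha>)) * t m powr (\<sigma> - (2 - \<alpha>) / r)"
        using 3 unfolding error_bound_def Let_def \<nu>_def[symmetric] by simp
      ultimately show ?thesis by (simp add: mult_ac)
    qed
    finally show ?thesis by (rule fin) simp
  qed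
qed

lemma uniform_error_bound:
  fixes t :: "nat \<Rightarrow> nat \<Rightarrow> real"
  assumes \<alpha>: "0 < \<alpha>" "\<alpha> < 1" and \<mu>: "0 \<le> \<mu>" and r: "1 \<le> r" and c2: "0 < c2" and c: "0 < c" and T: "0 < T"
    and \<sigma>: "0 < \<sigma>"
    and op: "\<And>M. M \<in> Ms \<Longrightarrow> graded_op \<alpha> (t M) M r c \<mu>" and TM: "\<And>M. M \<in> Ms \<Longrightarrow> t M M = T"
    and t1: "\<And>M. M \<in> Ms \<Longrightarrow> t M 1 \<le> c2 * real M powr (-r)"
  defines "p \<equiv> min (\<alpha> + 1) ((2 - \<alpha>) / r + \<alpha> - \<sigma>)"
  shows "\<exists>C>0. \<forall>M\<in>Ms. \<forall>m\<in>{1..M}. t M 1 powr (\<sigma> - \<alpha>) * L1_solve \<alpha> \<mu> (t M) (\<lambda>j. (t M 1 / t M j) powr p) m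
    \<le> C * error_bound \<alpha> \<sigma> r M (t M) m"
proof -
  obtain K h where K: "0 < K" and h: "0 < h" and stab:
    "\<And>t M k m. graded_op \<alpha> t M r c \<mu> \<Longrightarrow> t M = T \<Longrightarrow> (\<And>j. j \<in> {1..M} \<Longrightarrow> t j - t (j - 1) \<le> h) \<Longrightarrow>
      k \<in> {1..M} \<Longrightarrow> m \<in> {1..M} \<Longrightarrow> L1_solve \<alpha> \<mu> t (cutoff k) m \<le> K * t k * t m powr (\<alpha> - 1)"
    using discrete_stability[OF \<alpha> \<mu> r c T] by metis
  define S where "S M m = t M 1 powr (\<sigma> - \<alpha>) * L1_solve \<alpha> \<mu> (t M) (\<lambda>j. (t M 1 / t M j) powr p) m" for M m
  (* Stability holds on sufficiently fine meshes; the finitely many coarse ones get individual constants. *)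
  define N where "N = c * (T powr (1 - 1 / r) * c2 powr (1 / r)) / h"
  define Bad where "Bad = {M \<in> Ms. real M \<le> N}"
  have fin: "finite Bad"
    by (rule finite_subset[of _ "{..nat \<lfloor>N\<rfloor>}"]) (auto simp: Bad_def le_nat_floor)
  have steps: "t M j - t M (j - 1) \<le> h" if M: "M \<in> Ms" "M \<notin> Bad" and j: "j \<in> {1..M}" for M j
  proof -
    interpret graded_op \<alpha> "t M" M r c \<mu> by (rule op[OF M(1)])
    have tj: "0 < t M 1" "0 < t M j" "0 < real M" "t M j \<le> T"
      using t_1_pos t_pos[of j] t_le[of j M] j TM[OF M(1)] M_pos by auto
    \<comment> \<open>The step bound is largest at the final time, where the grading makes it of
      order 1 / M.\<close>
    have "t M j * (t M 1 / t M j) powr (1 / r) \<le> T * (t M 1 / T) powr (1 / r)"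
      using grading_scale_mono[of j M] j TM[OF M(1)] by auto
    also have "\<dots> = T powr (1 - 1 / r) * t M 1 powr (1 / r)"
      using T tj by (simp add: powr_divide powr_diff)
    also have "\<dots> \<le> T powr (1 - 1 / r) * (c2 * real M powr (-r)) powr (1 / r)"
      using t1[OF M(1)] tj r by (intro mult_left_mono powr_mono2) auto
    also have "\<dots> = T powr (1 - 1 / r) * c2 powr (1 / r) / real M"
    proof -
      have "(real M powr (-r)) powr (1 / r) = real M powr (-1)" using r by (simp only: powr_powr) simp
      moreover have "(c2 * real M powr (-r)) powr (1 / r) = c2 powr (1 / r) * (real M powr (-r)) powr (1 / r)"
        by (simp only: powr_mult)
      ultimately have "(c2 * real M powr (-r)) powr (1 / r) = c2 powr (1 / r) * real M powr (-1)" by simp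
      then show ?thesis using tj by (simp add: powr_minus_divide)
    qed
    finally have "t M j - t M (j - 1) \<le> c * (T powr (1 - 1 / r) * c2 powr (1 / r) / real M)"
      using grading[OF j] c mult_left_mono[of _ _ c] by (smt (verit, best))
    also have "\<dots> = N * h / real M" using h by (simp add: N_def)
    also have "\<dots> \<le> h" using M tj h by (simp add: Bad_def field_simps)
    finally show ?thesis .
  qed
  define C1 where "C1 = K * ((c2 powr (1 + \<sigma> - \<alpha>) + c2 powr ((2 - \<alpha>) / r)) * (1 + 1 / \<bar>p - 1\<bar>))"
  have C1: "0 < C1" using K c2 by (auto simp: C1_def intro!: mult_pos_pos add_pos_nonneg)
  have good: "S M m \<le> C1 * error_bound \<alpha> \<sigma> r M (t M) m" if M: "M \<in> Ms" "M \<notin> Bad" and m: "m \<in> {1..M}" for M m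
  proof -
    interpret graded_op \<alpha> "t M" M r c \<mu> by (rule op[OF M(1)])
    have pe: "p = truncation_exponent \<sigma>" by (simp add: p_def truncation_exponent_def)
    have "L1_solve \<alpha> \<mu> (t M) (\<lambda>j. (t M 1 / t M j) powr p) m \<le> K * t M m powr (\<alpha> - 1) * power_mass p m"
      using m K stab[OF op[OF M(1)] TM[OF M(1)] steps[OF M]] by (intro J_power_le) auto
    then have "S M m \<le> t M 1 powr (\<sigma> - \<alpha>) * (K * t M m powr (\<alpha> - 1) * power_mass p m)"
      unfolding S_def by (intro mult_left_mono) auto
    also have "\<dots> = K * (t M 1 powr (\<sigma> - \<alpha>) * (t M m powr (\<alpha> - 1) * power_mass p m))" by (simp add: mult_ac)
    also have "\<dots> \<le> K * ((c2 powr (1 + \<sigma> - \<alpha>) + c2 powr ((2 - \<alpha>) / r)) * (1 + 1 / \<bar>p - 1\<bar>) * error_bound \<alpha> \<sigma> r M (t M) m)"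
      unfolding pe using K c2 t1[OF M(1)] m \<sigma> by (intro mult_left_mono power_mass_le_error_bound) auto
    finally show ?thesis by (simp add: C1_def mult.assoc)
  qed
  define q where "q M m = \<bar>S M m\<bar> / error_bound \<alpha> \<sigma> r M (t M) m" for M m
  have eb: "0 < error_bound \<alpha> \<sigma> r M (t M) m" if M: "M \<in> Ms" and m: "m \<in> {1..M}" for M m
  proof -
    interpret graded_op \<alpha> "t M" M r c \<mu> by (rule op[OF M])
    show ?thesis using M_pos m by (rule error_bound_pos)
  qed
  have q: "0 \<le> q M m" if "M \<in> Bad" "m \<in> {1..M}" for M m
    using that eb[of M m] by (auto simp: q_def Bad_def)
  define C where "C = C1 + (\<Sum>M\<in>Bad. \<Sum>m=1..M. q M m)"
  have CB: "q M m \<le> C" if "M \<in> Bad" "m \<in> {1..M}" for M m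
  proof -
    have "q M m \<le> (\<Sum>m=1..M. q M m)" using that q by (intro member_le_sum) auto
    also have "\<dots> \<le> (\<Sum>M\<in>Bad. \<Sum>m=1..M. q M m)"
      using that q fin by (intro member_le_sum[of M Bad "\<lambda>M. \<Sum>m=1..M. q M m"] sum_nonneg) auto
    finally show ?thesis using C1 by (simp add: C_def)
  qed
  have CC: "C1 \<le> C" unfolding C_def using q by (auto intro!: sum_nonneg)
  have "S M m \<le> C * error_bound \<alpha> \<sigma> r M (t M) m" if M: "M \<in> Ms" and m: "m \<in> {1..M}" for M m
  proof (cases "M \<in> Bad")
    case True
    have "\<bar>S M m\<bar> \<le> C * error_bound \<alpha> \<sigma> r M (t M) m"
      using CB[OF True m] eb[OF M m] by (simp add: q_def pos_divide_le_eq)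
    then show ?thesis by simp
  next
    case False
    have "C1 * error_bound \<alpha> \<sigma> r M (t M) m \<le> C * error_bound \<alpha> \<sigma> r M (t M) m"
      using CC eb[OF M m] by (intro mult_right_mono) auto
    with good[OF M False m] show ?thesis by simp
  qed
  then show ?thesis using C1 CC unfolding S_def by (intro exI[of _ C]) auto
qed

theorem theorem5p1:
  fixes \<Omega> :: "(real^'d) set"
    and a b :: "'d \<Rightarrow> real^'d \<Rightarrow> real \<Rightarrow> real \<Rightarrow> real"
    and f :: "real^'d \<Rightarrow> real \<Rightarrow> real \<Rightarrow> real"
    and u0 :: "real^'d \<Rightarrow> real"
    and u :: "real \<Rightarrow> real^'d \<Rightarrow> real"
    and du :: "nat \<Rightarrow> real \<Rightarrow> real^'d \<Rightarrow> real"
    and T \<alpha> \<sigma> r ca ca' Ca Cb Cu lam0 lam :: real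
    and Ms :: "nat set"
    and t :: "nat \<Rightarrow> nat \<Rightarrow> real"
  assumes dim: "CARD('d) \<in> {1, 2, 3}"
    and domain: "bounded_lipschitz_domain \<Omega>"
    and T: "T > 0"
    and \<alpha>: "0 < \<alpha>" "\<alpha> < 1"
    and constants: "0 < ca" "ca \<le> ca'" "Ca \<ge> 0" "Cb \<ge> 0" "lam0 \<ge> 0"
    and f_continuous: "\<And>x s. x \<in> \<Omega> \<Longrightarrow> s > 0 \<Longrightarrow> continuous_on UNIV (f x s)"
    and f_bounded: "\<And>s v. s > 0 \<Longrightarrow> Linf_fun \<Omega> (\<lambda>x. f x s v)"
    and a_bounds: "\<And>k x s v. x \<in> \<Omega> \<Longrightarrow> s > 0 \<Longrightarrow> ca \<le> a k x s v \<and> a k x s v \<le> ca'"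
    and a_lipschitz: "\<And>k x s v w. x \<in> \<Omega> \<Longrightarrow> s > 0 \<Longrightarrow>
          \<bar>a k x s v - a k x s w\<bar> \<le> Ca * \<bar>v - w\<bar>"
    and b_lipschitz: "\<And>k x s v w. x \<in> \<Omega> \<Longrightarrow> s > 0 \<Longrightarrow>
          \<bar>b k x s v - b k x s w\<bar> \<le> Cb * \<bar>v - w\<bar>"
    and f_one_sided: "\<And>x s v w. x \<in> \<Omega> \<Longrightarrow> s > 0 \<Longrightarrow> v \<ge> w \<Longrightarrow>
          f x s v - f x s w \<ge> - lam0 * (v - w)"
    and solution: "parabolic_solution \<Omega> T \<alpha> a b f u0 u"
    and solution_unique: "\<And>w. parabolic_solution \<Omega> T \<alpha> a b f u0 w \<Longrightarrow>
          \<forall>s\<in>{0..T}. AE x in lebesgue_on \<Omega>. w s x = u s x"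
    and \<sigma>: "\<sigma> \<in> {0<..<1} \<union> {1<..<2}"
    and time_derivatives: "du 0 = u" "\<And>l. l < 2 \<Longrightarrow> L2_time_derivative \<Omega> T (du l) (du (Suc l))"
    and time_regularity: "\<exists>C>0. \<forall>l\<in>{0, 1, 2}. \<forall>s\<in>{0<..T}.
          L2_norm \<Omega> (du l s) \<le> C * (1 + s powr (\<sigma> - real l))"
    and gradient_bound: "\<And>s. s \<in> {0..T} \<Longrightarrow>
          \<exists>G. weak_gradient \<Omega> (u s) G \<and> Linf_norm \<Omega> G \<le> ereal Cu"
    and Ms: "Ms \<subseteq> {1..}"
    and meshes: "\<And>M. M \<in> Ms \<Longrightarrow> temporal_mesh T M (t M)"
    and r: "r \<ge> 1"
    and graded: "quasi_graded r Ms t"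
    and lam: "lam = lam0 + (Ca * Cu + Cb * sqrt (real CARD('d)))\<^sup>2 / (4 * ca)"
    and step: "\<And>M j. M \<in> Ms \<Longrightarrow> j \<in> {1..M} \<Longrightarrow>
          lam * mesh_step (t M) j powr \<alpha> < 1 / Gamma (2 - \<alpha>)"
  shows "\<exists>C>0. \<forall>M\<in>Ms. \<forall>U. semidiscrete_solution \<Omega> \<alpha> a b f u0 M (t M) U \<longrightarrow>
          (\<forall>m\<in>{1..M}. L2_norm \<Omega> (\<lambda>x. u (t M m) x - U m x)
             \<le> C * error_bound \<alpha> \<sigma> r M (t M) m)"
proof -
  have \<Omega>: "open \<Omega>" "bounded \<Omega>" using domain by (auto simp: bounded_lipschitz_domain_def)
  have \<sigma>': "0 < \<sigma>" "\<sigma> < 2" "\<sigma> \<noteq> 1" using \<sigma> by auto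
  have \<Gamma>: "0 < Gamma (2 - \<alpha>)" using \<alpha> by simp
  define \<mu> where "\<mu> = lam * Gamma (2 - \<alpha>)"
  have "0 \<le> lam" using constants unfolding lam by simp
  then have \<mu>: "0 \<le> \<mu>" using \<Gamma> by (simp add: \<mu>_def)
  obtain c1 c2 c3 where c: "0 < c1" "0 < c2" "0 < c3" and
    gr: "\<forall>M\<in>Ms. c1 * real M powr (-r) \<le> t M 1 \<and> t M 1 \<le> c2 * real M powr (-r) \<and>
      (\<forall>j\<in>{1..M}. mesh_step (t M) j \<le> c3 * t M 1 powr (1 / r) * t M j powr (1 - 1 / r))"
    using graded unfolding quasi_graded_def by blast
  then have t1: "\<And>M. M \<in> Ms \<Longrightarrow> t M 1 \<le> c2 * real M powr (-r)" by blast
  have mesh: "mesh \<alpha> (t M) M" if "M \<in> Ms" for M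
    using meshes[OF that] \<alpha> by unfold_locales (auto simp: temporal_mesh_def)
  have gmesh: "graded_mesh \<alpha> (t M) M r c3" if M: "M \<in> Ms" for M
  proof -
    interpret mesh \<alpha> "t M" M by (rule mesh[OF M])
    show ?thesis
    proof unfold_locales
      show "1 \<le> M" using M Ms by auto
      fix j assume j: "j \<in> {1..M}"
      have "0 < t M j" "0 < t M 1" using t_pos[of j] t_pos[of 1] j by auto
      then have eq: "c3 * t M 1 powr (1 / r) * t M j powr (1 - 1 / r) = c3 * (t M j * (t M 1 / t M j) powr (1 / r))"
        by (simp add: powr_divide powr_diff)
      have "t M j - t M (j - 1) \<le> c3 * t M 1 powr (1 / r) * t M j powr (1 - 1 / r)"
        using gr M j unfolding mesh_step_def by blast
      then show "t M j - t M (j - 1) \<le> c3 * (t M j * (t M 1 / t M j) powr (1 / r))"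
        unfolding eq .
    qed (use r c in auto)
  qed
  have op: "graded_op \<alpha> (t M) M r c3 \<mu>" if M: "M \<in> Ms" for M
  proof -
    interpret graded_mesh \<alpha> "t M" M r c3 by (rule gmesh[OF M])
    show ?thesis
    proof unfold_locales
      fix m assume m: "m \<in> {1..M}"
      have "lam * (t M m - t M (m - 1)) powr \<alpha> < 1 / Gamma (2 - \<alpha>)"
        using step[OF M m] by (simp add: mesh_step_def)
      moreover have "0 < (t M m - t M (m - 1)) powr \<alpha>" using t_pred[of m] m by simp
      moreover have "wt \<alpha> (t M) m m = 1 / (t M m - t M (m - 1)) powr \<alpha>"
        using wt_diag[of m] m by (simp add: powr_minus_divide)
      ultimately show "\<mu> < wt \<alpha> (t M) m m"
        using \<Gamma> unfolding \<mu>_def by (simp add: pos_less_divide_eq mult_ac)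
    qed (rule \<mu>)
  qed
  have TM: "t M M = T" if "M \<in> Ms" for M using meshes[OF that] by (simp add: temporal_mesh_def)
  define p where "p = min (\<alpha> + 1) ((2 - \<alpha>) / r + \<alpha> - \<sigma>)"
  obtain C1 where C1: "0 < C1" and
    bound: "\<And>M m. M \<in> Ms \<Longrightarrow> m \<in> {1..M} \<Longrightarrow>
      t M 1 powr (\<sigma> - \<alpha>) * L1_solve \<alpha> \<mu> (t M) (\<lambda>j. (t M 1 / t M j) powr p) m \<le> C1 * error_bound \<alpha> \<sigma> r M (t M) m"
    using uniform_error_bound[OF \<alpha> \<mu> r c(2,3) T \<sigma>'(1) op TM t1] unfolding p_def by metis
  obtain C0 where C0: "0 < C0" "\<And>l s. l \<in> {0, 1, 2} \<Longrightarrow> s \<in> {0<..T} \<Longrightarrow> L2_norm \<Omega> (du l s) \<le> C0 * (1 + s powr (\<sigma> - real l))"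
    using time_regularity by blast
  \<comment> \<open>As \<sigma> < 2, the power s^(\<sigma>-2) is bounded away from 0 on (0, T], so
    it absorbs the summand 1 of the regularity bound.\<close>
  define C2 where "C2 = C0 * (T powr (2 - \<sigma>) + 1)"
  have C2: "0 \<le> C2" using C0 by (simp add: C2_def)
  have reg: "L2_norm \<Omega> (du 2 s) \<le> C2 * s powr (\<sigma> - 2)" if s: "s \<in> {0<..T}" for s
  proof -
    have "1 = s powr (2 - \<sigma>) * s powr (\<sigma> - 2)" using s by (simp flip: powr_add)
    also have "\<dots> \<le> T powr (2 - \<sigma>) * s powr (\<sigma> - 2)"
      using s \<sigma>' by (intro mult_right_mono powr_mono2) auto
    finally have "1 + s powr (\<sigma> - 2) \<le> (T powr (2 - \<sigma>) + 1) * s powr (\<sigma> - 2)" by (simp add: algebra_simps)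
    then have "C0 * (1 + s powr (\<sigma> - 2)) \<le> C0 * ((T powr (2 - \<sigma>) + 1) * s powr (\<sigma> - 2))"
      using C0(1) by (intro mult_left_mono) auto
    with C0(2)[of 2 s] s show ?thesis by (simp add: C2_def mult.assoc)
  qed
  \<comment> \<open>The absolute value provides B \<ge> 0 without a look into the constant, and the
    1 added to B C1 makes the final constant positive even for B = 0.\<close>
  define B where "B = \<bar>(1 - \<alpha>) * (C2 * graded_mesh.truncation_bound_const \<alpha> r c3 \<sigma>)\<bar>"
  have "L2_norm \<Omega> (\<lambda>x. u (t M m) x - U m x) \<le> (B * C1 + 1) * error_bound \<alpha> \<sigma> r M (t M) m"
    if M: "M \<in> Ms" and U: "semidiscrete_solution \<Omega> \<alpha> a b f u0 M (t M) U" and m: "m \<in> {1..M}" for M U m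
  proof -
    interpret graded_op \<alpha> "t M" M r c3 \<mu> by (rule op[OF M])
    define v where "v j = L2_norm \<Omega> (\<lambda>x. u (t M j) x - U j x)" for j
    have du1: "L2_time_derivative \<Omega> T u (du 1)" "L2_time_derivative \<Omega> T (du 1) (du 2)"
      using time_derivatives(2)[of 0] time_derivatives(2)[of 1] time_derivatives(1) by (auto simp: numeral_2_eq_2)
    have pe: "truncation_exponent \<sigma> = p" by (simp add: p_def truncation_exponent_def)
    have ineq: "v 0 = 0" "D v j - \<mu> * v j \<le> B * (t M 1 powr (\<sigma> - \<alpha>) * (t M 1 / t M j) powr p)"
      if j: "j \<in> {1..M}" for j
    proof -
      note E = error_inequality[OF \<Omega> gmesh[OF M] TM[OF M] constants(1,3,4) _ a_lipschitz b_lipschitz f_one_sided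
        solution \<sigma>' du1 C2 reg gradient_bound U j]
      show "v 0 = 0" unfolding v_def by (rule E(1)) (use a_bounds in auto)
      have "D v j - \<mu> * v j \<le> (1 - \<alpha>) * (C2 * truncation_bound_const \<sigma>) *
          (t M 1 powr (\<sigma> - \<alpha>) * (t M 1 / t M j) powr p)"
        unfolding v_def \<mu>_def lam pe[symmetric] by (rule E(2)) (use a_bounds in auto)
      also have "\<dots> \<le> B * (t M 1 powr (\<sigma> - \<alpha>) * (t M 1 / t M j) powr p)"
        unfolding B_def by (intro mult_right_mono) auto
      finally show "D v j - \<mu> * v j \<le> B * (t M 1 powr (\<sigma> - \<alpha>) * (t M 1 / t M j) powr p)" .
    qed
    have "v m \<le> J (\<lambda>j. (B * t M 1 powr (\<sigma> - \<alpha>)) * (t M 1 / t M j) powr p) m"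
      using ineq m by (intro le_J) (auto simp: mult.assoc)
    also have "\<dots> = B * (t M 1 powr (\<sigma> - \<alpha>) * J (\<lambda>j. (t M 1 / t M j) powr p) m)"
      using m by (simp only: J_cmult atLeastAtMost_iff mult.assoc)
    also have "\<dots> \<le> B * (C1 * error_bound \<alpha> \<sigma> r M (t M) m)"
      using bound[OF M m] by (intro mult_left_mono) (auto simp: B_def)
    also have "\<dots> \<le> (B * C1 + 1) * error_bound \<alpha> \<sigma> r M (t M) m"
      using error_bound_pos[OF M_pos m, of \<sigma> r] by (simp add: algebra_simps)
    finally show ?thesis by (simp add: v_def)
  qed
  moreover have "0 < B * C1 + 1" using C1 by (simp add: B_def add_nonneg_pos)
  ultimately show ?thesis by (intro exI[of _ "B * C1 + 1"]) blast
qed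

end
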